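(* Let $F$ be a Finsler metric on a smooth manifold $M$ with fundamental tensor $g_w$, geodesic spray $S$ and canonical connection $\Gamma_S$. Let $\mathcal{P}\subset M$ be a submanifold, $x\in\mathcal{P}$, and let $\eta\in T_xM\setminus 0$ be normal to $\mathcal{P}$. Let ${\rm b}_\eta$ be the symmetric bilinear form on $T_x\mathcal{P}$ such that, under the isomorphism $T_\eta(TM\setminus 0)\simeq T_xM\oplus T_xM$, $X\mapsto({\rm d}\pi(X),i_\eta^{-1}\mathscr{V}X)$, $$T_\eta\nu(\mathcal{P})=\{(u,v):u\in T_x\mathcal{P}\ \text{and}\ g_\eta(v,\cdot)|_{T_x\mathcal{P}}+{\rm b}_\eta(u,\cdot)=0\}.$$ Then for any lift $\nabla$ of $\Gamma_S$ satisfying conditions (M1) and (M2) (defined in the context), ${\rm b}_\eta$ coincides with the second fundamental form ${\rm h}^{\mathcal{P}}_\eta$ constructed from $\nabla$.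
   Context: Let $\pi:TM\setminus 0\to M$ be the tangent bundle with the zero section removed, $\mathscr{V}TM=\ker({\rm d}\pi)\subset T(TM\setminus 0)$ the vertical bundle, regarded as a vector bundle over $TM\setminus 0$. For $w\in TM\setminus 0$, $i_w:T_{\pi(w)}M\to\mathscr{V}_wTM$, $i_w(u)=\frac{d}{dt}|_{t=0}(w+tu)$. The canonical vector field is $C(w)=i_w(w)$, and $\mathscr{J}(X)=i_w({\rm d}\pi(X))$ for $X\in T_w(TM\setminus 0)$. A Finsler metric is a function $F:TM\to[0,\infty)$, smooth on $TM\setminus 0$, with $F(u)=0$ iff $u=0$, $F(\lambda u)=\lambda F(u)$ for $\lambda>0$, and such that for each $w\in T_xM\setminus 0$ the fundamental tensor $g_w(u,v)=\frac12\frac{\partial^2}{\partial t\partial s}|_{(0,0)}F(w+su+tv)^2$ is positive definite on $T_xM$. Via $i_w$, $g$ is regarded as a Riemannian metric on the vector bundle $\mathscr{V}TM\to TM\setminus 0$. The geodesic spray $S$ of $F$ is the vector field on $TM\setminus 0$ with ${\rm d}(\frac12F^2)=\omega_F(S,\cdot)$, where $\omega_F$ is the pull-back of the canonical symplectic form $\sum dx^i\wedge dp_i$ of $T^*M$ by the Legendre transformation $w\mapsto g_w(w,\cdot)$; it satisfies $\mathscr{J}(S)=C$ and $[C,S]=S$. The canonical connection is $\Gamma_S=-[S,\mathscr{J}]$, i.e. $\Gamma_S(Y)=\mathscr{J}[S,Y]-[S,\mathscr{J}(Y)]$; $\Gamma_S^2={\bf I}$, $\ker(\Gamma_S+{\bf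 I})=\mathscr{V}TM$. With $\mathscr{H}TM=\ker(\Gamma_S-{\bf I})$ (horizontal vectors), $T(TM\setminus 0)=\mathscr{H}TM\oplus\mathscr{V}TM$, with projections $\mathscr{H},\mathscr{V}$. $u^{\mathfrak h}$ is the horizontal lift at $w$ of $u\in T_{\pi(w)}M$. A linear connection $\nabla$ on $\mathscr{V}TM\to TM\setminus 0$ is a lift of $\Gamma_S$ if $\nabla_XC=\mathscr{V}X$ for all $X$. Its torsion is ${\rm T}(X,Y)=\nabla_X\mathscr{J}(Y)-\nabla_Y\mathscr{J}(X)-\mathscr{J}[X,Y]$. Put $\mathscr{C}(X,Y)={\rm T}(\mathscr{J}(X),Y)$. Conditions: (M1) $(\nabla_Xg)(Z,C)=0$ for all $X$ and all vertical $Z$; (M2) $g(\mathscr{C}(X,Y),C)=0$ for all $X,Y$. For $w\in T_xM\setminus 0$, $u\in T_xM$ and $V$ a vector field near $x$, $D^w_uV=i_w^{-1}\nabla_{u^{\mathfrak h}}V^{\mathfrak v}$, where $V^{\mathfrak v}(z)=i_z(V(\pi(z)))$; as for any affine connection, this only depends on $V$ along a curve with velocity $u$. A vector $\eta\in T_xM\setminus 0$, $x\in\mathcal{P}$, is normal to $\mathcal{P}$ if $g_\eta(\eta,u)=0$ for all $u\in T_x\mathcal{P}$; $\nu(\mathcal{P})\subset TM\setminus 0$ is the set of all normal vectors (a submanifold, Lagrangian for $\omega_F$, which is why ${\rm b}_\eta$ exists and is unique). The second fundamental form is ${\rm h}^{\mathcal{P}}_\eta(u,v)=\frac12g_\eta(\eta,D^\eta_UV+D^\eta_VU)$,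 $u,v\in T_x\mathcal{P}$, where $U,V\in\mathfrak{X}(\mathcal{P})$ are any extensions of $u,v$ (well defined, symmetric bilinear). *)

theory Defs
  imports "HOL-Analysis.Analysis"
begin

section \<open>Smooth maps on open subsets of normed spaces\<close>

primrec Ck_on ::
  "nat \<Rightarrow> 'v::real_normed_vector set \<Rightarrow> ('v \<Rightarrow> 'w::real_normed_vector) \<Rightarrow> bool" where
  "Ck_on 0 S f \<longleftrightarrow> continuous_on S f"
| "Ck_on (Suc k) S f \<longleftrightarrow>
     (\<forall>x\<in>S. f differentiable (at x)) \<and>
     (\<forall>v. Ck_on k S (\<lambda>x. frechet_derivative f (at x) v))"

text \<open>Intended for open \<open>S\<close> only.\<close>

definition smooth_on :: "'v::real_normed_vector set \<Rightarrow> ('v \<Rightarrow> 'w::real_normed_vector) \<Rightarrow> bool" where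
  "smooth_on S f \<longleftrightarrow> (\<forall>k. Ck_on k S f)"


section \<open>Smooth manifolds\<close>

text \<open>
  A manifold is given by an atlas: a family, over an arbitrary index type, of pairs
  (chart domain, chart map). The set of points is the union of the chart domains, and its
  topology is the one making all the charts homeomorphisms onto open sets. The index type is
  kept when passing to the tangent or cotangent bundle.
\<close>

type_synonym ('i, 'a, 'e) atlas = "'i \<Rightarrow> 'a set \<times> ('a \<Rightarrow> 'e)"

definition cdom :: "('i, 'a, 'e) atlas \<Rightarrow> 'i \<Rightarrow> 'a set" where
  "cdom A i = fst (A i)"

definition cmap :: "('i, 'a, 'e) atlas \<Rightarrow> 'i \<Rightarrow> 'a \<Rightarrow> 'e" where
  "cmap A i = snd (A i)"

definition cinv :: "('i, 'a, 'e) atlas \<Rightarrow> 'i \<Rightarrow> 'e \<Rightarrow> 'a" where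
  "cinv A i = inv_into (cdom A i) (cmap A i)"

definition transition :: "('i, 'a, 'e) atlas \<Rightarrow> 'i \<Rightarrow> 'i \<Rightarrow> 'e \<Rightarrow> 'e" where
  "transition A i j = cmap A j \<circ> cinv A i"

definition points :: "('i, 'a, 'e) atlas \<Rightarrow> 'a set" where
  "points A = (\<Union>i. cdom A i)"

definition some_chart :: "('i, 'a, 'e) atlas \<Rightarrow> 'a \<Rightarrow> 'i" where
  "some_chart A p = (SOME i. p \<in> cdom A i)"

definition restrict_atlas :: "('i, 'a, 'e) atlas \<Rightarrow> 'a set \<Rightarrow> ('i, 'a, 'e) atlas" where
  "restrict_atlas A W = (\<lambda>i. (cdom A i \<inter> W, cmap A i))"

definition manifold_topology :: "('i, 'a, 'e::euclidean_space) atlas \<Rightarrow> 'a topology" where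
  "manifold_topology A =
     topology (\<lambda>W. W \<subseteq> points A \<and> (\<forall>i. open (cmap A i ` (W \<inter> cdom A i))))"

definition smooth_atlas :: "('i, 'a, 'e::euclidean_space) atlas \<Rightarrow> bool" where
  "smooth_atlas A \<longleftrightarrow>
     (\<forall>i. inj_on (cmap A i) (cdom A i)) \<and>
     (\<forall>i j. open (cmap A i ` (cdom A i \<inter> cdom A j)) \<and>
            smooth_on (cmap A i ` (cdom A i \<inter> cdom A j)) (transition A i j))"

definition smooth_manifold :: "('i, 'a, 'e::euclidean_space) atlas \<Rightarrow> bool" where
  "smooth_manifold A \<longleftrightarrow>
     smooth_atlas A \<and> Hausdorff_space (manifold_topology A) \<and>
     second_countable (manifold_topology A)"

definition open_nbhd :: "('i, 'a, 'e::euclidean_space) atlas \<Rightarrow> 'a \<Rightarrow> 'a set \<Rightarrow> bool" where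
  "open_nbhd A p W \<longleftrightarrow> openin (manifold_topology A) W \<and> p \<in> W"

definition smooth_fun ::
  "('i, 'a, 'e::euclidean_space) atlas \<Rightarrow> 'a set \<Rightarrow> ('a \<Rightarrow> 'v::real_normed_vector) \<Rightarrow> bool" where
  "smooth_fun A W f \<longleftrightarrow> (\<forall>i. smooth_on (cmap A i ` (W \<inter> cdom A i)) (f \<circ> cinv A i))"

text \<open>Openness of the coordinate domains expresses the continuity of \<open>f\<close> on the open set \<open>W\<close>.\<close>

definition smooth_map ::
  "('i, 'a, 'e::euclidean_space) atlas \<Rightarrow> ('j, 'b, 'f::euclidean_space) atlas \<Rightarrow>
   'a set \<Rightarrow> ('a \<Rightarrow> 'b) \<Rightarrow> bool" where
  "smooth_map A B W f \<longleftrightarrow>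
     f ` W \<subseteq> points B \<and>
     (\<forall>i j. open (cmap A i ` {p \<in> W \<inter> cdom A i. f p \<in> cdom B j}) \<and>
            smooth_on (cmap A i ` {p \<in> W \<inter> cdom A i. f p \<in> cdom B j})
              (cmap B j \<circ> f \<circ> cinv A i))"

definition real_line :: "(unit, real, real) atlas" where
  "real_line = (\<lambda>_. (UNIV, \<lambda>t. t))"


section \<open>Tangent vectors\<close>

text \<open>
  A tangent vector is a base point together with its components in every chart, related by the
  derivatives of the transition maps; components in charts not containing the base point are 0.
\<close>

type_synonym ('a, 'i, 'e) tvec = "'a \<times> ('i \<Rightarrow> 'e)"

definition tangent_space ::
  "('i, 'a, 'e::euclidean_space) atlas \<Rightarrow> 'a \<Rightarrow> ('a, 'i, 'e) tvec set" where
  "tangent_space A p =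
     {X. fst X = p \<and> p \<in> points A \<and>
         (\<forall>i. p \<notin> cdom A i \<longrightarrow> snd X i = 0) \<and>
         (\<forall>i j. p \<in> cdom A i \<inter> cdom A j \<longrightarrow>
            snd X j = frechet_derivative (transition A i j) (at (cmap A i p)) (snd X i))}"

definition tzero :: "'a \<Rightarrow> ('a, 'i, 'e::euclidean_space) tvec" where
  "tzero p = (p, \<lambda>_. 0)"

definition tadd ::
  "('a, 'i, 'e::euclidean_space) tvec \<Rightarrow> ('a, 'i, 'e) tvec \<Rightarrow> ('a, 'i, 'e) tvec" where
  "tadd X Y = (fst X, \<lambda>i. snd X i + snd Y i)"

definition tsub ::
  "('a, 'i, 'e::euclidean_space) tvec \<Rightarrow> ('a, 'i, 'e) tvec \<Rightarrow> ('a, 'i, 'e) tvec" where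
  "tsub X Y = (fst X, \<lambda>i. snd X i - snd Y i)"

definition tscale :: "real \<Rightarrow> ('a, 'i, 'e::euclidean_space) tvec \<Rightarrow> ('a, 'i, 'e) tvec" where
  "tscale c X = (fst X, \<lambda>i. c *\<^sub>R snd X i)"

definition tangent_atlas ::
  "('i, 'a, 'e::euclidean_space) atlas \<Rightarrow> ('i, ('a, 'i, 'e) tvec, 'e \<times> 'e) atlas" where
  "tangent_atlas A =
     (\<lambda>i. ((\<Union>p\<in>cdom A i. tangent_space A p), \<lambda>X. (cmap A i (fst X), snd X i)))"

text \<open>The manifold \<open>TM \ 0\<close>.\<close>

definition slit ::
  "('i, 'a, 'e::euclidean_space) atlas \<Rightarrow> ('i, ('a, 'i, 'e) tvec, 'e \<times> 'e) atlas" where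
  "slit A = restrict_atlas (tangent_atlas A) {w. w \<noteq> tzero (fst w)}"

definition tangent_map ::
  "('i, 'a, 'e::euclidean_space) atlas \<Rightarrow> ('j, 'b, 'f::euclidean_space) atlas \<Rightarrow>
   ('a \<Rightarrow> 'b) \<Rightarrow> ('a, 'i, 'e) tvec \<Rightarrow> ('b, 'j, 'f) tvec" where
  "tangent_map A B f X =
     (let p = fst X; i = some_chart A p in
       (f p, \<lambda>j. if f p \<in> cdom B j
                 then frechet_derivative (cmap B j \<circ> f \<circ> cinv A i) (at (cmap A i p)) (snd X i)
                 else 0))"

definition dir_deriv ::
  "('i, 'a, 'e::euclidean_space) atlas \<Rightarrow> ('a \<Rightarrow> real) \<Rightarrow> ('a, 'i, 'e) tvec \<Rightarrow> real" where
  "dir_deriv A f X =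
     (let p = fst X; i = some_chart A p in
       frechet_derivative (f \<circ> cinv A i) (at (cmap A i p)) (snd X i))"

definition velocity ::
  "('i, 'a, 'e::euclidean_space) atlas \<Rightarrow> (real \<Rightarrow> 'a) \<Rightarrow> real \<Rightarrow> ('a, 'i, 'e) tvec" where
  "velocity A c t =
     (c t, \<lambda>i. if c t \<in> cdom A i then vector_derivative (cmap A i \<circ> c) (at t) else 0)"

definition vector_field ::
  "('i, 'a, 'e::euclidean_space) atlas \<Rightarrow> 'a set \<Rightarrow> ('a \<Rightarrow> ('a, 'i, 'e) tvec) \<Rightarrow> bool" where
  "vector_field A W X \<longleftrightarrow>
     (\<forall>p\<in>W. X p \<in> tangent_space A p) \<and>
     (\<forall>i. smooth_on (cmap A i ` (W \<inter> cdom A i)) (\<lambda>y. snd (X (cinv A i y)) i))"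

definition field_near ::
  "('i, 'a, 'e::euclidean_space) atlas \<Rightarrow> 'a \<Rightarrow> ('a \<Rightarrow> ('a, 'i, 'e) tvec) \<Rightarrow> bool" where
  "field_near A p X \<longleftrightarrow> (\<exists>W. open_nbhd A p W \<and> vector_field A W X)"

definition bracket ::
  "('i, 'a, 'e::euclidean_space) atlas \<Rightarrow> ('a \<Rightarrow> ('a, 'i, 'e) tvec) \<Rightarrow>
   ('a \<Rightarrow> ('a, 'i, 'e) tvec) \<Rightarrow> 'a \<Rightarrow> ('a, 'i, 'e) tvec" where
  "bracket A X Y p =
     (p, \<lambda>i. if p \<in> cdom A i
             then frechet_derivative (\<lambda>y. snd (Y (cinv A i y)) i) (at (cmap A i p)) (snd (X p) i)
                - frechet_derivative (\<lambda>y. snd (X (cinv A i y)) i) (at (cmap A i p)) (snd (Y p) i)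
             else 0)"


section \<open>Submanifolds\<close>

definition embedded_submanifold ::
  "('i, 'a, 'e::euclidean_space) atlas \<Rightarrow> 'a set \<Rightarrow> bool" where
  "embedded_submanifold A P \<longleftrightarrow>
     P \<subseteq> points A \<and>
     (\<forall>p\<in>P. \<exists>W \<psi> L.
        open_nbhd A p W \<and> inj_on \<psi> W \<and> open (\<psi> ` W) \<and> smooth_fun A W \<psi> \<and>
        (\<forall>i. open (\<psi> ` (W \<inter> cdom A i)) \<and>
             smooth_on (\<psi> ` (W \<inter> cdom A i)) (cmap A i \<circ> inv_into W \<psi>)) \<and>
        subspace (L :: 'e set) \<and> \<psi> ` (W \<inter> P) = \<psi> ` W \<inter> L)"

text \<open>For an embedded submanifold \<open>N\<close> these are the tangent vectors of \<open>N\<close>, viewed in the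
  ambient manifold.\<close>

definition tangent_space_of ::
  "('i, 'a, 'e::euclidean_space) atlas \<Rightarrow> 'a set \<Rightarrow> 'a \<Rightarrow> ('a, 'i, 'e) tvec set" where
  "tangent_space_of A N p =
     {velocity A c 0 | c. c 0 = p \<and>
        (\<exists>\<epsilon>>0. smooth_map real_line A {-\<epsilon><..<\<epsilon>} c \<and> c ` {-\<epsilon><..<\<epsilon>} \<subseteq> N)}"

definition symmetric_bilinear_on ::
  "('a, 'i, 'e::euclidean_space) tvec set \<Rightarrow>
   (('a, 'i, 'e) tvec \<Rightarrow> ('a, 'i, 'e) tvec \<Rightarrow> real) \<Rightarrow> bool" where
  "symmetric_bilinear_on T b \<longleftrightarrow>
     (\<forall>u\<in>T. \<forall>v\<in>T. b u v = b v u) \<and>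
     (\<forall>u\<in>T. \<forall>u'\<in>T. \<forall>v\<in>T. b (tadd u u') v = b u v + b u' v) \<and>
     (\<forall>c. \<forall>u\<in>T. \<forall>v\<in>T. b (tscale c u) v = c * b u v)"


section \<open>The vertical bundle of \<open>TM \ 0\<close>\<close>

text \<open>From here on, \<open>A\<close> is the atlas of \<open>M\<close>; a vector in \<open>T(TM \ 0)\<close> is an element of a tangent
  space of \<open>slit A\<close>.\<close>

type_synonym ('a, 'i, 'e) ttvec = "(('a, 'i, 'e) tvec, 'i, 'e \<times> 'e) tvec"

definition d_proj ::
  "('i, 'a, 'e::euclidean_space) atlas \<Rightarrow> ('a, 'i, 'e) ttvec \<Rightarrow> ('a, 'i, 'e) tvec" where
  "d_proj A = tangent_map (slit A) A fst"

definition vertical_space ::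
  "('i, 'a, 'e::euclidean_space) atlas \<Rightarrow> ('a, 'i, 'e) tvec \<Rightarrow> ('a, 'i, 'e) ttvec set" where
  "vertical_space A w = {X \<in> tangent_space (slit A) w. d_proj A X = tzero (fst w)}"

text \<open>\<open>i_w(u)\<close>.\<close>

definition vert_lift ::
  "('i, 'a, 'e::euclidean_space) atlas \<Rightarrow> ('a, 'i, 'e) tvec \<Rightarrow> ('a, 'i, 'e) tvec \<Rightarrow>
   ('a, 'i, 'e) ttvec" where
  "vert_lift A w u = velocity (slit A) (\<lambda>t. tadd w (tscale t u)) 0"

definition vert_inv ::
  "('i, 'a, 'e::euclidean_space) atlas \<Rightarrow> ('a, 'i, 'e) ttvec \<Rightarrow> ('a, 'i, 'e) tvec" where
  "vert_inv A X = inv_into (tangent_space A (fst (fst X))) (vert_lift A (fst X)) X"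

definition canonical_field ::
  "('i, 'a, 'e::euclidean_space) atlas \<Rightarrow> ('a, 'i, 'e) tvec \<Rightarrow> ('a, 'i, 'e) ttvec" where
  "canonical_field A w = vert_lift A w w"

definition J_map ::
  "('i, 'a, 'e::euclidean_space) atlas \<Rightarrow> ('a, 'i, 'e) ttvec \<Rightarrow> ('a, 'i, 'e) ttvec" where
  "J_map A X = vert_lift A (fst X) (d_proj A X)"

definition vertical_field ::
  "('i, 'a, 'e::euclidean_space) atlas \<Rightarrow> ('a, 'i, 'e) tvec set \<Rightarrow>
   (('a, 'i, 'e) tvec \<Rightarrow> ('a, 'i, 'e) ttvec) \<Rightarrow> bool" where
  "vertical_field A W Z \<longleftrightarrow> vector_field (slit A) W Z \<and> (\<forall>w\<in>W. Z w \<in> vertical_space A w)"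

definition vertical_field_near ::
  "('i, 'a, 'e::euclidean_space) atlas \<Rightarrow> ('a, 'i, 'e) tvec \<Rightarrow>
   (('a, 'i, 'e) tvec \<Rightarrow> ('a, 'i, 'e) ttvec) \<Rightarrow> bool" where
  "vertical_field_near A w Z \<longleftrightarrow> (\<exists>W. open_nbhd (slit A) w W \<and> vertical_field A W Z)"


section \<open>Finsler metrics and the geodesic spray\<close>

definition fundamental_tensor ::
  "(('a, 'i, 'e::euclidean_space) tvec \<Rightarrow> real) \<Rightarrow>
   ('a, 'i, 'e) tvec \<Rightarrow> ('a, 'i, 'e) tvec \<Rightarrow> ('a, 'i, 'e) tvec \<Rightarrow> real" where
  "fundamental_tensor F w u v =
     1/2 * deriv (\<lambda>t. deriv (\<lambda>s. (F (tadd (tadd w (tscale s u)) (tscale t v)))\<^sup>2) 0) 0"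

definition finsler_metric ::
  "('i, 'a, 'e::euclidean_space) atlas \<Rightarrow> (('a, 'i, 'e) tvec \<Rightarrow> real) \<Rightarrow> bool" where
  "finsler_metric A F \<longleftrightarrow>
     (\<forall>u\<in>points (tangent_atlas A). F u \<ge> 0) \<and>
     smooth_fun (slit A) (points (slit A)) F \<and>
     (\<forall>u\<in>points (tangent_atlas A). F u = 0 \<longleftrightarrow> u = tzero (fst u)) \<and>
     (\<forall>u\<in>points (tangent_atlas A). \<forall>c>0. F (tscale c u) = c * F u) \<and>
     (\<forall>w\<in>points (slit A). \<forall>u\<in>tangent_space A (fst w).
        u \<noteq> tzero (fst w) \<longrightarrow> fundamental_tensor F w u u > 0)"

text \<open>Covectors are linear functionals on a tangent space, extended by 0. In the chart \<open>i\<close> the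
  functional is represented by the vector of its coefficients \<open>p_b\<close>, \<open>b \<in> Basis\<close>.\<close>

type_synonym ('a, 'i, 'e) cvec = "'a \<times> (('a, 'i, 'e) tvec \<Rightarrow> real)"

definition cotangent_space ::
  "('i, 'a, 'e::euclidean_space) atlas \<Rightarrow> 'a \<Rightarrow> ('a, 'i, 'e) cvec set" where
  "cotangent_space A p =
     {\<alpha>. fst \<alpha> = p \<and> p \<in> points A \<and>
         (\<forall>u. u \<notin> tangent_space A p \<longrightarrow> snd \<alpha> u = 0) \<and>
         (\<forall>u\<in>tangent_space A p. \<forall>v\<in>tangent_space A p.
            snd \<alpha> (tadd u v) = snd \<alpha> u + snd \<alpha> v) \<and>
         (\<forall>c. \<forall>u\<in>tangent_space A p. snd \<alpha> (tscale c u) = c * snd \<alpha> u)}"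

definition coord_vec ::
  "('i, 'a, 'e::euclidean_space) atlas \<Rightarrow> 'i \<Rightarrow> 'a \<Rightarrow> 'e \<Rightarrow> ('a, 'i, 'e) tvec" where
  "coord_vec A i p a = (THE u. u \<in> tangent_space A p \<and> snd u i = a)"

definition cotangent_atlas ::
  "('i, 'a, 'e::euclidean_space) atlas \<Rightarrow> ('i, ('a, 'i, 'e) cvec, 'e \<times> 'e) atlas" where
  "cotangent_atlas A =
     (\<lambda>i. ((\<Union>p\<in>cdom A i. cotangent_space A p),
           \<lambda>\<alpha>. (cmap A i (fst \<alpha>), \<Sum>b\<in>Basis. snd \<alpha> (coord_vec A i (fst \<alpha>) b) *\<^sub>R b)))"

text \<open>The form \<open>\<Sum> dx^i \<and> dp_i\<close> on \<open>T\<^sup>*M\<close>.\<close>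

definition canonical_symplectic ::
  "('i, 'a, 'e::euclidean_space) atlas \<Rightarrow>
   (('a, 'i, 'e) cvec, 'i, 'e \<times> 'e) tvec \<Rightarrow> (('a, 'i, 'e) cvec, 'i, 'e \<times> 'e) tvec \<Rightarrow> real" where
  "canonical_symplectic A X Y =
     (let i = some_chart (cotangent_atlas A) (fst X) in
       fst (snd X i) \<bullet> snd (snd Y i) - fst (snd Y i) \<bullet> snd (snd X i))"

definition legendre ::
  "('i, 'a, 'e::euclidean_space) atlas \<Rightarrow> (('a, 'i, 'e) tvec \<Rightarrow> real) \<Rightarrow>
   ('a, 'i, 'e) tvec \<Rightarrow> ('a, 'i, 'e) cvec" where
  "legendre A F w =
     (fst w, \<lambda>u. if u \<in> tangent_space A (fst w) then fundamental_tensor F w w u else 0)"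

definition omega_F ::
  "('i, 'a, 'e::euclidean_space) atlas \<Rightarrow> (('a, 'i, 'e) tvec \<Rightarrow> real) \<Rightarrow>
   ('a, 'i, 'e) ttvec \<Rightarrow> ('a, 'i, 'e) ttvec \<Rightarrow> real" where
  "omega_F A F X Y =
     canonical_symplectic A
       (tangent_map (slit A) (cotangent_atlas A) (legendre A F) X)
       (tangent_map (slit A) (cotangent_atlas A) (legendre A F) Y)"

definition geodesic_spray ::
  "('i, 'a, 'e::euclidean_space) atlas \<Rightarrow> (('a, 'i, 'e) tvec \<Rightarrow> real) \<Rightarrow>
   (('a, 'i, 'e) tvec \<Rightarrow> ('a, 'i, 'e) ttvec) \<Rightarrow> bool" where
  "geodesic_spray A F S \<longleftrightarrow>
     vector_field (slit A) (points (slit A)) S \<and>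
     (\<forall>w\<in>points (slit A). \<forall>X\<in>tangent_space (slit A) w.
        dir_deriv (slit A) (\<lambda>z. 1/2 * (F z)\<^sup>2) X = omega_F A F (S w) X)"


section \<open>The canonical connection of a spray\<close>

definition Gamma_field ::
  "('i, 'a, 'e::euclidean_space) atlas \<Rightarrow> (('a, 'i, 'e) tvec \<Rightarrow> ('a, 'i, 'e) ttvec) \<Rightarrow>
   (('a, 'i, 'e) tvec \<Rightarrow> ('a, 'i, 'e) ttvec) \<Rightarrow> ('a, 'i, 'e) tvec \<Rightarrow> ('a, 'i, 'e) ttvec" where
  "Gamma_field A S Y w =
     tsub (J_map A (bracket (slit A) S Y w)) (bracket (slit A) S (\<lambda>z. J_map A (Y z)) w)"

text \<open>\<open>\<Gamma>_S\<close> is tensorial, so its value on a single vector does not depend on the extension.\<close>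

definition Gamma ::
  "('i, 'a, 'e::euclidean_space) atlas \<Rightarrow> (('a, 'i, 'e) tvec \<Rightarrow> ('a, 'i, 'e) ttvec) \<Rightarrow>
   ('a, 'i, 'e) ttvec \<Rightarrow> ('a, 'i, 'e) ttvec" where
  "Gamma A S X =
     Gamma_field A S (SOME Y. field_near (slit A) (fst X) Y \<and> Y (fst X) = X) (fst X)"

definition horizontal_space ::
  "('i, 'a, 'e::euclidean_space) atlas \<Rightarrow> (('a, 'i, 'e) tvec \<Rightarrow> ('a, 'i, 'e) ttvec) \<Rightarrow>
   ('a, 'i, 'e) tvec \<Rightarrow> ('a, 'i, 'e) ttvec set" where
  "horizontal_space A S w = {X \<in> tangent_space (slit A) w. Gamma A S X = X}"

definition vert_proj ::
  "('i, 'a, 'e::euclidean_space) atlas \<Rightarrow> (('a, 'i, 'e) tvec \<Rightarrow> ('a, 'i, 'e) ttvec) \<Rightarrow>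
   ('a, 'i, 'e) ttvec \<Rightarrow> ('a, 'i, 'e) ttvec" where
  "vert_proj A S X =
     (THE V. V \<in> vertical_space A (fst X) \<and> tsub X V \<in> horizontal_space A S (fst X))"

definition hor_lift ::
  "('i, 'a, 'e::euclidean_space) atlas \<Rightarrow> (('a, 'i, 'e) tvec \<Rightarrow> ('a, 'i, 'e) ttvec) \<Rightarrow>
   ('a, 'i, 'e) tvec \<Rightarrow> ('a, 'i, 'e) tvec \<Rightarrow> ('a, 'i, 'e) ttvec" where
  "hor_lift A S w u = (THE X. X \<in> horizontal_space A S w \<and> d_proj A X = u)"


section \<open>Linear connections on the vertical bundle\<close>

text \<open>
  A linear connection is given by its values \<open>\<nabla>_X Z\<close> for a vector \<open>X \<in> T_w(TM \ 0)\<close> and a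
  vertical field \<open>Z\<close> that is smooth near \<open>w\<close>. Locality in \<open>Z\<close> is listed since fields are
  represented by total functions.
\<close>

type_synonym ('a, 'i, 'e) conn =
  "('a, 'i, 'e) ttvec \<Rightarrow> (('a, 'i, 'e) tvec \<Rightarrow> ('a, 'i, 'e) ttvec) \<Rightarrow> ('a, 'i, 'e) ttvec"

definition linear_connection ::
  "('i, 'a, 'e::euclidean_space) atlas \<Rightarrow> ('a, 'i, 'e) conn \<Rightarrow> bool" where
  "linear_connection A D \<longleftrightarrow>
     (\<forall>w\<in>points (slit A). \<forall>X\<in>tangent_space (slit A) w. \<forall>Z. vertical_field_near A w Z \<longrightarrow>
        D X Z \<in> vertical_space A w \<and>
        (\<forall>X'\<in>tangent_space (slit A) w. D (tadd X X') Z = tadd (D X Z) (D X' Z)) \<and>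
        (\<forall>c. D (tscale c X) Z = tscale c (D X Z)) \<and>
        (\<forall>Z'. vertical_field_near A w Z' \<longrightarrow>
           D X (\<lambda>z. tadd (Z z) (Z' z)) = tadd (D X Z) (D X Z')) \<and>
        (\<forall>f W. open_nbhd (slit A) w W \<and> smooth_fun (slit A) W f \<longrightarrow>
           D X (\<lambda>z. tscale (f z) (Z z)) =
             tadd (tscale (dir_deriv (slit A) f X) (Z w)) (tscale (f w) (D X Z))) \<and>
        (\<forall>Z' W. open_nbhd (slit A) w W \<and> (\<forall>z\<in>W. Z' z = Z z) \<longrightarrow> D X Z' = D X Z)) \<and>
     (\<forall>W X Z. openin (manifold_topology (slit A)) W \<and> vector_field (slit A) W X \<and>
        vertical_field A W Z \<longrightarrow> vertical_field A W (\<lambda>z. D (X z) Z))"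

definition lift_of_Gamma ::
  "('i, 'a, 'e::euclidean_space) atlas \<Rightarrow> (('a, 'i, 'e) tvec \<Rightarrow> ('a, 'i, 'e) ttvec) \<Rightarrow>
   ('a, 'i, 'e) conn \<Rightarrow> bool" where
  "lift_of_Gamma A S D \<longleftrightarrow>
     linear_connection A D \<and>
     (\<forall>w\<in>points (slit A). \<forall>X\<in>tangent_space (slit A) w.
        D X (canonical_field A) = vert_proj A S X)"

definition torsion ::
  "('i, 'a, 'e::euclidean_space) atlas \<Rightarrow> ('a, 'i, 'e) conn \<Rightarrow>
   (('a, 'i, 'e) tvec \<Rightarrow> ('a, 'i, 'e) ttvec) \<Rightarrow> (('a, 'i, 'e) tvec \<Rightarrow> ('a, 'i, 'e) ttvec) \<Rightarrow>
   ('a, 'i, 'e) tvec \<Rightarrow> ('a, 'i, 'e) ttvec" where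
  "torsion A D X Y w =
     tsub (tsub (D (X w) (\<lambda>z. J_map A (Y z))) (D (Y w) (\<lambda>z. J_map A (X z))))
       (J_map A (bracket (slit A) X Y w))"

definition C_tensor ::
  "('i, 'a, 'e::euclidean_space) atlas \<Rightarrow> ('a, 'i, 'e) conn \<Rightarrow>
   (('a, 'i, 'e) tvec \<Rightarrow> ('a, 'i, 'e) ttvec) \<Rightarrow> (('a, 'i, 'e) tvec \<Rightarrow> ('a, 'i, 'e) ttvec) \<Rightarrow>
   ('a, 'i, 'e) tvec \<Rightarrow> ('a, 'i, 'e) ttvec" where
  "C_tensor A D X Y = torsion A D (\<lambda>z. J_map A (X z)) Y"

definition vert_metric ::
  "('i, 'a, 'e::euclidean_space) atlas \<Rightarrow> (('a, 'i, 'e) tvec \<Rightarrow> real) \<Rightarrow>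
   ('a, 'i, 'e) ttvec \<Rightarrow> ('a, 'i, 'e) ttvec \<Rightarrow> real" where
  "vert_metric A F Y Z = fundamental_tensor F (fst Y) (vert_inv A Y) (vert_inv A Z)"

text \<open>\<open>(\<nabla>_X g)(Y,Z)\<close> for vertical fields \<open>Y, Z\<close> near the base point of \<open>X\<close>.\<close>

definition nabla_g ::
  "('i, 'a, 'e::euclidean_space) atlas \<Rightarrow> (('a, 'i, 'e) tvec \<Rightarrow> real) \<Rightarrow> ('a, 'i, 'e) conn \<Rightarrow>
   ('a, 'i, 'e) ttvec \<Rightarrow> (('a, 'i, 'e) tvec \<Rightarrow> ('a, 'i, 'e) ttvec) \<Rightarrow>
   (('a, 'i, 'e) tvec \<Rightarrow> ('a, 'i, 'e) ttvec) \<Rightarrow> real" where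
  "nabla_g A F D X Y Z =
     dir_deriv (slit A) (\<lambda>z. vert_metric A F (Y z) (Z z)) X
       - vert_metric A F (D X Y) (Z (fst X)) - vert_metric A F (Y (fst X)) (D X Z)"

definition M1 ::
  "('i, 'a, 'e::euclidean_space) atlas \<Rightarrow> (('a, 'i, 'e) tvec \<Rightarrow> real) \<Rightarrow> ('a, 'i, 'e) conn \<Rightarrow>
   bool" where
  "M1 A F D \<longleftrightarrow>
     (\<forall>w\<in>points (slit A). \<forall>X\<in>tangent_space (slit A) w. \<forall>Z. vertical_field_near A w Z \<longrightarrow>
        nabla_g A F D X Z (canonical_field A) = 0)"

definition M2 ::
  "('i, 'a, 'e::euclidean_space) atlas \<Rightarrow> (('a, 'i, 'e) tvec \<Rightarrow> real) \<Rightarrow> ('a, 'i, 'e) conn \<Rightarrow>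
   bool" where
  "M2 A F D \<longleftrightarrow>
     (\<forall>w\<in>points (slit A). \<forall>X Y. field_near (slit A) w X \<and> field_near (slit A) w Y \<longrightarrow>
        vert_metric A F (C_tensor A D X Y w) (canonical_field A w) = 0)"

text \<open>\<open>D^w_u V\<close>, for a vector field \<open>V\<close> of \<open>M\<close> that is smooth near the base point of \<open>w\<close>.\<close>

definition affine_deriv ::
  "('i, 'a, 'e::euclidean_space) atlas \<Rightarrow> (('a, 'i, 'e) tvec \<Rightarrow> ('a, 'i, 'e) ttvec) \<Rightarrow>
   ('a, 'i, 'e) conn \<Rightarrow> ('a, 'i, 'e) tvec \<Rightarrow> ('a, 'i, 'e) tvec \<Rightarrow>
   ('a \<Rightarrow> ('a, 'i, 'e) tvec) \<Rightarrow> ('a, 'i, 'e) tvec" where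
  "affine_deriv A S D w u V =
     vert_inv A (D (hor_lift A S w u) (\<lambda>z. vert_lift A z (V (fst z))))"


section \<open>Normal vectors and the second fundamental form\<close>

definition normal_vectors ::
  "('i, 'a, 'e::euclidean_space) atlas \<Rightarrow> (('a, 'i, 'e) tvec \<Rightarrow> real) \<Rightarrow> 'a set \<Rightarrow>
   ('a, 'i, 'e) tvec set" where
  "normal_vectors A F P =
     {\<eta> \<in> points (slit A). fst \<eta> \<in> P \<and>
        (\<forall>u\<in>tangent_space_of A P (fst \<eta>). fundamental_tensor F \<eta> \<eta> u = 0)}"

text \<open>The map \<open>X \<mapsto> (d\<pi>(X), i_\<eta>\<^sup>-\<^sup>1(\<V> X))\<close>, where \<open>\<V>\<close> is the vertical projection.\<close>

definition split_map ::
  "('i, 'a, 'e::euclidean_space) atlas \<Rightarrow> (('a, 'i, 'e) tvec \<Rightarrow> ('a, 'i, 'e) ttvec) \<Rightarrow>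
   ('a, 'i, 'e) ttvec \<Rightarrow> ('a, 'i, 'e) tvec \<times> ('a, 'i, 'e) tvec" where
  "split_map A S X = (d_proj A X, vert_inv A (vert_proj A S X))"

text \<open>A vector field of \<open>P\<close> near \<open>x\<close>, represented by a smooth extension to a neighbourhood of \<open>x\<close>
  in \<open>M\<close>; every smooth vector field of \<open>P\<close> has such extensions.\<close>

definition submanifold_field_near ::
  "('i, 'a, 'e::euclidean_space) atlas \<Rightarrow> 'a set \<Rightarrow> 'a \<Rightarrow> ('a \<Rightarrow> ('a, 'i, 'e) tvec) \<Rightarrow> bool" where
  "submanifold_field_near A P x V \<longleftrightarrow>
     (\<exists>W. open_nbhd A x W \<and> vector_field A W V \<and> (\<forall>y\<in>W \<inter> P. V y \<in> tangent_space_of A P y))"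

text \<open>The quantification over all extensions in the description makes independence of the
  extensions part of the notion.\<close>

definition second_fundamental_form ::
  "('i, 'a, 'e::euclidean_space) atlas \<Rightarrow> (('a, 'i, 'e) tvec \<Rightarrow> real) \<Rightarrow>
   (('a, 'i, 'e) tvec \<Rightarrow> ('a, 'i, 'e) ttvec) \<Rightarrow> ('a, 'i, 'e) conn \<Rightarrow> 'a set \<Rightarrow>
   ('a, 'i, 'e) tvec \<Rightarrow> ('a, 'i, 'e) tvec \<Rightarrow> ('a, 'i, 'e) tvec \<Rightarrow> real" where
  "second_fundamental_form A F S D P \<eta> u v =
     (THE r. \<forall>U V.
        submanifold_field_near A P (fst \<eta>) U \<and> U (fst \<eta>) = u \<and>
        submanifold_field_near A P (fst \<eta>) V \<and> V (fst \<eta>) = v \<longrightarrow>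
        r = 1/2 * fundamental_tensor F \<eta> \<eta>
                    (tadd (affine_deriv A S D \<eta> u V) (affine_deriv A S D \<eta> v U)))"

end

theory Submission
  imports Defs
begin

text \<open>
  Given \<open>u \<in> T\<^sub>xP\<close>, choose \<open>v'\<close> with \<open>g\<^sub>\<eta>(v', \<cdot>) = - b(u, \<cdot>)\<close> on \<open>T\<^sub>xP\<close>; then \<open>(u, v')\<close> is the velocity \<open>X\<close> of
  a curve of normal vectors starting at \<open>\<eta>\<close>. For a field \<open>V\<close> tangent to \<open>P\<close> the function \<open>g(V\<^sup>v, C)\<close>
  vanishes along this curve, so differentiating it by (M1) and using \<open>\<nabla>\<^sub>XC = i\<^sub>\<eta>(v')\<close> gives
  \<open>g(\<nabla>\<^sub>XV\<^sup>v, C) = - g\<^sub>\<eta>(V, v') = b(u, V)\<close>. The vertical part of \<open>X\<close> contributes nothing to the left-hand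
  side because of (M2), whence \<open>g\<^sub>\<eta>(\<eta>, D\<^sub>uV) = b(u, V)\<close>, and it remains to symmetrize. In charts the spray
  is \<open>S = (y, G(x, y))\<close> and its horizontal vectors are the pairs \<open>(a, (1/2) D\<^sub>yG a)\<close>.
\<close>

section \<open>Calculus of smooth maps\<close>

text \<open>The spray is given by Hamilton's equation alone, so \<open>J(S) = C\<close> has to come
  first: tested on vertical vectors, the equation says that \<open>d\<pi>(S w)\<close> and
  \<open>w\<close> have the same \<open>g_w\<close>-products, and positive definiteness makes them
  equal. Only then does \<open>[S, J]\<close> give the formula for horizontal vectors. The factor
  1/2 there comes from \<open>\<Gamma>(a, c) = (a, D_yG a - c)\<close>, whose fixed vectors satisfy
  \<open>2c = D_yG a\<close>. Whenever one slot of \<open>g_w\<close> is \<open>w\<close> itself,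
  homogeneity of degree two replaces the second derivative of \<open>F^2/2\<close> by a first
  derivative; this gives coordinates for the Legendre map and makes \<open>g(V^v, C)\<close> a
  smooth function that can be differentiated along the curve. The vector \<open>v'\<close> is a
  Riesz representative of \<open>- b(u, .)\<close> on \<open>T_xP\<close>. What shapes the proof is
  that projections, lifts, \<open>\<Gamma>_S\<close> and \<open>h\<close> are defined by chosen
  charts, chosen extensions or descriptions; each needs a formula in an arbitrary chart, and
  \<open>h\<close> needs the existence of extensions tangent to \<open>P\<close>.\<close>

abbreviation fd :: "('v::real_normed_vector \<Rightarrow> 'w::real_normed_vector) \<Rightarrow> 'v \<Rightarrow> 'v \<Rightarrow> 'w" where
  "fd f x \<equiv> frechet_derivative f (at x)"

lemma fd_eqI: "(f has_derivative f') (at x) \<Longrightarrow> fd f x = f'"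
  by (rule frechet_derivative_at[symmetric])

lemma fd_works: "f differentiable (at x) \<Longrightarrow> (f has_derivative fd f x) (at x)"
  by (simp add: frechet_derivative_works)

text \<open>No differentiability is assumed: \<open>frechet_derivative\<close> is a choice among all
  derivatives, and agreement on an open set gives both functions the same derivatives.\<close>

lemma fd_cong_open:
  assumes "open S" "x \<in> S" "\<And>y. y \<in> S \<Longrightarrow> f y = g y"
  shows "fd f x = fd g x"
proof -
  have "(f has_derivative h) (at x) \<longleftrightarrow> (g has_derivative h) (at x)" for h
    using assms has_derivative_transform_within_open[of f h x UNIV S g]
      has_derivative_transform_within_open[of g h x UNIV S f] by auto
  then show ?thesis by (simp add: frechet_derivative_def)
qed

lemma differentiable_cong_open:
  assumes "open S" "x \<in> S" "\<And>y. y \<in> S \<Longrightarrow> f y = g y"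
  shows "f differentiable (at x) \<longleftrightarrow> g differentiable (at x)"
  using assms has_derivative_transform_within_open[of f _ x UNIV S g]
      has_derivative_transform_within_open[of g _ x UNIV S f]
  unfolding differentiable_def by (metis (full_types))

section \<open>Closure properties of \<open>Ck_on\<close>\<close>

lemma Ck_on_cong:
  assumes "open S"
  shows "(\<And>y. y \<in> S \<Longrightarrow> f y = g y) \<Longrightarrow> Ck_on k S f \<longleftrightarrow> Ck_on k S g"
proof (induction k arbitrary: f g)
  case 0
  then show ?case by (simp cong: continuous_on_cong)
next
  case (Suc k)
  have "Ck_on k S (\<lambda>x. fd f x v) \<longleftrightarrow> Ck_on k S (\<lambda>x. fd g x v)" for v
    using fd_cong_open[OF assms _ Suc.prems] by (intro Suc.IH) auto
  then show ?case
    using differentiable_cong_open[OF assms _ Suc.prems] by auto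
qed

lemma Ck_on_subset: "Ck_on k S f \<Longrightarrow> T \<subseteq> S \<Longrightarrow> Ck_on k T f"
  by (induction k arbitrary: f) (auto intro: continuous_on_subset)

lemma Ck_on_lower: "Ck_on (Suc k) S f \<Longrightarrow> Ck_on k S f"
proof (induction k arbitrary: f)
  case 0
  then show ?case
    by (auto intro!: differentiable_imp_continuous_on differentiable_at_imp_differentiable_on
        simp: differentiable_on_def intro: differentiable_at_withinI)
next
  case (Suc k)
  then show ?case by auto
qed

lemma Ck_on_const: "Ck_on k S (\<lambda>_. c)"
  by (induction k arbitrary: c) auto

lemma Ck_on_linear_compose:
  assumes "open S" "bounded_linear h"
  shows "Ck_on k S f \<Longrightarrow> Ck_on k S (\<lambda>x. h (f x))"
proof (induction k arbitrary: f)
  case 0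
  then show ?case
    using assms(2) by (simp add: bounded_linear.continuous_on)
next
  case (Suc k)
  have hd: "((\<lambda>x. h (f x)) has_derivative (\<lambda>v. h (fd f x v))) (at x)" if "x \<in> S" for x
    using Suc.prems that by (intro bounded_linear.has_derivative[OF assms(2)] fd_works) auto
  have "Ck_on k S (\<lambda>x. fd (\<lambda>x. h (f x)) x v) \<longleftrightarrow> Ck_on k S (\<lambda>x. h (fd f x v))" for v
    by (rule Ck_on_cong[OF assms(1)]) (simp add: fd_eqI[OF hd])
  with Suc hd show ?case
    by (auto simp: differentiable_def)
qed

lemma Ck_on_linear:
  assumes "open S" "bounded_linear h"
  shows "Ck_on k S h"
proof (cases k)
  case 0
  then show ?thesis by (simp add: assms(2) linear_continuous_on)
next
  case (Suc k)
  have hd: "(h has_derivative h) (at x)" for x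
    using assms(2) by (rule bounded_linear_imp_has_derivative)
  then show ?thesis
    by (simp add: Suc fd_eqI[OF hd] Ck_on_const) (auto simp: differentiable_def)
qed

lemma Ck_on_add:
  assumes "open S"
  shows "Ck_on k S f \<Longrightarrow> Ck_on k S g \<Longrightarrow> Ck_on k S (\<lambda>x. f x + g x)"
proof (induction k arbitrary: f g)
  case 0
  then show ?case by (simp add: continuous_on_add)
next
  case (Suc k)
  have hd: "((\<lambda>x. f x + g x) has_derivative (\<lambda>v. fd f x v + fd g x v)) (at x)" if "x \<in> S" for x
    using Suc.prems that by (intro has_derivative_add fd_works) auto
  have "Ck_on k S (\<lambda>x. fd (\<lambda>x. f x + g x) x v) \<longleftrightarrow> Ck_on k S (\<lambda>x. fd f x v + fd g x v)" for v
    by (rule Ck_on_cong[OF assms]) (simp add: fd_eqI[OF hd])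
  with Suc hd show ?case
    by (auto simp: differentiable_def)
qed

lemma Ck_on_bilinear:
  assumes "open S" "bounded_bilinear h"
  shows "Ck_on k S f \<Longrightarrow> Ck_on k S g \<Longrightarrow> Ck_on k S (\<lambda>x. h (f x) (g x))"
proof (induction k arbitrary: f g)
  case 0
  then show ?case using assms(2) by (simp add: bounded_bilinear.continuous_on)
next
  case (Suc k)
  have hd: "((\<lambda>x. h (f x) (g x)) has_derivative (\<lambda>v. h (f x) (fd g x v) + h (fd f x v) (g x))) (at x)"
    if "x \<in> S" for x
    using Suc.prems that by (intro bounded_bilinear.FDERIV[OF assms(2)] fd_works) auto
  have "Ck_on k S (\<lambda>x. fd (\<lambda>x. h (f x) (g x)) x v) \<longleftrightarrow>
      Ck_on k S (\<lambda>x. h (f x) (fd g x v) + h (fd f x v) (g x))" for v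
    by (rule Ck_on_cong[OF assms(1)]) (simp add: fd_eqI[OF hd])
  \<comment> \<open>The product rule keeps one factor undifferentiated, so that factor must be
    lowered from order \<open>Suc k\<close> to \<open>k\<close> before the induction hypothesis
    applies.\<close>
  moreover have "Ck_on k S (\<lambda>x. h (f x) (fd g x v) + h (fd f x v) (g x))" for v
    using Suc.prems Ck_on_lower[OF Suc.prems(1)] Ck_on_lower[OF Suc.prems(2)]
    by (intro Ck_on_add[OF assms(1)] Suc.IH) auto
  ultimately show ?case
    using hd by (auto simp: differentiable_def)
qed

lemma Ck_on_sum:
  assumes "open S" "\<And>b. b \<in> B \<Longrightarrow> Ck_on k S (f b)"
  shows "Ck_on k S (\<lambda>x. \<Sum>b\<in>B. f b x)"
  using assms(2)
  by (induction B rule: infinite_finite_induct) (simp_all add: Ck_on_const Ck_on_add[OF assms(1)])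

text \<open>\<open>Ck_on\<close> controls derivatives in fixed directions only. Expanding in the
  basis turns a derivative at a moving vector into a finite sum of derivatives in fixed directions
  with scalar coefficients.\<close>

lemma linear_expand:
  fixes h :: "'v::euclidean_space \<Rightarrow> 'w::real_normed_vector"
  assumes "linear h"
  shows "h v = (\<Sum>b\<in>Basis. (v \<bullet> b) *\<^sub>R h b)"
proof -
  have "h v = h (\<Sum>b\<in>Basis. (v \<bullet> b) *\<^sub>R b)" by (simp add: euclidean_representation)
  also have "\<dots> = (\<Sum>b\<in>Basis. (v \<bullet> b) *\<^sub>R h b)"
    by (simp add: linear_sum[OF assms] linear_scale[OF assms])
  finally show ?thesis .
qed

text \<open>In the chain rule the derivative of \<open>g\<close> is taken in the direction
  \<open>fd f x v\<close>, which moves with \<open>x\<close>; after expansion in the basis each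
  summand is a product of a coefficient and a composition of lower order. This is where the middle
  space has to be finite-dimensional.\<close>

lemma Ck_on_compose:
  fixes f :: "'u::real_normed_vector \<Rightarrow> 'v::euclidean_space" and g :: "'v \<Rightarrow> 'w::real_normed_vector"
  assumes "open S" "open T" "f ` S \<subseteq> T"
  shows "Ck_on k S f \<Longrightarrow> Ck_on k T g \<Longrightarrow> Ck_on k S (\<lambda>x. g (f x))"
  using assms(3)
proof (induction k arbitrary: f g)
  case 0
  then show ?case by (auto intro: continuous_on_compose2)
next
  case (Suc k)
  have dg: "g differentiable (at (f x))" if "x \<in> S" for x
    using Suc.prems that by auto
  have hd: "((\<lambda>x. g (f x)) has_derivative (\<lambda>v. fd g (f x) (fd f x v))) (at x)"
    if "x \<in> S" for x
    using Suc.prems(1) that fd_works[OF dg[OF that]]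
    by (intro has_derivative_compose[where f = f and g = g] fd_works[of f]) auto
  have eq: "fd (\<lambda>x. g (f x)) x v = (\<Sum>b\<in>Basis. (fd f x v \<bullet> b) *\<^sub>R fd g (f x) b)" if "x \<in> S" for v x
    unfolding fd_eqI[OF hd[OF that]] by (rule linear_expand[OF linear_frechet_derivative[OF dg[OF that]]])
  have "Ck_on k S (\<lambda>x. fd (\<lambda>x. g (f x)) x v) \<longleftrightarrow>
      Ck_on k S (\<lambda>x. \<Sum>b\<in>Basis. (fd f x v \<bullet> b) *\<^sub>R fd g (f x) b)" for v
    by (rule Ck_on_cong[OF assms(1)]) (simp add: eq)
  moreover have "Ck_on k S (\<lambda>x. \<Sum>b\<in>Basis. (fd f x v \<bullet> b) *\<^sub>R fd g (f x) b)" for v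
  proof (rule Ck_on_sum[OF assms(1)], rule Ck_on_bilinear[OF assms(1) bounded_bilinear_scaleR])
    fix b :: 'v
    show "Ck_on k S (\<lambda>x. fd f x v \<bullet> b)"
      using Suc.prems(1) by (intro Ck_on_linear_compose[OF assms(1) bounded_linear_inner_left]) simp
    show "Ck_on k S (\<lambda>x. fd g (f x) b)"
      using Suc.prems Ck_on_lower[OF Suc.prems(1)] by (intro Suc.IH[of f "\<lambda>y. fd g y b"]) simp_all
  qed
  ultimately show ?case
    using hd by (auto simp: differentiable_def)
qed

lemma smooth_on_differentiable: "smooth_on S f \<Longrightarrow> x \<in> S \<Longrightarrow> f differentiable (at x)"
  unfolding smooth_on_def by (metis Ck_on.simps(2))

lemma smooth_on_has_derivative: "smooth_on S f \<Longrightarrow> x \<in> S \<Longrightarrow> (f has_derivative fd f x) (at x)"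
  using smooth_on_differentiable fd_works by blast

lemma smooth_on_linear_fd: "smooth_on S f \<Longrightarrow> x \<in> S \<Longrightarrow> linear (fd f x)"
  using smooth_on_differentiable linear_frechet_derivative by blast

lemma smooth_on_continuous_on: "smooth_on S f \<Longrightarrow> continuous_on S f"
  unfolding smooth_on_def by (metis Ck_on.simps(1))

lemma smooth_on_fd: "smooth_on S f \<Longrightarrow> smooth_on S (\<lambda>x. fd f x v)"
  unfolding smooth_on_def by (metis Ck_on.simps(2))

lemma smooth_on_cong: "open S \<Longrightarrow> (\<And>y. y \<in> S \<Longrightarrow> f y = g y) \<Longrightarrow> smooth_on S f \<longleftrightarrow> smooth_on S g"
  unfolding smooth_on_def using Ck_on_cong by blast

lemma smooth_on_transform:
  "smooth_on S g \<Longrightarrow> open S \<Longrightarrow> (\<And>y. y \<in> S \<Longrightarrow> f y = g y) \<Longrightarrow> smooth_on S f"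
  using smooth_on_cong[of S f g] by blast

lemma smooth_on_subset: "smooth_on S f \<Longrightarrow> T \<subseteq> S \<Longrightarrow> smooth_on T f"
  unfolding smooth_on_def using Ck_on_subset by blast

lemma smooth_on_const: "smooth_on S (\<lambda>_. c)"
  unfolding smooth_on_def using Ck_on_const by blast

lemma smooth_on_linear: "open S \<Longrightarrow> bounded_linear h \<Longrightarrow> smooth_on S h"
  unfolding smooth_on_def using Ck_on_linear by blast

lemma smooth_on_linear_compose:
  "open S \<Longrightarrow> bounded_linear h \<Longrightarrow> smooth_on S f \<Longrightarrow> smooth_on S (\<lambda>x. h (f x))"
  by (simp add: smooth_on_def Ck_on_linear_compose)

lemma smooth_on_add: "open S \<Longrightarrow> smooth_on S f \<Longrightarrow> smooth_on S g \<Longrightarrow> smooth_on S (\<lambda>x. f x + g x)"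
  by (simp add: smooth_on_def Ck_on_add)

lemma smooth_on_bilinear:
  "open S \<Longrightarrow> bounded_bilinear h \<Longrightarrow> smooth_on S f \<Longrightarrow> smooth_on S g \<Longrightarrow>
    smooth_on S (\<lambda>x. h (f x) (g x))"
  by (simp add: smooth_on_def Ck_on_bilinear)

lemma smooth_on_sum:
  "open S \<Longrightarrow> (\<And>b. b \<in> B \<Longrightarrow> smooth_on S (f b)) \<Longrightarrow> smooth_on S (\<lambda>x. \<Sum>b\<in>B. f b x)"
  by (simp add: smooth_on_def Ck_on_sum)

lemma smooth_on_compose:
  fixes f :: "'u::real_normed_vector \<Rightarrow> 'v::euclidean_space"
  assumes "open S" "open T" "f ` S \<subseteq> T" "smooth_on S f" "smooth_on T g"
  shows "smooth_on S (\<lambda>x. g (f x))"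
  unfolding smooth_on_def
proof
  fix k
  show "Ck_on k S (\<lambda>x. g (f x))"
    by (rule Ck_on_compose[OF assms(1-3)]) (use assms in \<open>simp_all add: smooth_on_def\<close>)
qed

lemma smooth_on_Pair:
  assumes "open S" "smooth_on S f" "smooth_on S g"
  shows "smooth_on S (\<lambda>x. (f x, g x))"
proof -
  have "smooth_on S (\<lambda>x. (f x, 0) + (0, g x))"
    using assms by (intro smooth_on_add smooth_on_linear_compose[where h = "\<lambda>x. (x, 0)"]
        smooth_on_linear_compose[where h = "\<lambda>x. (0, x)"] bounded_linear_Pair
        bounded_linear_ident bounded_linear_zero)
  then show ?thesis by simp
qed

lemma smooth_on_fst: "open S \<Longrightarrow> smooth_on S f \<Longrightarrow> smooth_on S (\<lambda>x. fst (f x))"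
  by (rule smooth_on_linear_compose[OF _ bounded_linear_fst])

text \<open>Covers the components of vectors under a change of chart, where the Jacobian, its base
  point and the vector all vary.\<close>

lemma smooth_on_fd_apply:
  fixes f :: "'v::euclidean_space \<Rightarrow> 'w::real_normed_vector"
  assumes S: "open S" "smooth_on S \<xi>" and T: "open T" "smooth_on T f"
    and p: "smooth_on S p" "p ` S \<subseteq> T"
  shows "smooth_on S (\<lambda>z. fd f (p z) (\<xi> z))"
proof -
  have eq: "fd f (p z) (\<xi> z) = (\<Sum>b\<in>Basis. (\<xi> z \<bullet> b) *\<^sub>R fd f (p z) b)" if "z \<in> S" for z
    using linear_expand[OF smooth_on_linear_fd[OF T(2)]] p that by blast
  have "smooth_on S (\<lambda>z. \<Sum>b\<in>Basis. (\<xi> z \<bullet> b) *\<^sub>R fd f (p z) b)"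
    by (intro smooth_on_sum[OF S(1)] smooth_on_bilinear[OF S(1) bounded_bilinear_scaleR]
        smooth_on_linear_compose[OF S(1) bounded_linear_inner_left S(2)]
        smooth_on_compose[OF S(1) T(1) p(2,1)] smooth_on_fd[OF T(2)])
  then show ?thesis
    by (rule smooth_on_transform[OF _ S(1) eq])
qed

text \<open>Product rule for \<open>Df(p(z)) \<xi>(z)\<close>: the second derivative of
  \<open>f\<close> enters as the derivative of \<open>Df(q) \<xi>(x)\<close> in \<open>q\<close>
  with the vector frozen, so no bilinear second derivative has to be introduced.\<close>

lemma has_derivative_fd_compose_apply:
  fixes f :: "'v::euclidean_space \<Rightarrow> 'w::real_normed_vector" and p :: "'u::real_normed_vector \<Rightarrow> 'v"
  assumes f: "open S" "smooth_on S f" and U: "open U" "x \<in> U" "p ` U \<subseteq> S"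
    and p: "(p has_derivative p') (at x)" and \<xi>: "(\<xi> has_derivative \<xi>') (at x)"
  shows "((\<lambda>z. fd f (p z) (\<xi> z)) has_derivative
    (\<lambda>v. fd (\<lambda>q. fd f q (\<xi> x)) (p x) (p' v) + fd f (p x) (\<xi>' v))) (at x)"
proof -
  have px: "p x \<in> S" using U by blast
  have ex: "fd f q v = (\<Sum>b\<in>Basis. (v \<bullet> b) *\<^sub>R fd f q b)" if "q \<in> S" for q v
    by (rule linear_expand[OF smooth_on_linear_fd[OF f(2) that]])
  have ex': "fd f (p z) (\<xi> z) = (\<Sum>b\<in>Basis. (\<xi> z \<bullet> b) *\<^sub>R fd f (p z) b)" if "z \<in> U" for z
    using U(3) that by (intro ex) blast
  have d2: "((\<lambda>q. fd f q b) has_derivative fd (\<lambda>q. fd f q b) (p x)) (at (p x))" for b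
    using smooth_on_has_derivative[OF smooth_on_fd[OF f(2)] px] .
  \<comment> \<open>The coefficients are frozen here; \<open>A'\<close> then recognizes the sum of
    second derivatives in basis directions as the derivative of
    \<open>q \<mapsto> Df(q) v\<close>.\<close>
  have A: "((\<lambda>q. \<Sum>b\<in>Basis. (v \<bullet> b) *\<^sub>R fd f q b) has_derivative
      (\<lambda>w. \<Sum>b\<in>Basis. (v \<bullet> b) *\<^sub>R fd (\<lambda>q. fd f q b) (p x) w)) (at (p x))" for v
    by (rule has_derivative_sum, rule has_derivative_scaleR_right, rule d2)
  have A': "fd (\<lambda>q. fd f q v) (p x) = (\<lambda>w. \<Sum>b\<in>Basis. (v \<bullet> b) *\<^sub>R fd (\<lambda>q. fd f q b) (p x) w)" for v
    by (rule trans[OF fd_cong_open[OF f(1) px ex] fd_eqI[OF A]])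
  have B: "((\<lambda>z. \<Sum>b\<in>Basis. (\<xi> z \<bullet> b) *\<^sub>R fd f (p z) b) has_derivative
      (\<lambda>w. \<Sum>b\<in>Basis. (\<xi> x \<bullet> b) *\<^sub>R fd (\<lambda>q. fd f q b) (p x) (p' w) + (\<xi>' w \<bullet> b) *\<^sub>R fd f (p x) b)) (at x)"
    by (rule has_derivative_sum, rule has_derivative_scaleR, rule has_derivative_inner_left, rule \<xi>,
        rule has_derivative_compose[OF p d2])
  have C: "((\<lambda>z. fd f (p z) (\<xi> z)) has_derivative
      (\<lambda>w. \<Sum>b\<in>Basis. (\<xi> x \<bullet> b) *\<^sub>R fd (\<lambda>q. fd f q b) (p x) (p' w) + (\<xi>' w \<bullet> b) *\<^sub>R fd f (p x) b)) (at x)"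
    by (rule has_derivative_transform_within_open[OF B U(1,2) ex'[symmetric]])
  moreover have "(\<lambda>w. \<Sum>b\<in>Basis. (\<xi> x \<bullet> b) *\<^sub>R fd (\<lambda>q. fd f q b) (p x) (p' w) + (\<xi>' w \<bullet> b) *\<^sub>R fd f (p x) b) =
      (\<lambda>v. fd (\<lambda>q. fd f q (\<xi> x)) (p x) (p' v) + fd f (p x) (\<xi>' v))"
  proof
    fix w
    show "(\<Sum>b\<in>Basis. (\<xi> x \<bullet> b) *\<^sub>R fd (\<lambda>q. fd f q b) (p x) (p' w) + (\<xi>' w \<bullet> b) *\<^sub>R fd f (p x) b) =
        fd (\<lambda>q. fd f q (\<xi> x)) (p x) (p' w) + fd f (p x) (\<xi>' w)"
      by (simp only: A'[of "\<xi> x"] sum.distrib ex[OF px, of "\<xi>' w", symmetric])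
  qed
  ultimately show ?thesis by simp
qed

lemma has_derivative_fd_apply:
  fixes f :: "'v::euclidean_space \<Rightarrow> 'w::real_normed_vector"
  assumes f: "open S" "smooth_on S f" "x \<in> S" and \<xi>: "(\<xi> has_derivative \<xi>') (at x)"
  shows "((\<lambda>z. fd f z (\<xi> z)) has_derivative (\<lambda>v. fd (\<lambda>z. fd f z (\<xi> x)) x v + fd f x (\<xi>' v))) (at x)"
  using has_derivative_fd_compose_apply[OF f(1,2,1,3) _ has_derivative_ident \<xi>] by simp

section \<open>Symmetry of second derivatives\<close>

lemma second_difference_mvt:
  fixes f :: "'v::euclidean_space \<Rightarrow> real"
  assumes f: "smooth_on S f" and h: "0 < h"
    and S: "\<And>s t. 0 \<le> s \<Longrightarrow> s \<le> h \<Longrightarrow> 0 \<le> t \<Longrightarrow> t \<le> h \<Longrightarrow> x + s *\<^sub>R a + t *\<^sub>R b \<in> S"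
  shows "\<exists>s t. 0 < s \<and> s < h \<and> 0 < t \<and> t < h \<and>
    f (x + h *\<^sub>R a + h *\<^sub>R b) - f (x + h *\<^sub>R a) - f (x + h *\<^sub>R b) + f x =
      h * (h * fd (\<lambda>z. fd f z a) (x + s *\<^sub>R a + t *\<^sub>R b) b)"
proof -
  have lines: "((\<lambda>s. g (y + s *\<^sub>R c)) has_real_derivative fd g (y + s *\<^sub>R c) c) (at s)"
    if "smooth_on S g" "y + s *\<^sub>R c \<in> S" for g :: "'v \<Rightarrow> real" and y c s
  proof -
    have "((\<lambda>s. y + s *\<^sub>R c) has_derivative (\<lambda>t. t *\<^sub>R c)) (at s)"
      by (auto intro!: derivative_eq_intros)
    then have "((\<lambda>s. g (y + s *\<^sub>R c)) has_derivative (\<lambda>t. fd g (y + s *\<^sub>R c) (t *\<^sub>R c))) (at s)"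
      using has_derivative_compose smooth_on_has_derivative[OF that] by blast
    moreover have "fd g (y + s *\<^sub>R c) (t *\<^sub>R c) = fd g (y + s *\<^sub>R c) c * t" for t
      using linear_scale[OF smooth_on_linear_fd[OF that]] by simp
    ultimately show ?thesis by (simp add: has_field_derivative_def)
  qed
  \<comment> \<open>Mean value theorem in direction \<open>a\<close>, applied to the increment of
    \<open>f\<close> under the shift by \<open>h b\<close>; it is applied once more in direction
    \<open>b\<close>, to the derivative of \<open>f\<close> along \<open>a\<close>.\<close>
  have "\<exists>s>0. s < h \<and> (f ((x + h *\<^sub>R b) + h *\<^sub>R a) - f (x + h *\<^sub>R a)) - (f ((x + h *\<^sub>R b) + 0 *\<^sub>R a) - f (x + 0 *\<^sub>R a))
      = (h - 0) * (fd f ((x + h *\<^sub>R b) + s *\<^sub>R a) a - fd f (x + s *\<^sub>R a) a)"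
  proof (rule MVT2)
    show "((\<lambda>s. f ((x + h *\<^sub>R b) + s *\<^sub>R a) - f (x + s *\<^sub>R a)) has_real_derivative
        fd f ((x + h *\<^sub>R b) + s *\<^sub>R a) a - fd f (x + s *\<^sub>R a) a) (at s)" if "0 \<le> s" "s \<le> h" for s
      using that h S[of s h] S[of s 0] by (intro DERIV_diff lines f) (auto simp: algebra_simps)
  qed (use h in auto)
  then obtain s where s: "0 < s" "s < h" "f ((x + h *\<^sub>R b) + h *\<^sub>R a) - f (x + h *\<^sub>R a) - (f (x + h *\<^sub>R b) - f x)
      = h * (fd f ((x + h *\<^sub>R b) + s *\<^sub>R a) a - fd f (x + s *\<^sub>R a) a)" by auto
  have "\<exists>t>0. t < h \<and> fd f ((x + s *\<^sub>R a) + h *\<^sub>R b) a - fd f ((x + s *\<^sub>R a) + 0 *\<^sub>R b) a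
      = (h - 0) * fd (\<lambda>z. fd f z a) ((x + s *\<^sub>R a) + t *\<^sub>R b) b"
    using s h S[of s] by (intro MVT2 lines smooth_on_fd f) auto
  then obtain t where t: "0 < t" "t < h" "fd f ((x + s *\<^sub>R a) + h *\<^sub>R b) a - fd f (x + s *\<^sub>R a) a
      = h * fd (\<lambda>z. fd f z a) ((x + s *\<^sub>R a) + t *\<^sub>R b) b" by auto
  have "(x + h *\<^sub>R b) + s *\<^sub>R a = (x + s *\<^sub>R a) + h *\<^sub>R b" "(x + h *\<^sub>R b) + h *\<^sub>R a = x + h *\<^sub>R a + h *\<^sub>R b"
    by (simp_all add: algebra_simps)
  with s t have "f (x + h *\<^sub>R a + h *\<^sub>R b) - f (x + h *\<^sub>R a) - f (x + h *\<^sub>R b) + f x =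
      h * (h * fd (\<lambda>z. fd f z a) (x + s *\<^sub>R a + t *\<^sub>R b) b)" by simp
  with s t show ?thesis by blast
qed

text \<open>The second difference over the parallelogram spanned by \<open>h a\<close> and
  \<open>h b\<close> is unchanged when \<open>a\<close> and \<open>b\<close> are exchanged. By the
  mean value form it equals \<open>h^2\<close> times either mixed derivative at nearby points, and
  continuity brings both to \<open>x\<close>.\<close>

lemma fd_symmetric_real:
  fixes f :: "'v::euclidean_space \<Rightarrow> real"
  assumes f: "open S" "smooth_on S f" "x \<in> S"
  shows "fd (\<lambda>z. fd f z a) x b = fd (\<lambda>z. fd f z b) x a"
proof -
  let ?G = "\<lambda>a b z. fd (\<lambda>z. fd f z a) z b"
  have cont: "(?G a b \<longlongrightarrow> ?G a b x) (nhds x)" for a b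
    using smooth_on_continuous_on[OF smooth_on_fd[OF smooth_on_fd[OF f(2)]]] f(1,3)
    by (intro tendsto_at_iff_tendsto_nhds[THEN iffD1]) (simp add: continuous_on_eq_continuous_at isCont_def)
  have "\<bar>?G a b x - ?G b a x\<bar> \<le> e" if e: "e > 0" for e
  proof -
    have "eventually (\<lambda>z. \<bar>?G a b z - ?G a b x\<bar> < e/2 \<and> \<bar>?G b a z - ?G b a x\<bar> < e/2 \<and> z \<in> S) (nhds x)"
      using tendstoD[OF cont, of "e/2" a b] tendstoD[OF cont, of "e/2" b a] f(1,3) e
      by (intro eventually_conj) (auto simp: eventually_nhds_in_open dist_real_def)
    then obtain d where d: "d > 0" "\<And>z. dist z x < d \<Longrightarrow>
        \<bar>?G a b z - ?G a b x\<bar> < e/2 \<and> \<bar>?G b a z - ?G b a x\<bar> < e/2 \<and> z \<in> S"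
      unfolding eventually_nhds_metric by blast
    \<comment> \<open>Keeps the parallelogram inside the ball of radius \<open>d\<close>: its points
      are at distance at most \<open>d / 2\<close> from \<open>x\<close>. The summand 1 avoids a
      zero denominator when \<open>a = b = 0\<close>.\<close>
    define h where "h = d / (2 * (norm a + norm b + 1))"
    have n: "norm a + norm b + 1 > 0" by (simp add: add_nonneg_pos)
    have h: "h > 0" using d n by (simp add: h_def)
    have near: "dist (x + s *\<^sub>R a + t *\<^sub>R b) x < d" if "0 \<le> s" "s \<le> h" "0 \<le> t" "t \<le> h" for s t
    proof -
      have "dist (x + s *\<^sub>R a + t *\<^sub>R b) x = norm (s *\<^sub>R a + t *\<^sub>R b)"
        by (simp add: dist_norm algebra_simps)
      also have "\<dots> \<le> s * norm a + t * norm b" using that norm_triangle_ineq[of "s *\<^sub>R a" "t *\<^sub>R b"] by simp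
      also have "\<dots> \<le> h * norm a + h * norm b" using that by (intro add_mono mult_right_mono) auto
      also have "\<dots> \<le> h * (norm a + norm b + 1)" using h by (simp add: algebra_simps)
      also have "\<dots> = d / 2" using n by (simp add: h_def field_simps)
      finally show ?thesis using d by simp
    qed
    have near': "dist (x + s *\<^sub>R b + t *\<^sub>R a) x < d" if "0 \<le> s" "s \<le> h" "0 \<le> t" "t \<le> h" for s t
      using near[of t s] that by (simp add: algebra_simps)
    obtain s t where st: "0 < s" "s < h" "0 < t" "t < h"
      "f (x + h *\<^sub>R a + h *\<^sub>R b) - f (x + h *\<^sub>R a) - f (x + h *\<^sub>R b) + f x =
        h * (h * ?G a b (x + s *\<^sub>R a + t *\<^sub>R b))"
      using second_difference_mvt[OF f(2) h, of x a b] near d(2) by blast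
    obtain s' t' where st': "0 < s'" "s' < h" "0 < t'" "t' < h"
      "f (x + h *\<^sub>R b + h *\<^sub>R a) - f (x + h *\<^sub>R b) - f (x + h *\<^sub>R a) + f x =
        h * (h * ?G b a (x + s' *\<^sub>R b + t' *\<^sub>R a))"
      using second_difference_mvt[OF f(2) h, of x b a] near' d(2) by blast
    have "x + h *\<^sub>R b + h *\<^sub>R a = x + h *\<^sub>R a + h *\<^sub>R b" by (simp add: algebra_simps)
    then have "?G a b (x + s *\<^sub>R a + t *\<^sub>R b) = ?G b a (x + s' *\<^sub>R b + t' *\<^sub>R a)"
      using st(5) st'(5) h by (smt (verit) mult_left_cancel)
    moreover have "\<bar>?G a b (x + s *\<^sub>R a + t *\<^sub>R b) - ?G a b x\<bar> < e/2"
      using d(2)[OF near[of s t]] st by auto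
    moreover have "\<bar>?G b a (x + s' *\<^sub>R b + t' *\<^sub>R a) - ?G b a x\<bar> < e/2"
      using d(2)[OF near'[of s' t']] st' by auto
    ultimately show ?thesis by (smt (verit) field_sum_of_halves)
  qed
  then have "\<bar>?G a b x - ?G b a x\<bar> \<le> 0" by (rule field_le_epsilon) simp
  then show ?thesis by simp
qed

lemma fd_symmetric:
  fixes f :: "'v::euclidean_space \<Rightarrow> 'w::euclidean_space"
  assumes f: "open S" "smooth_on S f" "x \<in> S"
  shows "fd (\<lambda>z. fd f z a) x b = fd (\<lambda>z. fd f z b) x a"
proof (rule euclidean_eqI)
  fix c :: 'w
  have inner: "fd (\<lambda>z. g z \<bullet> c) x v = fd g x v \<bullet> c" if "g differentiable (at x)"
    for g :: "'v \<Rightarrow> 'w" and x v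
    by (rule fd_eqI[OF has_derivative_inner_left[OF fd_works[OF that]], THEN fun_cong])
  have "fd (\<lambda>z. fd (\<lambda>z. f z \<bullet> c) z a) x b = fd (\<lambda>z. fd f z a) x b \<bullet> c" for a b
  proof -
    have "fd (\<lambda>z. fd (\<lambda>z. f z \<bullet> c) z a) x = fd (\<lambda>z. fd f z a \<bullet> c) x"
      using f inner smooth_on_differentiable[OF f(2)] by (intro fd_cong_open[of S]) auto
    then show ?thesis
      using inner smooth_on_differentiable[OF smooth_on_fd[OF f(2)] f(3)] by simp
  qed
  moreover have "smooth_on S (\<lambda>z. f z \<bullet> c)"
    by (intro smooth_on_linear_compose[OF f(1) bounded_linear_inner_left] f)
  ultimately show "fd (\<lambda>z. fd f z a) x b \<bullet> c = fd (\<lambda>z. fd f z b) x a \<bullet> c"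
    using fd_symmetric_real[OF f(1) _ f(3), of "\<lambda>z. f z \<bullet> c" a b] by simp
qed

section \<open>Charts and tangent vectors\<close>

abbreviation cimg :: "('i, 'a, 'e) atlas \<Rightarrow> 'i \<Rightarrow> 'a set \<Rightarrow> 'e set" where
  "cimg A i W \<equiv> cmap A i ` (W \<inter> cdom A i)"

abbreviation jac :: "('i, 'a, 'e::euclidean_space) atlas \<Rightarrow> 'i \<Rightarrow> 'i \<Rightarrow> 'a \<Rightarrow> 'e \<Rightarrow> 'e" where
  "jac A i j p \<equiv> fd (transition A i j) (cmap A i p)"

text \<open>For \<open>p\<close> in chart \<open>i\<close> this inverts the passage from a tangent
  vector to its \<open>i\<close>-component; fields given by components in one chart are built with
  it.\<close>

definition tvec_of ::
  "('i, 'a, 'e::euclidean_space) atlas \<Rightarrow> 'i \<Rightarrow> 'a \<Rightarrow> 'e \<Rightarrow> ('a, 'i, 'e) tvec" where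
  "tvec_of A i p a = (p, \<lambda>j. if p \<in> cdom A j then jac A i j p a else 0)"

lemma some_chart: "p \<in> points A \<Longrightarrow> p \<in> cdom A (some_chart A p)"
  unfolding points_def some_chart_def by (auto intro: someI)

lemma cdom_points: "p \<in> cdom A i \<Longrightarrow> p \<in> points A"
  by (auto simp: points_def)

lemma cinv_cmap: "smooth_atlas A \<Longrightarrow> p \<in> cdom A i \<Longrightarrow> cinv A i (cmap A i p) = p"
  by (simp add: smooth_atlas_def cinv_def)

lemma transition_cmap: "smooth_atlas A \<Longrightarrow> p \<in> cdom A i \<Longrightarrow> transition A i j (cmap A i p) = cmap A j p"
  by (simp add: transition_def cinv_cmap)

lemma inj_cmap: "smooth_atlas A \<Longrightarrow> inj_on (cmap A i) (cdom A i)"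
  by (simp add: smooth_atlas_def)

lemma cimg_Int:
  assumes "smooth_atlas A"
  shows "cimg A i (W \<inter> W') = cimg A i W \<inter> cimg A i W'"
  using inj_on_image_Int[OF inj_cmap[OF assms], of "W \<inter> cdom A i" i "W' \<inter> cdom A i"]
  by (simp add: Int_ac)

text \<open>The definition applies \<open>topology\<close> to a predicate, which has the expected
  open sets only after \<open>istopology\<close> is checked. Intersections use the injectivity of
  charts, since images do not commute with intersections in general.\<close>

lemma openin_manifold:
  assumes "smooth_atlas A"
  shows "openin (manifold_topology A) W \<longleftrightarrow> W \<subseteq> points A \<and> (\<forall>i. open (cimg A i W))"
proof -
  have "istopology (\<lambda>W. W \<subseteq> points A \<and> (\<forall>i. open (cimg A i W)))"
    unfolding istopology_def
  proof (intro conjI allI impI)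
    fix W W' i
    assume "W \<subseteq> points A \<and> (\<forall>i. open (cimg A i W))" "W' \<subseteq> points A \<and> (\<forall>i. open (cimg A i W'))"
    then show "W \<inter> W' \<subseteq> points A" "open (cimg A i (W \<inter> W'))"
      by (auto simp: cimg_Int[OF assms])
  next
    fix K i
    assume K: "\<forall>W\<in>K. W \<subseteq> points A \<and> (\<forall>i. open (cimg A i W))"
    then show "\<Union> K \<subseteq> points A" by blast
    have "cimg A i (\<Union> K) = (\<Union>W\<in>K. cimg A i W)" by blast
    then show "open (cimg A i (\<Union> K))" using K by auto
  qed
  then show ?thesis by (simp add: manifold_topology_def topology_inverse')
qed

lemma open_cimg: "smooth_atlas A \<Longrightarrow> openin (manifold_topology A) W \<Longrightarrow> open (cimg A i W)"
  by (simp add: openin_manifold)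

lemma openin_cdom: "smooth_atlas A \<Longrightarrow> openin (manifold_topology A) (cdom A i)"
  by (auto simp: openin_manifold smooth_atlas_def Int_commute cdom_points)

lemma openin_cdom_Int:
  "smooth_atlas A \<Longrightarrow> openin (manifold_topology A) W \<Longrightarrow> openin (manifold_topology A) (W \<inter> cdom A i)"
  by (simp add: openin_cdom openin_Int)

lemma open_cdom_img: "smooth_atlas A \<Longrightarrow> open (cmap A i ` cdom A i)"
  using open_cimg[OF _ openin_cdom, of A i i] by simp

lemma smooth_on_transition:
  "smooth_atlas A \<Longrightarrow> smooth_on (cimg A i (cdom A j)) (transition A i j)"
  by (simp add: smooth_atlas_def Int_commute)

lemma jac_has_derivative:
  assumes "smooth_atlas A" "p \<in> cdom A i" "p \<in> cdom A j"
  shows "(transition A i j has_derivative jac A i j p) (at (cmap A i p))"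
  using smooth_on_has_derivative[OF smooth_on_transition[OF assms(1)]] assms by blast

lemma linear_jac:
  assumes "smooth_atlas A" "p \<in> cdom A i" "p \<in> cdom A j"
  shows "linear (jac A i j p)"
  using jac_has_derivative[OF assms] has_derivative_linear by blast

text \<open>\<open>f\<close> takes values in any normed space: with \<open>f\<close> a chart map
  this is the cocycle rule for Jacobians, with \<open>f\<close> real-valued it makes
  \<open>dir_deriv\<close> independent of the chart.\<close>

lemma fd_change_chart:
  assumes A: "smooth_atlas A" and p: "p \<in> cdom A i" "p \<in> cdom A j"
    and d: "((f \<circ> cinv A j) has_derivative f') (at (cmap A j p))"
  shows "((f \<circ> cinv A i) has_derivative (\<lambda>v. f' (jac A i j p v))) (at (cmap A i p))"
proof -
  have "((\<lambda>y. (f \<circ> cinv A j) (transition A i j y)) has_derivative (\<lambda>v. f' (jac A i j p v))) (at (cmap A i p))"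
    using has_derivative_compose[OF jac_has_derivative[OF A p], of "f \<circ> cinv A j" f'] d
    by (simp only: transition_cmap[OF A p(1)])
  then show ?thesis
    by (rule has_derivative_transform_within_open[OF _ open_cimg[OF A openin_cdom[OF A, of j], of i]])
      (use A p in \<open>auto simp: transition_cmap cinv_cmap\<close>)
qed

lemma jac_cocycle:
  assumes A: "smooth_atlas A" and p: "p \<in> cdom A i" "p \<in> cdom A j" "p \<in> cdom A k"
  shows "jac A j k p (jac A i j p v) = jac A i k p v"
  using fd_eqI[OF fd_change_chart[OF A p(1,2), of "cmap A k" "jac A j k p"]]
    jac_has_derivative[OF A p(2,3)]
  by (simp add: transition_def)

lemma jac_self:
  assumes A: "smooth_atlas A" and p: "p \<in> cdom A i"
  shows "jac A i i p v = v"
proof -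
  have "jac A i i p = fd (\<lambda>x. x) (cmap A i p)"
    using p by (intro fd_cong_open[OF open_cdom_img[OF A]]) (auto simp: transition_cmap[OF A])
  then show ?thesis by simp
qed

section \<open>Tangent spaces in a chart\<close>

lemma tangent_fst: "X \<in> tangent_space A p \<Longrightarrow> fst X = p"
  by (simp add: tangent_space_def)

lemma tangent_point: "X \<in> tangent_space A p \<Longrightarrow> p \<in> points A"
  by (simp add: tangent_space_def)

lemma tangent_change:
  "X \<in> tangent_space A p \<Longrightarrow> p \<in> cdom A i \<Longrightarrow> p \<in> cdom A j \<Longrightarrow> snd X j = jac A i j p (snd X i)"
  unfolding tangent_space_def by blast

lemma tangent_outside: "X \<in> tangent_space A p \<Longrightarrow> p \<notin> cdom A j \<Longrightarrow> snd X j = 0"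
  unfolding tangent_space_def by blast

lemma fst_tvec_of [simp]: "fst (tvec_of A i p a) = p"
  by (simp add: tvec_of_def)

lemma snd_tvec_of: "p \<in> cdom A j \<Longrightarrow> snd (tvec_of A i p a) j = jac A i j p a"
  by (simp add: tvec_of_def)

lemma snd_tvec_of_self: "smooth_atlas A \<Longrightarrow> p \<in> cdom A i \<Longrightarrow> snd (tvec_of A i p a) i = a"
  by (simp add: tvec_of_def jac_self)

lemma tvec_of_tangent:
  "smooth_atlas A \<Longrightarrow> p \<in> cdom A i \<Longrightarrow> tvec_of A i p a \<in> tangent_space A p"
  by (auto simp: tangent_space_def tvec_of_def jac_cocycle cdom_points)

lemma tangent_eqI:
  assumes "X \<in> tangent_space A p" "Y \<in> tangent_space A p" "p \<in> cdom A i" "snd X i = snd Y i"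
  shows "X = Y"
proof (rule prod_eqI)
  show "fst X = fst Y" using assms by (simp add: tangent_fst)
  show "snd X = snd Y"
  proof
    fix j
    show "snd X j = snd Y j"
      by (cases "p \<in> cdom A j")
        (use assms tangent_change[of _ A p i j] tangent_outside[of _ A p j] in auto)
  qed
qed

lemma tvec_of_snd:
  assumes "smooth_atlas A" "X \<in> tangent_space A p" "p \<in> cdom A i"
  shows "tvec_of A i p (snd X i) = X"
  using assms by (intro tangent_eqI[OF tvec_of_tangent]) (auto simp: snd_tvec_of_self)

lemma fst_tops [simp]:
  "fst (tadd X Y) = fst X" "fst (tsub X Y) = fst X" "fst (tscale c X) = fst X" "fst (tzero p) = p"
  by (simp_all add: tadd_def tsub_def tscale_def tzero_def)

lemma snd_tops [simp]:
  "snd (tadd X Y) i = snd X i + snd Y i" "snd (tsub X Y) i = snd X i - snd Y i"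
  "snd (tscale c X) i = c *\<^sub>R snd X i" "snd (tzero p) i = 0"
  by (simp_all add: tadd_def tsub_def tscale_def tzero_def)

lemma tangentI:
  assumes "fst X = p" "p \<in> points A" "\<And>i. p \<notin> cdom A i \<Longrightarrow> snd X i = 0"
    "\<And>i j. p \<in> cdom A i \<Longrightarrow> p \<in> cdom A j \<Longrightarrow> snd X j = jac A i j p (snd X i)"
  shows "X \<in> tangent_space A p"
  using assms by (simp add: tangent_space_def)

lemma tangent_closed:
  assumes A: "smooth_atlas A" and X: "X \<in> tangent_space A p"
  shows "Y \<in> tangent_space A p \<Longrightarrow> tadd X Y \<in> tangent_space A p"
    "Y \<in> tangent_space A p \<Longrightarrow> tsub X Y \<in> tangent_space A p"
    "tscale c X \<in> tangent_space A p"
proof -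
  show "tscale c X \<in> tangent_space A p"
  proof (rule tangentI)
    fix i j assume ij: "p \<in> cdom A i" "p \<in> cdom A j"
    show "snd (tscale c X) j = jac A i j p (snd (tscale c X) i)"
      by (simp add: tangent_change[OF X ij] linear_scale[OF linear_jac[OF A ij]])
  qed (use X in \<open>auto simp: tangent_fst tangent_point tangent_outside\<close>)
  assume Y: "Y \<in> tangent_space A p"
  show "tadd X Y \<in> tangent_space A p"
  proof (rule tangentI)
    fix i j assume ij: "p \<in> cdom A i" "p \<in> cdom A j"
    show "snd (tadd X Y) j = jac A i j p (snd (tadd X Y) i)"
      by (simp add: tangent_change[OF X ij] tangent_change[OF Y ij] linear_add[OF linear_jac[OF A ij]])
  qed (use X Y in \<open>auto simp: tangent_fst tangent_point tangent_outside\<close>)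
  show "tsub X Y \<in> tangent_space A p"
  proof (rule tangentI)
    fix i j assume ij: "p \<in> cdom A i" "p \<in> cdom A j"
    show "snd (tsub X Y) j = jac A i j p (snd (tsub X Y) i)"
      by (simp add: tangent_change[OF X ij] tangent_change[OF Y ij] linear_diff[OF linear_jac[OF A ij]])
  qed (use X Y in \<open>auto simp: tangent_fst tangent_point tangent_outside\<close>)
qed

lemma tzero_tangent: "smooth_atlas A \<Longrightarrow> p \<in> points A \<Longrightarrow> tzero p \<in> tangent_space A p"
  by (auto simp: tangent_space_def linear_0[OF linear_jac])

lemma dir_deriv_chart:
  assumes A: "smooth_atlas A" and X: "X \<in> tangent_space A p" and i: "p \<in> cdom A i"
    and d: "((f \<circ> cinv A i) has_derivative f') (at (cmap A i p))"
  shows "dir_deriv A f X = f' (snd X i)"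
proof -
  let ?j = "some_chart A p"
  have j: "p \<in> cdom A ?j" using i some_chart cdom_points by metis
  have "fd (f \<circ> cinv A ?j) (cmap A ?j p) = (\<lambda>v. f' (jac A ?j i p v))"
    by (rule fd_eqI[OF fd_change_chart[OF A j i d]])
  then show ?thesis
    using tangent_change[OF X j i] by (simp add: dir_deriv_def tangent_fst[OF X] Let_def)
qed

lemma openin_subset_points:
  "smooth_atlas A \<Longrightarrow> openin (manifold_topology A) W \<Longrightarrow> W \<subseteq> points A"
  by (simp add: openin_manifold)

text \<open>Smoothness has to be verified in every chart \<open>j\<close>: there the component is
  the Jacobian from \<open>i\<close> to \<open>j\<close> at a moving point, applied to the moving
  vector \<open>\<xi>\<close>, a case of \<open>smooth_on_fd_apply\<close>.\<close>

lemma vector_field_tvec_of: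
  assumes A: "smooth_atlas A" and W: "openin (manifold_topology A) W" "W \<subseteq> cdom A i"
    and \<xi>: "smooth_on (cimg A i W) \<xi>"
  shows "vector_field A W (\<lambda>p. tvec_of A i p (\<xi> (cmap A i p)))"
  unfolding vector_field_def
proof (intro conjI ballI allI)
  fix p assume "p \<in> W"
  then show "tvec_of A i p (\<xi> (cmap A i p)) \<in> tangent_space A p"
    using W tvec_of_tangent[OF A] by blast
next
  fix j
  have 1: "transition A j i ` cimg A j W \<subseteq> cimg A i W" "transition A j i ` cimg A j W \<subseteq> cimg A i (cdom A j)"
    using W(2) by (auto simp: transition_cmap[OF A])
  have op: "open (cimg A j W)" "open (cimg A i W)" "open (cimg A i (cdom A j))"
    using open_cimg[OF A] W(1) openin_cdom[OF A] by auto
  have tr: "smooth_on (cimg A j W) (transition A j i)"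
    using W(2) by (intro smooth_on_subset[OF smooth_on_transition[OF A]]) auto
  have "smooth_on (cimg A j W) (\<lambda>y. fd (transition A i j) (transition A j i y) (\<xi> (transition A j i y)))"
    using smooth_on_fd_apply[OF op(1) smooth_on_compose[OF op(1,2) 1(1) tr \<xi>] op(3)
        smooth_on_transition[OF A] tr 1(2)] .
  then show "smooth_on (cimg A j W)
      (\<lambda>y. snd (tvec_of A i (cinv A j y) (\<xi> (cmap A i (cinv A j y)))) j)"
    by (rule smooth_on_transform[OF _ op(1)])
      (auto simp: cinv_cmap[OF A] transition_cmap[OF A] snd_tvec_of)
qed

section \<open>Vector fields and brackets in a chart\<close>

abbreviation lcomp :: "('i, 'a, 'e) atlas \<Rightarrow> 'i \<Rightarrow> ('a \<Rightarrow> ('a, 'i, 'e) tvec) \<Rightarrow> 'e \<Rightarrow> 'e" where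
  "lcomp A i X \<equiv> \<lambda>y. snd (X (cinv A i y)) i"

lemma vector_field_smooth: "vector_field A W X \<Longrightarrow> smooth_on (cimg A i W) (lcomp A i X)"
  by (simp add: vector_field_def)

lemma vector_field_tangent: "vector_field A W X \<Longrightarrow> p \<in> W \<Longrightarrow> X p \<in> tangent_space A p"
  by (simp add: vector_field_def)

lemma vector_field_has_derivative:
  assumes "vector_field A W X" "p \<in> W" "p \<in> cdom A i"
  shows "(lcomp A i X has_derivative fd (lcomp A i X) (cmap A i p)) (at (cmap A i p))"
  using smooth_on_has_derivative[OF vector_field_smooth[OF assms(1)]] assms by blast

text \<open>Differentiating \<open>X\<^sub>j \<circ> T = DT \<cdot> X\<^sub>i\<close> along \<open>Y\<close> produces the term \<open>D\<^sup>2T(X, Y)\<close>, whose symmetry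
  makes it cancel in the bracket.\<close>

lemma bracket_tangent:
  assumes A: "smooth_atlas A" and W: "openin (manifold_topology A) W" "p \<in> W"
    and X: "vector_field A W X" and Y: "vector_field A W Y"
  shows "bracket A X Y p \<in> tangent_space A p"
proof -
  have key: "fd (lcomp A j X) (cmap A j p) (jac A i j p v) =
      fd (\<lambda>z. fd (transition A i j) z (lcomp A i X (cmap A i p))) (cmap A i p) v
        + jac A i j p (fd (lcomp A i X) (cmap A i p) v)"
    if X: "vector_field A W X" and i: "p \<in> cdom A i" and j: "p \<in> cdom A j" for X i j v
  proof -
    let ?N = "cimg A i (W \<inter> cdom A j)" and ?T = "transition A i j" and ?y = "cmap A i p"
    have N: "open ?N" "?y \<in> ?N"
      using open_cimg[OF A openin_cdom_Int[OF A W(1)]] W i j by auto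
    have s: "smooth_on ?N ?T" by (rule smooth_on_subset[OF smooth_on_transition[OF A]]) auto
    have d1: "((\<lambda>y. lcomp A j X (?T y)) has_derivative (\<lambda>v. fd (lcomp A j X) (cmap A j p) (jac A i j p v))) (at ?y)"
      using vector_field_has_derivative[OF X W(2) j] transition_cmap[OF A i]
      by (intro has_derivative_compose[OF jac_has_derivative[OF A i j]]) simp
    have d2: "((\<lambda>y. fd ?T y (lcomp A i X y)) has_derivative
        (\<lambda>v. fd (\<lambda>z. fd ?T z (lcomp A i X ?y)) ?y v + fd ?T ?y (fd (lcomp A i X) ?y v))) (at ?y)"
      by (rule has_derivative_fd_apply[OF N(1) s N(2) vector_field_has_derivative[OF X W(2) i]])
    have eq: "lcomp A j X (?T y) = fd ?T y (lcomp A i X y)" if yN: "y \<in> ?N" for y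
    proof -
      obtain q where q: "q \<in> W" "q \<in> cdom A j" "q \<in> cdom A i" "y = cmap A i q" using yN by blast
      show ?thesis
        using tangent_change[OF vector_field_tangent[OF X q(1)] q(3,2)] q
        by (simp add: cinv_cmap[OF A] transition_cmap[OF A])
    qed
    have "(\<lambda>v. fd (lcomp A j X) (cmap A j p) (jac A i j p v)) =
        (\<lambda>v. fd (\<lambda>z. fd ?T z (lcomp A i X ?y)) ?y v + fd ?T ?y (fd (lcomp A i X) ?y v))"
      using has_derivative_transform_within_open[OF d1 N eq] d2 has_derivative_unique by blast
    then show ?thesis by (rule fun_cong)
  qed
  show ?thesis
    unfolding tangent_space_def
  proof (intro CollectI conjI allI impI)
    show "fst (bracket A X Y p) = p" "p \<in> points A"
      using openin_subset_points[OF A W(1)] W by (auto simp: bracket_def)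
    show "snd (bracket A X Y p) i = 0" if "p \<notin> cdom A i" for i
      using that by (simp add: bracket_def)
    fix i j assume "p \<in> cdom A i \<inter> cdom A j"
    then have ij: "p \<in> cdom A i" "p \<in> cdom A j" by auto
    have comp: "snd (X p) j = jac A i j p (snd (X p) i)" "snd (Y p) j = jac A i j p (snd (Y p) i)"
      using tangent_change[OF vector_field_tangent[OF X W(2)] ij]
        tangent_change[OF vector_field_tangent[OF Y W(2)] ij] .
    have sym: "fd (\<lambda>z. fd (transition A i j) z a) (cmap A i p) b =
        fd (\<lambda>z. fd (transition A i j) z b) (cmap A i p) a" for a b
      using ij by (intro fd_symmetric[OF open_cimg[OF A openin_cdom[OF A]] smooth_on_transition[OF A]]) auto
    show "snd (bracket A X Y p) j = jac A i j p (snd (bracket A X Y p) i)"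
      using key[OF Y ij, of "snd (X p) i"] key[OF X ij, of "snd (Y p) i"] sym[of "snd (X p) i" "snd (Y p) i"]
      by (simp add: bracket_def ij comp linear_diff[OF linear_jac[OF A ij]] cinv_cmap[OF A])
  qed
qed

section \<open>The slit tangent bundle\<close>

lemma cmap_slit: "cmap (slit A) i w = (cmap A i (fst w), snd w i)"
  by (simp add: slit_def restrict_atlas_def tangent_atlas_def cmap_def)

lemma cdom_slit:
  "w \<in> cdom (slit A) i \<longleftrightarrow>
    fst w \<in> cdom A i \<and> w \<in> tangent_space A (fst w) \<and> w \<noteq> tzero (fst w)"
  by (auto simp: slit_def restrict_atlas_def tangent_atlas_def cdom_def tangent_fst)

lemma points_slit: "w \<in> points (slit A) \<longleftrightarrow> w \<in> tangent_space A (fst w) \<and> w \<noteq> tzero (fst w)"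
  using tangent_point[of w A "fst w"] by (auto simp: points_def cdom_slit)

lemma points_tangent_atlas: "w \<in> points (tangent_atlas A) \<longleftrightarrow> w \<in> tangent_space A (fst w)"
proof
  assume "w \<in> points (tangent_atlas A)"
  then obtain p where "w \<in> tangent_space A p" by (auto simp: points_def tangent_atlas_def cdom_def)
  then show "w \<in> tangent_space A (fst w)" using tangent_fst by metis
next
  assume w: "w \<in> tangent_space A (fst w)"
  then obtain i where "fst w \<in> cdom A i" using tangent_point[OF w] by (auto simp: points_def)
  with w show "w \<in> points (tangent_atlas A)" by (auto simp: points_def tangent_atlas_def cdom_def)
qed

lemma cdom_slitI: "w \<in> points (slit A) \<Longrightarrow> fst w \<in> cdom A i \<Longrightarrow> w \<in> cdom (slit A) i"
  by (simp add: cdom_slit points_slit)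

lemma cdom_slitD:
  assumes "w \<in> cdom (slit A) i"
  shows "fst w \<in> cdom A i" "w \<in> tangent_space A (fst w)" "w \<in> points (slit A)"
  using assms by (simp_all add: cdom_slit points_slit)

text \<open>Whether a vector lies in the slit bundle can be tested in one chart, because one
  component determines a tangent vector.\<close>

lemma nonzero_component:
  assumes A: "smooth_atlas A" and w: "w \<in> tangent_space A (fst w)" and i: "fst w \<in> cdom A i"
  shows "w \<noteq> tzero (fst w) \<longleftrightarrow> snd w i \<noteq> 0"
  using tangent_eqI[OF w tzero_tangent[OF A cdom_points[OF i]] i] by auto (metis snd_tops(4))

lemma tvec_of_slit:
  assumes A: "smooth_atlas A" and p: "p \<in> cdom A i" and a: "a \<noteq> 0"
  shows "tvec_of A i p a \<in> cdom (slit A) i"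
  using nonzero_component[OF A, of "tvec_of A i p a" i] p a
  by (simp add: cdom_slit tvec_of_tangent[OF A p] snd_tvec_of_self[OF A p])

definition over :: "('i, 'a, 'e::euclidean_space) atlas \<Rightarrow> 'a set \<Rightarrow> ('a, 'i, 'e) tvec set" where
  "over A W = {w \<in> points (slit A). fst w \<in> W}"

text \<open>Every nonzero fibre component is attained, so preimages under the projection have
  product images in the charts; openness, and smoothness of functions of the base point, are read
  off from this form.\<close>

lemma cimg_over:
  fixes A :: "('i, 'a, 'e::euclidean_space) atlas"
  assumes A: "smooth_atlas A"
  shows "cimg (slit A) i (over A W) = cimg A i W \<times> (- {0 :: 'e})"
proof (intro equalityI subsetI)
  fix z assume "z \<in> cimg (slit A) i (over A W)"
  then obtain w where w: "w \<in> cdom (slit A) i" "fst w \<in> W" "z = cmap (slit A) i w"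
    by (auto simp: over_def)
  then show "z \<in> cimg A i W \<times> (- {0 :: 'e})"
    using nonzero_component[OF A, of w i] by (auto simp: cdom_slit cmap_slit)
next
  fix z assume "z \<in> cimg A i W \<times> (- {0 :: 'e})"
  then obtain p a where p: "p \<in> W" "p \<in> cdom A i" "a \<noteq> 0" "z = (cmap A i p, a)" by auto
  have "z = cmap (slit A) i (tvec_of A i p a)"
    using p by (simp add: cmap_slit snd_tvec_of_self[OF A])
  then show "z \<in> cimg (slit A) i (over A W)"
    using tvec_of_slit[OF A p(2,3)] p cdom_slitD(3)[OF tvec_of_slit[OF A p(2,3)]]
    by (auto simp: over_def)
qed

lemma cdom_slit_over:
  "cdom (slit A) i \<inter> cdom (slit A) j = over A (cdom A j) \<inter> cdom (slit A) i"
  by (auto simp: over_def cdom_slit points_slit)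

lemma slit_inj:
  assumes A: "smooth_atlas A"
  shows "inj_on (cmap (slit A) i) (cdom (slit A) i)"
proof (rule inj_onI)
  fix w w' assume w: "w \<in> cdom (slit A) i" "w' \<in> cdom (slit A) i" "cmap (slit A) i w = cmap (slit A) i w'"
  then have "fst w = fst w'"
    using inj_cmap[OF A, of i] by (auto simp: cmap_slit cdom_slit inj_on_def)
  then show "w = w'"
    using w by (intro tangent_eqI[of w A "fst w" w' i]) (auto simp: cmap_slit cdom_slit)
qed

lemma cinv_slit_cmap:
  assumes A: "smooth_atlas A" and w: "w \<in> cdom (slit A) i"
  shows "cinv (slit A) i (cmap (slit A) i w) = w"
  using slit_inj[OF A] w by (simp add: cinv_def)

lemma cinv_slit:
  "smooth_atlas A \<Longrightarrow> w \<in> cdom (slit A) i \<Longrightarrow> cinv (slit A) i (cmap A i (fst w), snd w i) = w"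
  using cinv_slit_cmap[of A w i] by (simp add: cmap_slit)

lemma transition_slit:
  assumes A: "smooth_atlas A" and w: "w \<in> cdom (slit A) i" "w \<in> cdom (slit A) j"
  shows "transition (slit A) i j (cmap (slit A) i w) =
    (transition A i j (cmap A i (fst w)), jac A i j (fst w) (snd w i))"
  using w tangent_change[of w A "fst w" i j]
  by (simp add: transition_def[of "slit A"] cinv_slit[OF A] cmap_slit transition_cmap[OF A] cdom_slit)

lemma transition_slit':
  assumes A: "smooth_atlas A" and z: "z \<in> cimg (slit A) i (cdom (slit A) j)"
  shows "transition (slit A) i j z = (transition A i j (fst z), fd (transition A i j) (fst z) (snd z))"
  using z transition_slit[OF A] by (auto simp: cmap_slit)

lemma cimg_slit_cdom:
  fixes A :: "('i, 'a, 'e::euclidean_space) atlas"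
  assumes A: "smooth_atlas A"
  shows "cimg (slit A) i (cdom (slit A) j) = cimg A i (cdom A j) \<times> (- {0 :: 'e})"
  using cimg_over[OF A, of i "cdom A j"] cdom_slit_over[of A i j] by (simp add: Int_commute)

text \<open>The fibre part of a transition map is \<open>DT\<close> at the base point applied to the
  fibre coordinate, so smoothness needs the version of the derivative with moving point and
  vector.\<close>

lemma smooth_atlas_slit:
  assumes A: "smooth_atlas A"
  shows "smooth_atlas (slit A)"
  unfolding smooth_atlas_def
proof (intro conjI allI slit_inj[OF A])
  fix i j
  let ?N = "cimg (slit A) i (cdom (slit A) j)" and ?M = "cimg A i (cdom A j)"
  have M: "open ?M" by (rule open_cimg[OF A openin_cdom[OF A]])
  have N: "open ?N" unfolding cimg_slit_cdom[OF A] by (intro open_Times M) auto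
  have sub: "fst ` ?N \<subseteq> ?M" unfolding cimg_slit_cdom[OF A] by auto
  have s: "smooth_on ?N fst" "smooth_on ?N snd"
    using smooth_on_linear[OF N bounded_linear_fst] smooth_on_linear[OF N bounded_linear_snd] .
  have "smooth_on ?N (\<lambda>z. (transition A i j (fst z), fd (transition A i j) (fst z) (snd z)))"
    by (intro smooth_on_Pair[OF N] smooth_on_compose[OF N M sub s(1) smooth_on_transition[OF A]]
        smooth_on_fd_apply[OF N s(2) M smooth_on_transition[OF A] s(1) sub])
  then have "smooth_on ?N (transition (slit A) i j)"
    by (rule smooth_on_transform[OF _ N]) (rule transition_slit'[OF A])
  with N show "open (cmap (slit A) i ` (cdom (slit A) i \<inter> cdom (slit A) j))"
    "smooth_on (cmap (slit A) i ` (cdom (slit A) i \<inter> cdom (slit A) j)) (transition (slit A) i j)"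
    by (simp_all add: Int_commute)
qed

lemma openin_over:
  assumes A: "smooth_atlas A" and W: "openin (manifold_topology A) W"
  shows "openin (manifold_topology (slit A)) (over A W)"
  unfolding openin_manifold[OF smooth_atlas_slit[OF A]] cimg_over[OF A]
  using open_cimg[OF A W] by (auto simp: over_def intro: open_Times)

text \<open>The block \<open>D^2T(., y)\<close> mixes base into fibre components. Hence the fibre
  component of a vector tangent to the slit bundle has an invariant meaning only for vertical
  vectors, which is why a connection is needed.\<close>

lemma jac_slit:
  assumes A: "smooth_atlas A" and w: "w \<in> cdom (slit A) i" "w \<in> cdom (slit A) j"
  shows "jac (slit A) i j w v = (jac A i j (fst w) (fst v),
    fd (\<lambda>q. fd (transition A i j) q (snd w i)) (cmap A i (fst w)) (fst v) + jac A i j (fst w) (snd v))"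
proof -
  let ?N = "cimg (slit A) i (cdom (slit A) j)" and ?M = "cimg A i (cdom A j)" and ?z = "cmap (slit A) i w"
  let ?T = "transition A i j"
  have M: "open ?M" by (rule open_cimg[OF A openin_cdom[OF A]])
  have N: "open ?N" "?z \<in> ?N"
    using w by (auto intro: open_cimg openin_cdom smooth_atlas_slit[OF A])
  have sub: "fst ` ?N \<subseteq> ?M" unfolding cimg_slit_cdom[OF A] by auto
  have zM: "fst ?z \<in> ?M" using N sub by blast
  have f: "(fst has_derivative fst) (at ?z)" "(snd has_derivative snd) (at ?z)"
    by (auto intro: bounded_linear_imp_has_derivative bounded_linear_fst bounded_linear_snd)
  have "((\<lambda>z. (?T (fst z), fd ?T (fst z) (snd z))) has_derivative
     (\<lambda>v. (fd ?T (fst ?z) (fst v), fd (\<lambda>q. fd ?T q (snd ?z)) (fst ?z) (fst v) + fd ?T (fst ?z) (snd v)))) (at ?z)"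
    by (intro has_derivative_Pair has_derivative_compose[OF f(1)]
        smooth_on_has_derivative[OF smooth_on_transition[OF A] zM]
        has_derivative_fd_compose_apply[OF M smooth_on_transition[OF A] N sub f])
  then have "(transition (slit A) i j has_derivative
     (\<lambda>v. (fd ?T (fst ?z) (fst v), fd (\<lambda>q. fd ?T q (snd ?z)) (fst ?z) (fst v) + fd ?T (fst ?z) (snd v)))) (at ?z)"
    by (rule has_derivative_transform_within_open[OF _ N]) (simp add: transition_slit'[OF A])
  from fd_eqI[OF this] show ?thesis by (simp add: cmap_slit)
qed

text \<open>\<open>tangent_map\<close> evaluates in the chart chosen by \<open>some_chart\<close>.
  Computing there and changing charts gives the result in the given chart \<open>i\<close>, where
  the projection just drops the fibre component.\<close>

lemma d_proj_tvec_of: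
  assumes A: "smooth_atlas A" and X: "X \<in> tangent_space (slit A) w" and i: "w \<in> cdom (slit A) i"
  shows "d_proj A X = tvec_of A i (fst w) (fst (snd X i))"
proof -
  let ?k = "some_chart (slit A) w" and ?p = "fst w"
  have k: "w \<in> cdom (slit A) ?k" by (rule some_chart[OF cdom_slitD(3)[OF i]])
  have p: "?p \<in> cdom A ?k" "?p \<in> cdom A i" using i k by (auto simp: cdom_slit)
  have comp: "fd (cmap A j \<circ> fst \<circ> cinv (slit A) ?k) (cmap (slit A) ?k w) v = jac A ?k j ?p (fst v)"
    if j: "?p \<in> cdom A j" for j v
  proof -
    let ?N = "cimg (slit A) ?k (cdom (slit A) j)" and ?z = "cmap (slit A) ?k w"
    have wj: "w \<in> cdom (slit A) j" using k j by (simp add: cdom_slit)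
    then have N: "open ?N" "?z \<in> ?N"
      using k by (auto intro: open_cimg openin_cdom smooth_atlas_slit[OF A])
    have f: "(fst has_derivative fst) (at ?z)"
      by (auto intro: bounded_linear_imp_has_derivative bounded_linear_fst)
    have "((\<lambda>z. transition A ?k j (fst z)) has_derivative (\<lambda>v. jac A ?k j ?p (fst v))) (at ?z)"
      using jac_has_derivative[OF A p(1) j]
      by (intro has_derivative_compose[OF f]) (simp add: cmap_slit)
    then have "((cmap A j \<circ> fst \<circ> cinv (slit A) ?k) has_derivative (\<lambda>v. jac A ?k j ?p (fst v))) (at ?z)"
    proof (rule has_derivative_transform_within_open[OF _ N])
      fix z assume "z \<in> ?N"
      then obtain w where w: "w \<in> cdom (slit A) ?k" "z = cmap (slit A) ?k w" by blast
      show "transition A ?k j (fst z) = (cmap A j \<circ> fst \<circ> cinv (slit A) ?k) z"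
        by (simp add: w cmap_slit cinv_slit[OF A w(1)] transition_cmap[OF A cdom_slitD(1)[OF w(1)]])
    qed
    from fd_eqI[OF this] show ?thesis by simp
  qed
  have "d_proj A X = tvec_of A ?k ?p (fst (snd X ?k))"
    by (auto simp: d_proj_def tangent_map_def tangent_fst[OF X] Let_def tvec_of_def comp)
  also have "\<dots> = tvec_of A i ?p (fst (snd X i))"
    using tangent_change[OF X k i] jac_slit[OF A k i]
    by (intro tangent_eqI[OF tvec_of_tangent[OF A p(1)] tvec_of_tangent[OF A p(2)] p(2)])
      (simp add: snd_tvec_of_self[OF A p(2)] snd_tvec_of p)
  finally show ?thesis .
qed

lemma d_proj_tangent:
  assumes A: "smooth_atlas A" and X: "X \<in> tangent_space (slit A) w"
  shows "d_proj A X \<in> tangent_space A (fst w)"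
proof -
  have i: "w \<in> cdom (slit A) (some_chart (slit A) w)" by (rule some_chart[OF tangent_point[OF X]])
  show ?thesis
    unfolding d_proj_tvec_of[OF A X i] by (rule tvec_of_tangent[OF A cdom_slitD(1)[OF i]])
qed

lemma snd_d_proj:
  assumes A: "smooth_atlas A" and X: "X \<in> tangent_space (slit A) w" and i: "w \<in> cdom (slit A) i"
  shows "snd (d_proj A X) i = fst (snd X i)"
  unfolding d_proj_tvec_of[OF A X i] by (rule snd_tvec_of_self[OF A cdom_slitD(1)[OF i]])

section \<open>Vertical lifts and the map \<open>J\<close>\<close>

lemma fst_vert_lift [simp]: "fst (vert_lift A w u) = w"
  by (simp add: vert_lift_def velocity_def tadd_def tscale_def)

lemma snd_vert_lift: "snd (vert_lift A w u) i = (if w \<in> cdom (slit A) i then (0, snd u i) else 0)"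
proof -
  have "((\<lambda>t. (cmap A i (fst w), snd w i + t *\<^sub>R snd u i)) has_vector_derivative (0, snd u i)) (at 0)"
    by (auto intro!: derivative_eq_intros)
  then have "vector_derivative (\<lambda>t. (cmap A i (fst w), snd w i + t *\<^sub>R snd u i)) (at 0) = (0, snd u i)"
    by (rule vector_derivative_at)
  moreover have "tadd w (tscale 0 u) = w" by (simp add: tadd_def tscale_def)
  ultimately show ?thesis
    by (simp add: vert_lift_def velocity_def cmap_slit o_def)
qed

lemma vert_lift_tangent:
  assumes A: "smooth_atlas A" and w: "w \<in> points (slit A)" and u: "u \<in> tangent_space A (fst w)"
  shows "vert_lift A w u \<in> tangent_space (slit A) w"
proof (rule tangentI)
  fix i j assume ij: "w \<in> cdom (slit A) i" "w \<in> cdom (slit A) j"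
  have p: "fst w \<in> cdom A i" "fst w \<in> cdom A j" using ij by (auto simp: cdom_slit)
  \<comment> \<open>The second-derivative block of the slit Jacobian acts on the base component,
    which is 0 for a vertical lift.\<close>
  have 0: "linear (fd (\<lambda>q. fd (transition A i j) q (snd w i)) (cmap A i (fst w)))"
    using p by (intro smooth_on_linear_fd[OF smooth_on_fd[OF smooth_on_transition[OF A]]]) auto
  show "snd (vert_lift A w u) j = jac (slit A) i j w (snd (vert_lift A w u) i)"
    using ij tangent_change[OF u p] linear_0[OF 0] linear_0[OF linear_jac[OF A p]]
    by (simp add: snd_vert_lift jac_slit[OF A ij])
qed (use w in \<open>auto simp: snd_vert_lift\<close>)

lemma d_proj_vert_lift:
  assumes A: "smooth_atlas A" and w: "w \<in> points (slit A)" and u: "u \<in> tangent_space A (fst w)"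
  shows "d_proj A (vert_lift A w u) = tzero (fst w)"
proof -
  let ?i = "some_chart (slit A) w"
  have i: "w \<in> cdom (slit A) ?i" by (rule some_chart[OF w])
  have p: "fst w \<in> points A" by (rule tangent_point[OF u])
  show ?thesis
    using vert_lift_tangent[OF A w u] i
    by (intro tangent_eqI[OF d_proj_tangent[OF A] tzero_tangent[OF A p] cdom_slitD(1)[OF i]])
      (auto simp: snd_d_proj[OF A _ i] snd_vert_lift)
qed

lemma vert_lift_vertical:
  assumes A: "smooth_atlas A" and w: "w \<in> points (slit A)" and u: "u \<in> tangent_space A (fst w)"
  shows "vert_lift A w u \<in> vertical_space A w"
  using vert_lift_tangent[OF assms] d_proj_vert_lift[OF assms] by (simp add: vertical_space_def)

lemma vert_inv_vert_lift:
  assumes A: "smooth_atlas A" and w: "w \<in> points (slit A)" and u: "u \<in> tangent_space A (fst w)"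
  shows "vert_inv A (vert_lift A w u) = u"
proof -
  have i: "w \<in> cdom (slit A) (some_chart (slit A) w)" by (rule some_chart[OF w])
  have "inj_on (vert_lift A w) (tangent_space A (fst w))"
  proof (rule inj_onI)
    fix u v assume uv: "u \<in> tangent_space A (fst w)" "v \<in> tangent_space A (fst w)"
      "vert_lift A w u = vert_lift A w v"
    from arg_cong[OF uv(3), of "\<lambda>X. snd X (some_chart (slit A) w)"]
    show "u = v"
      using i by (intro tangent_eqI[OF uv(1,2) cdom_slitD(1)[OF i]]) (simp add: snd_vert_lift)
  qed
  then show ?thesis using u by (simp add: vert_inv_def)
qed

text \<open>Surjectivity of \<open>i_w\<close> onto the vertical space: once the base component
  vanishes, the fibre component in one chart already determines the vector.\<close>

lemma vertical_spaceE:
  assumes A: "smooth_atlas A" and X: "X \<in> vertical_space A w"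
  obtains u where "u \<in> tangent_space A (fst w)" "X = vert_lift A w u"
proof -
  let ?i = "some_chart (slit A) w"
  have Xt: "X \<in> tangent_space (slit A) w" and X0: "d_proj A X = tzero (fst w)"
    using X by (auto simp: vertical_space_def)
  have w: "w \<in> points (slit A)" by (rule tangent_point[OF Xt])
  have i: "w \<in> cdom (slit A) ?i" by (rule some_chart[OF w])
  have p: "fst w \<in> cdom A ?i" by (rule cdom_slitD(1)[OF i])
  define u where "u = tvec_of A ?i (fst w) (snd (snd X ?i))"
  have u: "u \<in> tangent_space A (fst w)" unfolding u_def by (rule tvec_of_tangent[OF A p])
  have "fst (snd X ?i) = 0" using snd_d_proj[OF A Xt i] X0 by simp
  then have "X = vert_lift A w u"
    using i by (intro tangent_eqI[OF Xt vert_lift_tangent[OF A w u] i])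
      (simp add: snd_vert_lift u_def snd_tvec_of_self[OF A p] prod_eq_iff)
  with u that show thesis by blast
qed

lemma J_map_tangent:
  assumes A: "smooth_atlas A" and X: "X \<in> tangent_space (slit A) w"
  shows "J_map A X \<in> tangent_space (slit A) w"
  unfolding J_map_def tangent_fst[OF X]
  by (rule vert_lift_tangent[OF A tangent_point[OF X] d_proj_tangent[OF A X]])

lemma snd_J_map:
  assumes A: "smooth_atlas A" and X: "X \<in> tangent_space (slit A) w" and i: "w \<in> cdom (slit A) i"
  shows "snd (J_map A X) i = (0, fst (snd X i))"
  using i by (simp add: J_map_def tangent_fst[OF X] snd_vert_lift snd_d_proj[OF A X i])

lemma vector_field_J_map:
  assumes A: "smooth_atlas A" and W: "openin (manifold_topology (slit A)) W"
    and X: "vector_field (slit A) W X"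
  shows "vector_field (slit A) W (\<lambda>z. J_map A (X z))"
  unfolding vector_field_def
proof (intro conjI ballI allI)
  fix i
  have N: "open (cimg (slit A) i W)" by (rule open_cimg[OF smooth_atlas_slit[OF A] W])
  have "smooth_on (cimg (slit A) i W) (\<lambda>y. (0, fst (lcomp (slit A) i X y)))"
    by (intro smooth_on_Pair[OF N] smooth_on_const smooth_on_fst[OF N] vector_field_smooth[OF X])
  then show "smooth_on (cimg (slit A) i W) (\<lambda>y. snd (J_map A (X (cinv (slit A) i y))) i)"
    by (rule smooth_on_transform[OF _ N])
      (auto simp: cinv_slit_cmap[OF A] snd_J_map[OF A vector_field_tangent[OF X]])
qed (use J_map_tangent[OF A] vector_field_tangent[OF X] in blast)

lemma vertical_field_vert_lift:
  assumes A: "smooth_atlas A" and W: "openin (manifold_topology A) W" and V: "vector_field A W V"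
  shows "vertical_field A (over A W) (\<lambda>z. vert_lift A z (V (fst z)))"
  unfolding vertical_field_def vector_field_def
proof (intro conjI ballI allI)
  fix w assume "w \<in> over A W"
  then have w: "w \<in> points (slit A)" "V (fst w) \<in> tangent_space A (fst w)"
    using vector_field_tangent[OF V] by (auto simp: over_def)
  show "vert_lift A w (V (fst w)) \<in> tangent_space (slit A) w" "vert_lift A w (V (fst w)) \<in> vertical_space A w"
    using vert_lift_tangent[OF A w] vert_lift_vertical[OF A w] .
next
  fix i
  let ?N = "cimg (slit A) i (over A W)"
  have N: "open ?N" by (intro open_cimg smooth_atlas_slit[OF A] openin_over[OF A W])
  have M: "open (cimg A i W)" by (rule open_cimg[OF A W])
  have sub: "fst ` ?N \<subseteq> cimg A i W" unfolding cimg_over[OF A] by auto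
  have "smooth_on ?N (\<lambda>z. (0, lcomp A i V (fst z)))"
    by (intro smooth_on_Pair[OF N] smooth_on_const
        smooth_on_compose[OF N M sub smooth_on_linear[OF N bounded_linear_fst] vector_field_smooth[OF V]])
  then show "smooth_on ?N (\<lambda>y. snd (vert_lift A (cinv (slit A) i y) (V (fst (cinv (slit A) i y)))) i)"
  proof (rule smooth_on_transform[OF _ N])
    fix z assume "z \<in> ?N"
    then obtain w where w: "w \<in> cdom (slit A) i" "z = cmap (slit A) i w" by blast
    show "snd (vert_lift A (cinv (slit A) i z) (V (fst (cinv (slit A) i z)))) i = (0, lcomp A i V (fst z))"
      by (simp add: w cmap_slit cinv_slit[OF A w(1)] snd_vert_lift cinv_cmap[OF A cdom_slitD(1)[OF w(1)]])
  qed
qed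

section \<open>The fundamental tensor in a chart\<close>

definition energy ::
  "('i, 'a, 'e::euclidean_space) atlas \<Rightarrow> (('a, 'i, 'e) tvec \<Rightarrow> real) \<Rightarrow> 'i \<Rightarrow> 'e \<times> 'e \<Rightarrow> real" where
  "energy A F i z = 1/2 * (F (cinv (slit A) i z))\<^sup>2"

text \<open>The \<open>y\<close>-Hessian of the energy, that is, the coordinate matrix of the
  fundamental tensor; the zeros select fibre directions.\<close>

definition hess ::
  "('i, 'a, 'e::euclidean_space) atlas \<Rightarrow> (('a, 'i, 'e) tvec \<Rightarrow> real) \<Rightarrow> 'i \<Rightarrow> 'e \<times> 'e \<Rightarrow> 'e \<Rightarrow> 'e \<Rightarrow> real" where
  "hess A F i z a c = fd (\<lambda>z. fd (energy A F i) z (0, a)) z (0, c)"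

lemma open_slit_img: "smooth_atlas A \<Longrightarrow> open (cmap (slit A) i ` cdom (slit A) i)"
  by (intro open_cdom_img smooth_atlas_slit)

lemma slit_img:
  fixes A :: "('i, 'a, 'e::euclidean_space) atlas"
  shows "smooth_atlas A \<Longrightarrow> cmap (slit A) i ` cdom (slit A) i = cmap A i ` cdom A i \<times> (- {0 :: 'e})"
  using cimg_slit_cdom[of A i i] by simp

lemma smooth_on_energy:
  assumes A: "smooth_atlas A" and F: "finsler_metric A F"
  shows "smooth_on (cmap (slit A) i ` cdom (slit A) i) (energy A F i)"
proof -
  let ?N = "cmap (slit A) i ` cdom (slit A) i"
  have "points (slit A) \<inter> cdom (slit A) i = cdom (slit A) i"
    by (auto simp: cdom_slitD(3))
  then have s: "smooth_on ?N (\<lambda>z. F (cinv (slit A) i z))"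
    using F by (auto simp: finsler_metric_def smooth_fun_def o_def dest: spec[of _ i])
  have "smooth_on ?N (\<lambda>z. 1/2 * (F (cinv (slit A) i z) * F (cinv (slit A) i z)))"
    using open_slit_img[OF A]
    by (intro smooth_on_bilinear[OF _ bounded_bilinear_mult] smooth_on_const s)
  then show ?thesis by (simp add: energy_def[abs_def] power2_eq_square)
qed

lemma energy_value:
  assumes A: "smooth_atlas A" and w: "w \<in> cdom (slit A) i"
    and w': "w' \<in> tangent_space A (fst w)" "snd w' i \<noteq> 0"
  shows "(F w')\<^sup>2 = 2 * energy A F i (cmap A i (fst w), snd w' i)"
proof -
  have "fst w' = fst w" using tangent_fst w' by metis
  then have "w' \<in> cdom (slit A) i"
    using w' nonzero_component[OF A, of w' i] cdom_slitD[OF w] by (auto simp: cdom_slit)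
  from cinv_slit[OF A this] show ?thesis using \<open>fst w' = fst w\<close> by (simp add: energy_def)
qed

lemma has_real_derivative_fibre_line:
  assumes "(g has_derivative g') (at (x, y))"
  shows "((\<lambda>s. g (x, y + s *\<^sub>R u)) has_real_derivative g' (0, u)) (at 0)"
proof -
  have 1: "((\<lambda>s. (x, y + s *\<^sub>R u)) has_derivative (\<lambda>t. (0, t *\<^sub>R u))) (at 0)"
    by (auto intro!: derivative_eq_intros)
  have 2: "((\<lambda>s. g (x, y + s *\<^sub>R u)) has_derivative (\<lambda>t. g' (0, t *\<^sub>R u))) (at 0)"
    using has_derivative_compose[OF 1, of g g'] assms by simp
  have "g' (0, t *\<^sub>R u) = g' (0, u) * t" for t
    using linear_scale[OF has_derivative_linear[OF assms], of t "(0, u)"] by simp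
  with 2 show ?thesis by (simp add: has_field_derivative_def)
qed

lemma fundamental_tensor_chart:
  fixes A :: "('i, 'a, 'e::euclidean_space) atlas"
  assumes A: "smooth_atlas A" and F: "finsler_metric A F" and w: "w \<in> cdom (slit A) i"
    and u: "u \<in> tangent_space A (fst w)" and v: "v \<in> tangent_space A (fst w)"
  shows "fundamental_tensor F w u v = hess A F i (cmap (slit A) i w) (snd u i) (snd v i)"
proof -
  let ?E = "energy A F i" and ?x = "cmap A i (fst w)" and ?y = "snd w i" and ?u = "snd u i" and ?v = "snd v i"
  let ?N = "cmap (slit A) i ` cdom (slit A) i"
  have wt: "w \<in> tangent_space A (fst w)" by (rule cdom_slitD(2)[OF w])
  have mem: "(?x, a) \<in> ?N" if "a \<noteq> 0" for a
    using that cdom_slitD(1)[OF w] unfolding slit_img[OF A] by auto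
  have y0: "?y \<noteq> 0" using nonzero_component[OF A wt cdom_slitD(1)[OF w]] w by (simp add: cdom_slit)
  \<comment> \<open>\<open>w + s u + t v\<close> may cross the zero section, where the slit chart
    gives nothing; the open set of admissible parameters keeps the derivatives local.\<close>
  have op: "open {t. c + t *\<^sub>R b \<noteq> 0}" for b c :: 'e
    by (intro open_Collect_neq continuous_intros)
  \<comment> \<open>Required for all \<open>t\<close> near 0 and not only at 0, because the outer
    \<open>deriv\<close> differentiates this value as a function of \<open>t\<close>.\<close>
  have inner: "deriv (\<lambda>s. (F (tadd (tadd w (tscale s u)) (tscale t v)))\<^sup>2) 0 = 2 * fd ?E (?x, ?y + t *\<^sub>R ?v) (0, ?u)"
    if t: "?y + t *\<^sub>R ?v \<noteq> 0" for t
  proof -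
    have "((\<lambda>s. 2 * ?E (?x, (?y + t *\<^sub>R ?v) + s *\<^sub>R ?u)) has_real_derivative
        2 * fd ?E (?x, ?y + t *\<^sub>R ?v) (0, ?u)) (at 0)"
      by (intro DERIV_cmult has_real_derivative_fibre_line
          smooth_on_has_derivative[OF smooth_on_energy[OF A F] mem[OF t]])
    then have "((\<lambda>s. (F (tadd (tadd w (tscale s u)) (tscale t v)))\<^sup>2) has_real_derivative
        2 * fd ?E (?x, ?y + t *\<^sub>R ?v) (0, ?u)) (at 0)"
    proof (rule has_field_derivative_transform_within_open[OF _ op])
      fix s assume s: "s \<in> {s. (?y + t *\<^sub>R ?v) + s *\<^sub>R ?u \<noteq> 0}"
      have "tadd (tadd w (tscale s u)) (tscale t v) \<in> tangent_space A (fst w)"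
        by (intro tangent_closed[OF A] wt u v)
      from energy_value[OF A w this, of F] s
      show "2 * ?E (?x, (?y + t *\<^sub>R ?v) + s *\<^sub>R ?u) = (F (tadd (tadd w (tscale s u)) (tscale t v)))\<^sup>2"
        by (simp add: add_ac)
    qed (use t in auto)
    then show ?thesis by (rule DERIV_imp_deriv)
  qed
  have "((\<lambda>t. 2 * fd ?E (?x, ?y + t *\<^sub>R ?v) (0, ?u)) has_real_derivative
      2 * fd (\<lambda>z. fd ?E z (0, ?u)) (?x, ?y) (0, ?v)) (at 0)"
    by (intro DERIV_cmult has_real_derivative_fibre_line
        smooth_on_has_derivative[OF smooth_on_fd[OF smooth_on_energy[OF A F]] mem[OF y0]])
  then have "((\<lambda>t. deriv (\<lambda>s. (F (tadd (tadd w (tscale s u)) (tscale t v)))\<^sup>2) 0) has_real_derivative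
      2 * fd (\<lambda>z. fd ?E z (0, ?u)) (?x, ?y) (0, ?v)) (at 0)"
    by (rule has_field_derivative_transform_within_open[OF _ op[of ?y ?v]]) (use y0 in \<open>auto simp: inner\<close>)
  from DERIV_imp_deriv[OF this] show ?thesis
    by (simp add: fundamental_tensor_def hess_def cmap_slit)
qed

text \<open>Linearity is immediate in the direction of the outer derivative; symmetry of second
  derivatives carries it over to the other slot.\<close>

lemma hess_linear:
  assumes A: "smooth_atlas A" and F: "finsler_metric A F" and z: "z \<in> cmap (slit A) i ` cdom (slit A) i"
  shows "hess A F i z a c = hess A F i z c a" "linear (hess A F i z a)" "linear (\<lambda>a. hess A F i z a c)"
proof -
  have sym: "hess A F i z a c = hess A F i z c a" for a c
    unfolding hess_def by (rule fd_symmetric[OF open_slit_img[OF A] smooth_on_energy[OF A F] z])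
  then show "hess A F i z a c = hess A F i z c a" .
  have l: "linear (fd (\<lambda>z. fd (energy A F i) z (0, a)) z)" for a
    by (rule smooth_on_linear_fd[OF smooth_on_fd[OF smooth_on_energy[OF A F]] z])
  have l2: "linear (hess A F i z a)" for a
    unfolding hess_def using l[of a] linear_add[OF l[of a], of "(0, _)" "(0, _)"]
      linear_scale[OF l[of a], of _ "(0, _)"]
    by (intro linearI) auto
  then show "linear (hess A F i z a)" .
  show "linear (\<lambda>a. hess A F i z a c)" using l2[of c] by (simp add: sym[of _ c])
qed

section \<open>Homogeneity and Euler relations\<close>

lemma energy_homogeneous:
  assumes A: "smooth_atlas A" and F: "finsler_metric A F"
    and z: "(x, y) \<in> cmap (slit A) i ` cdom (slit A) i" and c: "c > 0"
  shows "energy A F i (x, c *\<^sub>R y) = c\<^sup>2 * energy A F i (x, y)"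
proof -
  obtain w where w: "w \<in> cdom (slit A) i" "(x, y) = (cmap A i (fst w), snd w i)"
    using z by (auto simp: cmap_slit)
  have wt: "w \<in> tangent_space A (fst w)" by (rule cdom_slitD(2)[OF w(1)])
  have y: "snd w i \<noteq> 0" using nonzero_component[OF A wt cdom_slitD(1)[OF w(1)]] w by (simp add: cdom_slit)
  have "F (tscale c w) = c * F w"
    using F c wt by (simp add: finsler_metric_def points_tangent_atlas)
  then show ?thesis
    using energy_value[OF A w(1) wt y, of F] energy_value[OF A w(1) tangent_closed(3)[OF A wt], of c F] y c w(2)
    by (simp add: power_mult_distrib)
qed

lemma fd_energy_homogeneous:
  assumes A: "smooth_atlas A" and F: "finsler_metric A F"
    and z: "(x, y) \<in> cmap (slit A) i ` cdom (slit A) i" and c: "c > 0"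
  shows "fd (energy A F i) (x, c *\<^sub>R y) (0, u) = c * fd (energy A F i) (x, y) (0, u)"
proof -
  let ?E = "energy A F i" and ?N = "cmap (slit A) i ` cdom (slit A) i"
  have y0: "y \<noteq> 0" and x: "x \<in> cmap A i ` cdom A i" using z unfolding slit_img[OF A] by auto
  have mem: "(x, a) \<in> ?N" if "a \<noteq> 0" for a using x that unfolding slit_img[OF A] by auto
  have op: "open {t. y + t *\<^sub>R u \<noteq> 0}" by (intro open_Collect_neq continuous_intros)
  \<comment> \<open>The direction is \<open>c u\<close> so that
    \<open>c y + s c u = c (y + s u)\<close> and homogeneity of degree two applies along the line;
    linearity removes one factor \<open>c\<close> afterwards.\<close>
  have "((\<lambda>s. ?E (x, c *\<^sub>R y + s *\<^sub>R (c *\<^sub>R u))) has_real_derivative fd ?E (x, c *\<^sub>R y) (0, c *\<^sub>R u)) (at 0)"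
    using c y0 by (intro has_real_derivative_fibre_line smooth_on_has_derivative[OF smooth_on_energy[OF A F] mem]) auto
  then have "((\<lambda>s. c\<^sup>2 * ?E (x, y + s *\<^sub>R u)) has_real_derivative fd ?E (x, c *\<^sub>R y) (0, c *\<^sub>R u)) (at 0)"
  proof (rule has_field_derivative_transform_within_open[OF _ op])
    fix s assume "s \<in> {t. y + t *\<^sub>R u \<noteq> 0}"
    then have "(x, y + s *\<^sub>R u) \<in> ?N" by (simp add: mem)
    from energy_homogeneous[OF A F this c]
    show "?E (x, c *\<^sub>R y + s *\<^sub>R (c *\<^sub>R u)) = c\<^sup>2 * ?E (x, y + s *\<^sub>R u)"
      by (simp add: scaleR_add_right mult.commute)
  qed (use y0 in auto)
  moreover have "((\<lambda>s. c\<^sup>2 * ?E (x, y + s *\<^sub>R u)) has_real_derivative c\<^sup>2 * fd ?E (x, y) (0, u)) (at 0)"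
    by (intro DERIV_cmult has_real_derivative_fibre_line smooth_on_has_derivative[OF smooth_on_energy[OF A F] z])
  ultimately have eq: "fd ?E (x, c *\<^sub>R y) (0, c *\<^sub>R u) = c\<^sup>2 * fd ?E (x, y) (0, u)"
    by (rule DERIV_unique)
  have "linear (fd ?E (x, c *\<^sub>R y))"
    using c y0 by (intro smooth_on_linear_fd[OF smooth_on_energy[OF A F] mem]) auto
  from linear_scale[OF this, of c "(0, u)"] eq c show ?thesis by (simp add: power2_eq_square)
qed

text \<open>Euler's relation for the fibre derivative of the energy, which is homogeneous of degree
  one: along the ray \<open>y + t y\<close> it equals \<open>(1 + t)\<close> times its value at
  \<open>y\<close>.\<close>

lemma hess_self:
  assumes A: "smooth_atlas A" and F: "finsler_metric A F"
    and z: "(x, y) \<in> cmap (slit A) i ` cdom (slit A) i"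
  shows "hess A F i (x, y) u y = fd (energy A F i) (x, y) (0, u)"
proof -
  let ?E = "energy A F i"
  have "((\<lambda>t. fd ?E (x, y + t *\<^sub>R y) (0, u)) has_real_derivative hess A F i (x, y) u y) (at 0)"
    unfolding hess_def
    by (intro has_real_derivative_fibre_line smooth_on_has_derivative[OF smooth_on_fd[OF smooth_on_energy[OF A F]] z])
  then have "((\<lambda>t. (1 + t) * fd ?E (x, y) (0, u)) has_real_derivative hess A F i (x, y) u y) (at 0)"
  proof (rule has_field_derivative_transform_within_open[of _ _ _ "{-1<..}"])
    \<comment> \<open>Homogeneity is available for positive factors only, and
      \<open>1 + t > 0\<close> on this set.\<close>
    fix t :: real assume "t \<in> {-1<..}"
    then show "fd ?E (x, y + t *\<^sub>R y) (0, u) = (1 + t) * fd ?E (x, y) (0, u)"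
      using fd_energy_homogeneous[OF A F z, of "1 + t" u] by (simp add: scaleR_add_left)
  qed auto
  moreover have "((\<lambda>t. (1 + t) * fd ?E (x, y) (0, u)) has_real_derivative fd ?E (x, y) (0, u)) (at 0)"
    by (auto intro!: derivative_eq_intros)
  ultimately show ?thesis by (rule DERIV_unique)
qed

text \<open>Pairing with the base vector costs one derivative instead of two. The Legendre map, the
  spray equation on vertical vectors and the function \<open>g(V^v, C)\<close> all rest on this
  form.\<close>

lemma fundamental_tensor_self:
  assumes A: "smooth_atlas A" and F: "finsler_metric A F" and w: "w \<in> cdom (slit A) i"
    and u: "u \<in> tangent_space A (fst w)"
  shows "fundamental_tensor F w w u = fd (energy A F i) (cmap (slit A) i w) (0, snd u i)"
    "fundamental_tensor F w u w = fd (energy A F i) (cmap (slit A) i w) (0, snd u i)"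
proof -
  have z: "cmap (slit A) i w \<in> cmap (slit A) i ` cdom (slit A) i" using w by blast
  have "hess A F i (cmap (slit A) i w) (snd u i) (snd w i) = fd (energy A F i) (cmap (slit A) i w) (0, snd u i)"
    using hess_self[OF A F z[unfolded cmap_slit[of A i w]]] by (simp add: cmap_slit)
  then show "fundamental_tensor F w w u = fd (energy A F i) (cmap (slit A) i w) (0, snd u i)"
    "fundamental_tensor F w u w = fd (energy A F i) (cmap (slit A) i w) (0, snd u i)"
    using fundamental_tensor_chart[OF A F w cdom_slitD(2)[OF w] u]
      fundamental_tensor_chart[OF A F w u cdom_slitD(2)[OF w]] hess_linear(1)[OF A F z, of "snd u i" "snd w i"]
    by simp_all
qed

lemma fundamental_tensor_sym:
  assumes A: "smooth_atlas A" and F: "finsler_metric A F" and w: "w \<in> points (slit A)"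
    and u: "u \<in> tangent_space A (fst w)" and v: "v \<in> tangent_space A (fst w)"
  shows "fundamental_tensor F w u v = fundamental_tensor F w v u"
proof -
  note i = some_chart[OF w]
  show ?thesis
    unfolding fundamental_tensor_chart[OF A F i u v] fundamental_tensor_chart[OF A F i v u]
    using i by (intro hess_linear(1)[OF A F]) auto
qed

lemma fundamental_tensor_linear:
  assumes A: "smooth_atlas A" and F: "finsler_metric A F" and w: "w \<in> points (slit A)"
    and u: "u \<in> tangent_space A (fst w)" "u' \<in> tangent_space A (fst w)" and v: "v \<in> tangent_space A (fst w)"
  shows "fundamental_tensor F w v (tadd u u') = fundamental_tensor F w v u + fundamental_tensor F w v u'"
    "fundamental_tensor F w v (tscale c u) = c * fundamental_tensor F w v u"
proof -
  note i = some_chart[OF w]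
  have l: "linear (hess A F (some_chart (slit A) w) (cmap (slit A) (some_chart (slit A) w) w) a)" for a
    using i by (intro hess_linear(2)[OF A F]) auto
  show "fundamental_tensor F w v (tadd u u') = fundamental_tensor F w v u + fundamental_tensor F w v u'"
    "fundamental_tensor F w v (tscale c u) = c * fundamental_tensor F w v u"
    using tangent_closed[OF A u(1)] u v
    by (simp_all add: fundamental_tensor_chart[OF A F i] linear_add[OF l] linear_scale[OF l])
qed

lemma vert_metric_vert_lift:
  assumes A: "smooth_atlas A" and w: "w \<in> points (slit A)"
    and u: "u \<in> tangent_space A (fst w)" and v: "v \<in> tangent_space A (fst w)"
  shows "vert_metric A F (vert_lift A w u) (vert_lift A w v) = fundamental_tensor F w u v"
  by (simp add: vert_metric_def vert_inv_vert_lift[OF A w] u v)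

section \<open>The geodesic spray is a second-order field\<close>

lemma cdom_cotangent:
  "\<alpha> \<in> cdom (cotangent_atlas A) k \<longleftrightarrow> fst \<alpha> \<in> cdom A k \<and> \<alpha> \<in> cotangent_space A (fst \<alpha>)"
  by (auto simp: cotangent_atlas_def cdom_def cotangent_space_def)

lemma coord_vec_eq:
  assumes A: "smooth_atlas A" and p: "p \<in> cdom A k"
  shows "coord_vec A k p a = tvec_of A k p a"
  unfolding coord_vec_def
  by (rule the_equality)
    (auto simp: tvec_of_tangent[OF A p] snd_tvec_of_self[OF A p]
      intro: tangent_eqI[OF _ tvec_of_tangent[OF A p] p])

lemma legendre_cotangent:
  assumes A: "smooth_atlas A" and F: "finsler_metric A F" and w: "w \<in> points (slit A)"
  shows "legendre A F w \<in> cotangent_space A (fst w)"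
proof -
  have wt: "w \<in> tangent_space A (fst w)" using w by (simp add: points_slit)
  show ?thesis
    using tangent_closed[OF A] tangent_point[OF wt] fundamental_tensor_linear[OF A F w _ _ wt]
    by (auto simp: cotangent_space_def legendre_def)
qed

text \<open>Two charts occur because \<open>tangent_map\<close> and
  \<open>canonical_symplectic\<close> choose theirs separately. The momenta in chart
  \<open>k\<close> are the fibre derivative of the energy in chart \<open>i\<close>, evaluated on
  the coordinate vectors of \<open>k\<close> rewritten in \<open>i\<close>.\<close>

lemma legendre_chart:
  assumes A: "smooth_atlas A" and F: "finsler_metric A F"
    and w: "w \<in> cdom (slit A) i" "w \<in> cdom (slit A) k"
  shows "(cmap (cotangent_atlas A) k \<circ> legendre A F \<circ> cinv (slit A) i) (cmap (slit A) i w) =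
    (transition A i k (cmap A i (fst w)),
     \<Sum>b\<in>Basis. fd (energy A F i) (cmap (slit A) i w)
        (0, fd (transition A k i) (transition A i k (cmap A i (fst w))) b) *\<^sub>R b)"
proof -
  note p = cdom_slitD(1)[OF w(1)] cdom_slitD(1)[OF w(2)]
  show ?thesis
    using tvec_of_tangent[OF A p(2)]
    by (simp add: cinv_slit_cmap[OF A w(1)] cotangent_atlas_def cmap_def[of "\<lambda>i. (_ i, _ i)"]
        legendre_def transition_cmap[OF A p(1)] coord_vec_eq[OF A p(2)]
        fundamental_tensor_self(1)[OF A F w(1)] snd_tvec_of[OF p(1)])
qed

text \<open>The fibre part \<open>q\<close> of the derivative is recorded on vertical vectors only,
  where the derivatives of the Jacobians drop out and the Hessian remains; the pairing of
  \<open>omega_F\<close> with a vertical vector needs no more.\<close>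

lemma legendre_has_derivative:
  assumes A: "smooth_atlas A" and F: "finsler_metric A F"
    and w: "w \<in> cdom (slit A) i" "w \<in> cdom (slit A) k"
  obtains q where
    "((cmap (cotangent_atlas A) k \<circ> legendre A F \<circ> cinv (slit A) i) has_derivative
       (\<lambda>v. (jac A i k (fst w) (fst v), q v))) (at (cmap (slit A) i w))"
    "\<And>c. q (0, c) = (\<Sum>b\<in>Basis. hess A F i (cmap (slit A) i w) (jac A k i (fst w) b) c *\<^sub>R b)"
proof -
  let ?N = "cimg (slit A) i (cdom (slit A) k)" and ?M = "cimg A i (cdom A k)" and ?z = "cmap (slit A) i w"
  let ?T = "transition A i k" and ?T' = "transition A k i" and ?E = "energy A F i"
  note p = cdom_slitD(1)[OF w(1)] cdom_slitD(1)[OF w(2)]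
  have M: "open ?M" "open (cimg A k (cdom A i))" by (auto intro: open_cimg openin_cdom A)
  have N: "open ?N" "?z \<in> ?N"
    using w by (auto intro: open_cimg openin_cdom smooth_atlas_slit[OF A])
  have sub: "fst ` ?N \<subseteq> ?M" unfolding cimg_slit_cdom[OF A] by auto
  have zM: "fst ?z \<in> ?M" using N sub by blast
  have f: "(fst has_derivative fst) (at ?z)"
    by (auto intro: bounded_linear_imp_has_derivative bounded_linear_fst)
  have sE: "smooth_on ?N ?E" by (rule smooth_on_subset[OF smooth_on_energy[OF A F]]) auto
  \<comment> \<open>\<open>r b x\<close> is the \<open>i\<close>-component of the
    \<open>b\<close>-th coordinate vector of chart \<open>k\<close> at the point with
    \<open>i\<close>-coordinates \<open>x\<close>.\<close>
  define r where "r b x = fd ?T' (?T x) b" for b x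
  have "smooth_on ?M (r b)" for b
    unfolding r_def
    by (rule smooth_on_compose[OF M(1) M(2) _ smooth_on_transition[OF A] smooth_on_fd[OF smooth_on_transition[OF A]]])
      (auto simp: transition_cmap[OF A])
  then have dr: "(r b has_derivative fd (r b) (fst ?z)) (at (fst ?z))" for b
    using smooth_on_has_derivative zM by blast
  have dr': "((\<lambda>z. (0, r b (fst z))) has_derivative (\<lambda>v. (0, fd (r b) (fst ?z) (fst v)))) (at ?z)" for b
    by (intro has_derivative_Pair has_derivative_const has_derivative_compose[OF f dr])
  define q where "q v = (\<Sum>b\<in>Basis. (fd (\<lambda>z. fd ?E z (0, r b (fst ?z))) ?z v
     + fd ?E ?z (0, fd (r b) (fst ?z) (fst v))) *\<^sub>R b)" for v
  have "((\<lambda>z. (?T (fst z), \<Sum>b\<in>Basis. fd ?E z (0, r b (fst z)) *\<^sub>R b)) has_derivative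
     (\<lambda>v. (jac A i k (fst w) (fst v), q v))) (at ?z)"
    unfolding q_def
    by (intro has_derivative_Pair has_derivative_sum has_derivative_scaleR_left
        has_derivative_fd_apply[OF N(1) sE N(2) dr'] has_derivative_compose[OF f])
      (use jac_has_derivative[OF A p] in \<open>simp add: cmap_slit\<close>)
  then have "((cmap (cotangent_atlas A) k \<circ> legendre A F \<circ> cinv (slit A) i) has_derivative
       (\<lambda>v. (jac A i k (fst w) (fst v), q v))) (at ?z)"
  proof (rule has_derivative_transform_within_open[OF _ N])
    fix z assume "z \<in> ?N"
    then obtain w' where w': "w' \<in> cdom (slit A) i" "w' \<in> cdom (slit A) k" "z = cmap (slit A) i w'" by blast
    show "(?T (fst z), \<Sum>b\<in>Basis. fd ?E z (0, r b (fst z)) *\<^sub>R b) =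
        (cmap (cotangent_atlas A) k \<circ> legendre A F \<circ> cinv (slit A) i) z"
      unfolding w'(3) legendre_chart[OF A F w'(1,2)] by (simp add: r_def cmap_slit)
  qed
  moreover have "q (0, c) = (\<Sum>b\<in>Basis. hess A F i ?z (jac A k i (fst w) b) c *\<^sub>R b)" for c
  proof -
    have "fd (r b) (fst ?z) 0 = 0" for b by (rule linear_0[OF has_derivative_linear[OF dr]])
    moreover have "fd ?E ?z (0, 0) = 0"
      using linear_0[OF smooth_on_linear_fd[OF sE N(2)]] by (simp add: zero_prod_def)
    ultimately show ?thesis
      by (simp add: q_def hess_def r_def cmap_slit transition_cmap[OF A p(1)])
  qed
  ultimately show thesis by (rule that)
qed

text \<open>The image of a vertical vector under the Legendre map has base component 0, so one of
  the two terms of \<open>dx \<and> dp\<close> vanishes and the other contracts the base component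
  of \<open>X\<close> with the Hessian.\<close>

lemma omega_F_vertical:
  assumes A: "smooth_atlas A" and F: "finsler_metric A F"
    and X: "X \<in> tangent_space (slit A) w" and v: "v \<in> tangent_space A (fst w)"
  shows "omega_F A F X (vert_lift A w v) = fundamental_tensor F w (d_proj A X) v"
proof -
  let ?i = "some_chart (slit A) w" and ?k = "some_chart (cotangent_atlas A) (legendre A F w)"
  have w: "w \<in> points (slit A)" by (rule tangent_point[OF X])
  have i: "w \<in> cdom (slit A) ?i" by (rule some_chart[OF w])
  have "legendre A F w \<in> cdom (cotangent_atlas A) ?i"
    using legendre_cotangent[OF A F w] cdom_slitD(1)[OF i] by (simp add: cdom_cotangent legendre_def)
  then have lk: "legendre A F w \<in> cdom (cotangent_atlas A) ?k" by (rule some_chart[OF cdom_points])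
  then have pk: "fst w \<in> cdom A ?k" by (simp add: cdom_cotangent legendre_def)
  have k: "w \<in> cdom (slit A) ?k" by (rule cdom_slitI[OF w pk])
  note p = cdom_slitD(1)[OF i] pk
  obtain q where q: "((cmap (cotangent_atlas A) ?k \<circ> legendre A F \<circ> cinv (slit A) ?i) has_derivative
       (\<lambda>v. (jac A ?i ?k (fst w) (fst v), q v))) (at (cmap (slit A) ?i w))"
    "\<And>c. q (0, c) = (\<Sum>b\<in>Basis. hess A F ?i (cmap (slit A) ?i w) (jac A ?k ?i (fst w) b) c *\<^sub>R b)"
    by (rule legendre_has_derivative[OF A F i k]) blast
  let ?H = "hess A F ?i (cmap (slit A) ?i w)" and ?s = "jac A ?i ?k (fst w) (fst (snd X ?i))"
  have lH: "linear (\<lambda>a. ?H a c)" for c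
    using i by (intro hess_linear(3)[OF A F]) auto
  have lHj: "linear (\<lambda>a. ?H (jac A ?k ?i (fst w) a) c)" for c
    using linear_compose[OF linear_jac[OF A p(2,1)] lH[of c]] by (simp add: o_def)
  have "omega_F A F X (vert_lift A w v) = ?s \<bullet> q (0, snd v ?i)"
    using i lk fd_eqI[OF q(1)] linear_0[OF linear_jac[OF A p]]
    by (simp add: omega_F_def canonical_symplectic_def tangent_map_def Let_def tangent_fst[OF X]
        snd_vert_lift)
  also have "\<dots> = (\<Sum>b\<in>Basis. (?s \<bullet> b) *\<^sub>R ?H (jac A ?k ?i (fst w) b) (snd v ?i))"
    by (simp add: q(2) inner_sum_right mult.commute)
  also have "\<dots> = ?H (jac A ?k ?i (fst w) ?s) (snd v ?i)"
    by (rule linear_expand[OF lHj, symmetric])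
  \<comment> \<open>The base component of \<open>X\<close> was carried from \<open>i\<close> to
    \<open>k\<close>, the coordinate vectors from \<open>k\<close> to \<open>i\<close>; the two
    Jacobians cancel by the cocycle rule.\<close>
  also have "\<dots> = ?H (fst (snd X ?i)) (snd v ?i)"
    using jac_cocycle[OF A p p(1)] jac_self[OF A p(1)] by simp
  also have "\<dots> = fundamental_tensor F w (d_proj A X) v"
    by (simp add: fundamental_tensor_chart[OF A F i d_proj_tangent[OF A X] v] snd_d_proj[OF A X i])
  finally show ?thesis .
qed

text \<open>On vertical vectors the two sides of the spray equation are \<open>g_w(w, v)\<close> and
  \<open>g_w(d\<pi>(S w), v)\<close>. Taking \<open>v\<close> to be the difference
  \<open>d\<pi>(S w) - w\<close> contradicts positive definiteness unless it is 0.\<close>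

lemma d_proj_spray:
  assumes A: "smooth_atlas A" and F: "finsler_metric A F" and S: "geodesic_spray A F S"
    and w: "w \<in> points (slit A)"
  shows "d_proj A (S w) = w"
proof (rule ccontr)
  assume ne: "d_proj A (S w) \<noteq> w"
  let ?i = "some_chart (slit A) w" and ?s = "d_proj A (S w)"
  have i: "w \<in> cdom (slit A) ?i" by (rule some_chart[OF w])
  have wt: "w \<in> tangent_space A (fst w)" by (rule cdom_slitD(2)[OF i])
  have Sw: "S w \<in> tangent_space (slit A) w" using S w by (auto simp: geodesic_spray_def vector_field_def)
  have st: "?s \<in> tangent_space A (fst w)" by (rule d_proj_tangent[OF A Sw])
  have eq: "fundamental_tensor F w w v = fundamental_tensor F w ?s v" if v: "v \<in> tangent_space A (fst w)" for v
  proof -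
    have vl: "vert_lift A w v \<in> tangent_space (slit A) w" by (rule vert_lift_tangent[OF A w v])
    have "(((\<lambda>z. 1/2 * (F z)\<^sup>2) \<circ> cinv (slit A) ?i) has_derivative fd (energy A F ?i) (cmap (slit A) ?i w)) (at (cmap (slit A) ?i w))"
      using smooth_on_has_derivative[OF smooth_on_energy[OF A F], of "cmap (slit A) ?i w" ?i] i
      by (simp add: o_def energy_def[abs_def])
    then have "dir_deriv (slit A) (\<lambda>z. 1/2 * (F z)\<^sup>2) (vert_lift A w v) =
        fd (energy A F ?i) (cmap (slit A) ?i w) (snd (vert_lift A w v) ?i)"
      by (rule dir_deriv_chart[OF smooth_atlas_slit[OF A] vl i])
    also have "\<dots> = fundamental_tensor F w w v"
      using i by (simp add: fundamental_tensor_self[OF A F i v] snd_vert_lift)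
    finally show ?thesis
      using S w vl omega_F_vertical[OF A F Sw v] by (simp add: geodesic_spray_def)
  qed
  have d: "tsub ?s w \<in> tangent_space A (fst w)" by (rule tangent_closed(2)[OF A st wt])
  have z: "cmap (slit A) ?i w \<in> cmap (slit A) ?i ` cdom (slit A) ?i" using i by blast
  have "fundamental_tensor F w (tsub ?s w) (tsub ?s w) = 0"
    using eq[OF d] linear_diff[OF hess_linear(3)[OF A F z]]
    by (simp add: fundamental_tensor_chart[OF A F i] d st wt)
  moreover have "tsub ?s w \<noteq> tzero (fst w)"
    using ne tangent_eqI[OF st wt cdom_slitD(1)[OF i]] by (auto dest: arg_cong[where f = "\<lambda>X. snd X ?i"])
  moreover have "\<forall>u\<in>tangent_space A (fst w). u \<noteq> tzero (fst w) \<longrightarrow> fundamental_tensor F w u u > 0"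
    using F w by (simp add: finsler_metric_def)
  ultimately show False using d by fastforce
qed

section \<open>The canonical connection in a chart\<close>

lemma vector_field_subset: "vector_field A W X \<Longrightarrow> W' \<subseteq> W \<Longrightarrow> vector_field A W' X"
  unfolding vector_field_def by (blast intro: smooth_on_subset)

lemma openin_points: "smooth_atlas A \<Longrightarrow> openin (manifold_topology A) (points A)"
proof -
  assume A: "smooth_atlas A"
  have "points A \<inter> cdom A i = cdom A i" for i by (auto simp: points_def)
  then show ?thesis by (simp add: openin_manifold[OF A] open_cdom_img[OF A])
qed

text \<open>Writing \<open>S = (y, G(x, y))\<close> in chart \<open>i\<close>, this is
  \<open>D_yG\<close> at \<open>w\<close> applied to \<open>a\<close>; half of it is the fibre
  component of the horizontal lift of \<open>a\<close>.\<close>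

definition spray_coeff ::
  "('i, 'a, 'e::euclidean_space) atlas \<Rightarrow> (('a, 'i, 'e) tvec \<Rightarrow> ('a, 'i, 'e) ttvec) \<Rightarrow> 'i \<Rightarrow>
   ('a, 'i, 'e) tvec \<Rightarrow> 'e \<Rightarrow> 'e" where
  "spray_coeff A S i w a = snd (fd (lcomp (slit A) i S) (cmap (slit A) i w) (0, a))"

text \<open>The only derivative of \<open>Y\<close> that enters is the base part of
  \<open>DY(S)\<close>. It occurs in \<open>J[S, Y]\<close> and in \<open>[S, JY]\<close> and
  cancels in the difference, so the value at \<open>w\<close> depends on \<open>Y w\<close> alone:
  this is the tensoriality of \<open>\<Gamma>_S\<close>.\<close>

lemma Gamma_field_chart:
  assumes A: "smooth_atlas A" and S: "vector_field (slit A) (points (slit A)) S"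
    and SC: "\<forall>w\<in>points (slit A). d_proj A (S w) = w"
    and W: "openin (manifold_topology (slit A)) W" "w \<in> W" and Y: "vector_field (slit A) W Y"
    and i: "w \<in> cdom (slit A) i"
  shows "Gamma_field A S Y w \<in> tangent_space (slit A) w"
    "snd (Gamma_field A S Y w) i =
      (fst (snd (Y w) i), spray_coeff A S i w (fst (snd (Y w) i)) - snd (snd (Y w) i))"
proof -
  let ?B = "slit A" and ?z = "cmap (slit A) i w" and ?N = "cimg (slit A) i W"
  let ?S = "lcomp ?B i S" and ?Y = "lcomp ?B i Y" and ?JY = "lcomp ?B i (\<lambda>z. J_map A (Y z))"
  note B = smooth_atlas_slit[OF A]
  have S': "vector_field ?B W S"
    by (rule vector_field_subset[OF S openin_subset_points[OF B W(1)]])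
  have JY: "vector_field ?B W (\<lambda>z. J_map A (Y z))" by (rule vector_field_J_map[OF A W(1) Y])
  have N: "open ?N" "?z \<in> ?N" using open_cimg[OF B W(1)] W(2) i by auto
  note dS = vector_field_has_derivative[OF S' W(2) i] and dY = vector_field_has_derivative[OF Y W(2) i]
  have br: "bracket ?B S Y w \<in> tangent_space ?B w" "bracket ?B S (\<lambda>z. J_map A (Y z)) w \<in> tangent_space ?B w"
    by (rule bracket_tangent[OF B W S' Y], rule bracket_tangent[OF B W S' JY])
  show G: "Gamma_field A S Y w \<in> tangent_space ?B w"
    unfolding Gamma_field_def by (rule tangent_closed(2)[OF B J_map_tangent[OF A br(1)] br(2)])
  \<comment> \<open>\<open>J(S) = C\<close> in coordinates: the base component of \<open>S\<close>
    is the fibre coordinate, so its derivative is the projection \<open>snd\<close>.\<close>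
  have s: "fst (?S z) = snd z" if z: "z \<in> ?N" for z
  proof -
    obtain v where v: "v \<in> cdom ?B i" "z = cmap ?B i v" "v \<in> W" using z by blast
    have "snd (d_proj A (S v)) i = fst (snd (S v) i)"
      by (rule snd_d_proj[OF A vector_field_tangent[OF S' v(3)] v(1)])
    then show ?thesis
      using SC cdom_slitD(3)[OF v(1)] unfolding v(2) cinv_slit_cmap[OF A v(1)] by (simp add: cmap_slit)
  qed
  have "((\<lambda>z. fst (?S z)) has_derivative (\<lambda>v. fst (fd ?S ?z v))) (at ?z)"
    by (rule has_derivative_fst[OF dS])
  from has_derivative_transform_within_open[OF this N s]
  have "(snd has_derivative (\<lambda>v. fst (fd ?S ?z v))) (at ?z)" .
  moreover have "(snd has_derivative snd) (at ?z)"
    by (rule bounded_linear_imp_has_derivative[OF bounded_linear_snd])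
  ultimately have fstS: "fst (fd ?S ?z v) = snd v" for v
    using has_derivative_unique by metis
  have "((\<lambda>z. (0, fst (?Y z))) has_derivative (\<lambda>v. (0, fst (fd ?Y ?z v)))) (at ?z)"
    by (intro has_derivative_Pair has_derivative_const has_derivative_fst[OF dY])
  then have "(?JY has_derivative (\<lambda>v. (0, fst (fd ?Y ?z v)))) (at ?z)"
  proof (rule has_derivative_transform_within_open[OF _ N])
    fix z assume "z \<in> ?N"
    then obtain v where v: "v \<in> cdom ?B i" "z = cmap ?B i v" "v \<in> W" by blast
    show "(0, fst (?Y z)) = ?JY z"
      using snd_J_map[OF A vector_field_tangent[OF Y v(3)] v(1)] by (simp add: v cinv_slit_cmap[OF A v(1)])
  qed
  from fd_eqI[OF this] have fdJY: "fd ?JY ?z v = (0, fst (fd ?Y ?z v))" for v by simp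
  have JYw: "snd (J_map A (Y w)) i = (0, fst (snd (Y w) i))"
    by (rule snd_J_map[OF A vector_field_tangent[OF Y W(2)] i])
  have "fst (snd (bracket ?B S Y w) i) = fst (fd ?Y ?z (snd (S w) i)) - snd (snd (Y w) i)"
    using i by (simp add: bracket_def fstS)
  moreover have "snd (bracket ?B S (\<lambda>z. J_map A (Y z)) w) i =
      (0, fst (fd ?Y ?z (snd (S w) i))) - (fst (snd (Y w) i), spray_coeff A S i w (fst (snd (Y w) i)))"
    using i fstS[of "(0, fst (snd (Y w) i))"]
    by (simp add: bracket_def fdJY JYw spray_coeff_def prod_eq_iff)
  ultimately show "snd (Gamma_field A S Y w) i =
      (fst (snd (Y w) i), spray_coeff A S i w (fst (snd (Y w) i)) - snd (snd (Y w) i))"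
    by (simp add: Gamma_field_def snd_J_map[OF A br(1) i])
qed

text \<open>Guarantees that the choice of an extension inside \<open>Gamma\<close> is not vacuous:
  constant components in one chart extend any vector.\<close>

lemma tangent_extension:
  assumes B: "smooth_atlas B" and X: "X \<in> tangent_space B w"
  shows "\<exists>Y. field_near B w Y \<and> Y w = X"
proof -
  let ?i = "some_chart B w"
  have i: "w \<in> cdom B ?i" by (rule some_chart[OF tangent_point[OF X]])
  have "vector_field B (cdom B ?i) (\<lambda>p. tvec_of B ?i p (snd X ?i))"
    by (rule vector_field_tvec_of[OF B openin_cdom[OF B] order_refl smooth_on_const])
  then have "field_near B w (\<lambda>p. tvec_of B ?i p (snd X ?i))"
    using i openin_cdom[OF B] by (auto simp: field_near_def open_nbhd_def)
  then show ?thesis using tvec_of_snd[OF B X i] by blast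
qed

text \<open>The fixed vectors of \<open>(a, c) \<mapsto> (a, D_yG a - c)\<close> are those with
  \<open>2 c = D_yG a\<close>.\<close>

lemma horizontal_space_chart:
  assumes A: "smooth_atlas A" and S: "vector_field (slit A) (points (slit A)) S"
    and SC: "\<forall>w\<in>points (slit A). d_proj A (S w) = w"
    and X: "X \<in> tangent_space (slit A) w" and i: "w \<in> cdom (slit A) i"
  shows "X \<in> horizontal_space A S w \<longleftrightarrow> 2 *\<^sub>R snd (snd X i) = spray_coeff A S i w (fst (snd X i))"
proof -
  note B = smooth_atlas_slit[OF A]
  define Y where "Y = (SOME Y. field_near (slit A) w Y \<and> Y w = X)"
  have Y: "field_near (slit A) w Y" "Y w = X"
    using someI_ex[OF tangent_extension[OF B X]] by (auto simp: Y_def)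
  then obtain W where W: "openin (manifold_topology (slit A)) W" "w \<in> W" "vector_field (slit A) W Y"
    by (auto simp: field_near_def open_nbhd_def)
  have G: "Gamma A S X = Gamma_field A S Y w" by (simp add: Gamma_def tangent_fst[OF X] Y_def)
  note Gf = Gamma_field_chart[OF A S SC W i]
  have "X \<in> horizontal_space A S w \<longleftrightarrow> Gamma_field A S Y w = X"
    using X by (simp add: horizontal_space_def G)
  also have "\<dots> \<longleftrightarrow> snd (Gamma_field A S Y w) i = snd X i"
    using tangent_eqI[OF Gf(1) X i] by auto
  also have "\<dots> \<longleftrightarrow> 2 *\<^sub>R snd (snd X i) = spray_coeff A S i w (fst (snd X i))"
    by (auto simp: Gf(2) Y(2) prod_eq_iff scaleR_2 algebra_simps)
  finally show ?thesis .
qed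

text \<open>Resolves the two descriptions behind \<open>vert_proj\<close> and
  \<open>hor_lift\<close>. Existence and uniqueness follow because a horizontal vector is determined
  by its base component, which subtracting a vertical vector does not change.\<close>

lemma horizontal_vertical_decomposition:
  assumes A: "smooth_atlas A" and S: "vector_field (slit A) (points (slit A)) S"
    and SC: "\<forall>w\<in>points (slit A). d_proj A (S w) = w"
    and X: "X \<in> tangent_space (slit A) w"
  shows "vert_proj A S X \<in> vertical_space A w" "hor_lift A S w (d_proj A X) = tsub X (vert_proj A S X)"
    "hor_lift A S w (d_proj A X) \<in> tangent_space (slit A) w"
proof -
  let ?B = "slit A" and ?i = "some_chart (slit A) w"
  note B = smooth_atlas_slit[OF A]
  have w: "w \<in> points ?B" by (rule tangent_point[OF X])
  have i: "w \<in> cdom ?B ?i" by (rule some_chart[OF w])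
  note p = cdom_slitD(1)[OF i]
  note hor = horizontal_space_chart[OF A S SC _ i]
  have vert: "V \<in> vertical_space A w \<Longrightarrow> fst (snd V ?i) = 0" for V
    using i by (auto elim!: vertical_spaceE[OF A] simp: snd_vert_lift)
  have vt: "V \<in> vertical_space A w \<Longrightarrow> V \<in> tangent_space ?B w" for V by (simp add: vertical_space_def)
  have ht: "V \<in> horizontal_space A S w \<Longrightarrow> V \<in> tangent_space ?B w" for V by (simp add: horizontal_space_def)
  \<comment> \<open>The fibre component of \<open>X\<close> minus the one required of a horizontal
    vector with the same base component.\<close>
  define c where "c = snd (snd X ?i) - (1/2) *\<^sub>R spray_coeff A S ?i w (fst (snd X ?i))"
  define V where "V = vert_lift A w (tvec_of A ?i (fst w) c)"
  have V: "V \<in> vertical_space A w" unfolding V_def by (rule vert_lift_vertical[OF A w tvec_of_tangent[OF A p]])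
  have sV: "snd V ?i = (0, c)" using i by (simp add: V_def snd_vert_lift snd_tvec_of_self[OF A p])
  have XV: "tsub X V \<in> tangent_space ?B w" by (rule tangent_closed(2)[OF B X vt[OF V]])
  have h: "tsub X V \<in> horizontal_space A S w"
    unfolding hor[OF XV] by (simp add: sV c_def scaleR_diff_right)
  have uniq: "V' = V" if V': "V' \<in> vertical_space A w" "tsub X V' \<in> horizontal_space A S w" for V'
  proof (rule tangent_eqI[OF vt[OF V'(1)] vt[OF V] i])
    have "2 *\<^sub>R (snd (snd X ?i) - snd (snd V' ?i)) = spray_coeff A S ?i w (fst (snd X ?i))"
      using V'(2) hor[OF ht[OF V'(2)]] vert[OF V'(1)] by simp
    then have "(1/2) *\<^sub>R (2 *\<^sub>R (snd (snd X ?i) - snd (snd V' ?i))) = (1/2) *\<^sub>R spray_coeff A S ?i w (fst (snd X ?i))"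
      by simp
    then have "snd (snd X ?i) - snd (snd V' ?i) = (1/2) *\<^sub>R spray_coeff A S ?i w (fst (snd X ?i))"
      by simp
    then have "snd (snd V' ?i) = c" by (auto simp: c_def algebra_simps)
    then show "snd V' ?i = snd V ?i" using vert[OF V'(1)] by (simp add: sV prod_eq_iff)
  qed
  have eq: "vert_proj A S X = V"
    unfolding vert_proj_def tangent_fst[OF X] by (rule the_equality) (use V h uniq in blast)+
  show "vert_proj A S X \<in> vertical_space A w" by (simp add: eq V)
  have "fst (snd (tsub X V) ?i) = fst (snd X ?i)" by (simp add: sV)
  then have dp: "d_proj A (tsub X V) = d_proj A X"
    by (intro tangent_eqI[OF d_proj_tangent[OF A XV] d_proj_tangent[OF A X] p])
      (simp add: snd_d_proj[OF A XV i] snd_d_proj[OF A X i])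
  have uniq': "Y = tsub X V" if Y: "Y \<in> horizontal_space A S w" "d_proj A Y = d_proj A X" for Y
  proof (rule tangent_eqI[OF ht[OF Y(1)] XV i])
    have 1: "fst (snd Y ?i) = fst (snd (tsub X V) ?i)"
      using arg_cong[OF trans[OF Y(2) dp[symmetric]], of "\<lambda>X. snd X ?i"]
      by (simp only: snd_d_proj[OF A ht[OF Y(1)] i] snd_d_proj[OF A XV i])
    have "2 *\<^sub>R snd (snd Y ?i) = 2 *\<^sub>R snd (snd (tsub X V) ?i)"
      using Y(1) h by (simp only: hor[OF ht[OF Y(1)]] hor[OF XV] 1)
    then show "snd Y ?i = snd (tsub X V) ?i" using 1 by (simp add: prod_eq_iff)
  qed
  have "hor_lift A S w (d_proj A X) = tsub X V"
    unfolding hor_lift_def by (rule the_equality) (use h dp uniq' in blast)+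
  then show "hor_lift A S w (d_proj A X) = tsub X (vert_proj A S X)"
    "hor_lift A S w (d_proj A X) \<in> tangent_space (slit A) w" by (simp_all add: eq XV)
qed

section \<open>Smooth curves and embedded submanifolds\<close>

lemma smooth_map_real_line:
  assumes "smooth_map real_line A I c"
  shows "c ` I \<subseteq> points A" "open {t \<in> I. c t \<in> cdom A i}"
    "smooth_on {t \<in> I. c t \<in> cdom A i} (cmap A i \<circ> c)"
proof -
  have [simp]: "cmap real_line j = (\<lambda>t. t)" "cdom real_line j = UNIV" "cinv real_line j = (\<lambda>t. t)" for j
    by (auto simp: real_line_def cmap_def cdom_def cinv_def inv_into_def)
  show "c ` I \<subseteq> points A" "open {t \<in> I. c t \<in> cdom A i}"
    "smooth_on {t \<in> I. c t \<in> cdom A i} (cmap A i \<circ> c)"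
    using assms by (auto simp: smooth_map_def o_def image_def)
qed

lemma smooth_map_real_lineI:
  assumes "c ` I \<subseteq> points A" "\<And>i. open {t \<in> I. c t \<in> cdom A i}"
    "\<And>i. smooth_on {t \<in> I. c t \<in> cdom A i} (cmap A i \<circ> c)"
  shows "smooth_map real_line A I c"
proof -
  have [simp]: "cmap real_line j = (\<lambda>t. t)" "cdom real_line j = UNIV" "cinv real_line j = (\<lambda>t. t)" for j
    by (auto simp: real_line_def cmap_def cdom_def cinv_def inv_into_def)
  show ?thesis using assms by (auto simp: smooth_map_def o_def image_def)
qed

text \<open>Equality with the composition is asked for near 0 only: a curve is known to stay in a
  chart domain or in a slice only for small parameters.\<close>

lemma has_vector_derivative_compose_eventually:
  assumes f: "(f has_vector_derivative f') (at 0)" and g: "(g has_derivative g') (at (f 0))"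
    and ev: "eventually (\<lambda>t. h t = g (f t)) (nhds 0)"
  shows "(h has_vector_derivative g' f') (at 0)"
proof -
  obtain S where S: "open S" "0 \<in> S" "\<And>t. t \<in> S \<Longrightarrow> h t = g (f t)"
    using ev unfolding eventually_nhds by blast
  have "((\<lambda>t. g (f t)) has_vector_derivative g' f') (at 0)"
    using has_derivative_compose[OF f[unfolded has_vector_derivative_def] g]
    by (simp add: has_vector_derivative_def linear_scale[OF has_derivative_linear[OF g]])
  then show ?thesis
    by (rule has_vector_derivative_transform_within_open[OF _ S(1,2)]) (simp add: S(3))
qed

lemma velocity_works:
  assumes c: "smooth_map real_line A I c" "0 \<in> I" and i: "c 0 \<in> cdom A i"
  shows "((cmap A i \<circ> c) has_vector_derivative snd (velocity A c 0) i) (at 0)"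
proof -
  have "(cmap A i \<circ> c) differentiable (at 0)"
    by (rule smooth_on_differentiable[OF smooth_map_real_line(3)[OF c(1)]]) (use c i in auto)
  then show ?thesis using i by (simp add: velocity_def vector_derivative_works)
qed

lemma fst_velocity [simp]: "fst (velocity A c t) = c t"
  by (simp add: velocity_def)

text \<open>The manifold topology is accessible only through charts, so openness is pulled back
  along one chart at \<open>c 0\<close>; injectivity of that chart turns membership in the image of
  \<open>W\<close> back into membership in \<open>W\<close>.\<close>

lemma curve_stays_near:
  assumes A: "smooth_atlas A" and c: "smooth_map real_line A I c" "0 \<in> I"
    and W: "openin (manifold_topology A) W" "c 0 \<in> W"
  shows "eventually (\<lambda>t. c t \<in> W) (nhds 0)"
proof -
  have "c 0 \<in> points A" using openin_subset_points[OF A W(1)] W(2) by blast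
  then have i: "c 0 \<in> cdom A (some_chart A (c 0))" (is "_ \<in> cdom A ?i") by (rule some_chart)
  let ?J = "{t \<in> I. c t \<in> cdom A ?i}"
  have J: "open ?J" "smooth_on ?J (cmap A ?i \<circ> c)" using smooth_map_real_line[OF c(1)] by auto
  have "open ((cmap A ?i \<circ> c) -` cimg A ?i W \<inter> ?J)"
    using iffD1[OF continuous_on_open_vimage[OF J(1)] smooth_on_continuous_on[OF J(2)]] open_cimg[OF A W(1)]
    by blast
  then have "eventually (\<lambda>t. t \<in> (cmap A ?i \<circ> c) -` cimg A ?i W \<inter> ?J) (nhds 0)"
    using c i W by (intro eventually_nhds_in_open) auto
  then show ?thesis
    by eventually_elim (use inj_cmap[OF A, of ?i] in \<open>auto simp: inj_on_def\<close>)
qed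

lemma velocity_tangent:
  assumes A: "smooth_atlas A" and c: "smooth_map real_line A I c" "0 \<in> I"
  shows "velocity A c 0 \<in> tangent_space A (c 0)"
proof (rule tangentI)
  show "c 0 \<in> points A" using smooth_map_real_line(1)[OF c(1)] c(2) by auto
  show "snd (velocity A c 0) i = 0" if "c 0 \<notin> cdom A i" for i using that by (simp add: velocity_def)
  fix i j assume ij: "c 0 \<in> cdom A i" "c 0 \<in> cdom A j"
  have "((cmap A j \<circ> c) has_vector_derivative jac A i j (c 0) (snd (velocity A c 0) i)) (at 0)"
  proof (rule has_vector_derivative_compose_eventually[OF velocity_works[OF c ij(1)]])
    show "(transition A i j has_derivative jac A i j (c 0)) (at ((cmap A i \<circ> c) 0))"
      using jac_has_derivative[OF A ij] by simp
    show "eventually (\<lambda>t. (cmap A j \<circ> c) t = transition A i j ((cmap A i \<circ> c) t)) (nhds 0)"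
      using curve_stays_near[OF A c openin_cdom[OF A] ij(1)]
      by eventually_elim (simp add: transition_cmap[OF A])
  qed
  then show "snd (velocity A c 0) j = jac A i j (c 0) (snd (velocity A c 0) i)"
    using velocity_works[OF c ij(2)] vector_derivative_unique_at by blast
qed (simp add: velocity_def)

text \<open>\<open>L\<close> is its own double orthogonal complement, and for each \<open>y\<close>
  orthogonal to \<open>L\<close> the function \<open>y \<bullet> f\<close> vanishes near 0, so its
  derivative \<open>y \<bullet> e\<close> is 0.\<close>

lemma vector_derivative_in_subspace:
  fixes f :: "real \<Rightarrow> 'e::euclidean_space"
  assumes f: "(f has_vector_derivative e) (at 0)" and L: "subspace L"
    and ev: "eventually (\<lambda>t. f t \<in> L) (nhds 0)"
  shows "e \<in> L"
proof -
  have "y \<bullet> e = 0" if y: "y \<in> orthogonal_comp L" for y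
  proof -
    have "((\<lambda>t. 0) has_vector_derivative y \<bullet> e) (at 0)"
    proof (rule has_vector_derivative_compose_eventually[OF f])
      show "((\<lambda>z. y \<bullet> z) has_derivative (\<lambda>z. y \<bullet> z)) (at (f 0))"
        by (rule bounded_linear_imp_has_derivative[OF bounded_linear_inner_right])
      show "eventually (\<lambda>t. 0 = y \<bullet> f t) (nhds 0)"
        using ev by eventually_elim (use y in \<open>auto simp: orthogonal_comp_def orthogonal_def inner_commute\<close>)
    qed
    then show ?thesis
      using has_vector_derivative_const vector_derivative_unique_at by blast
  qed
  then have "e \<in> orthogonal_comp (orthogonal_comp L)"
    by (simp add: orthogonal_comp_def[of "orthogonal_comp L"] orthogonal_def)
  then show ?thesis by (simp add: orthogonal_comp_self[OF L])
qed

text \<open>One adapted chart \<open>\<psi>\<close> of a submanifold, flattening \<open>P\<close> to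
  \<open>L\<close>. It need not belong to the atlas; \<open>sm\<close>, \<open>opi\<close> and
  \<open>smi\<close> express that it is compatible with the atlas in both directions.\<close>

locale slice =
  fixes A :: "('i, 'a, 'e::euclidean_space) atlas" and P W :: "'a set"
    and \<psi> :: "'a \<Rightarrow> 'e" and L :: "'e set"
  assumes A: "smooth_atlas A" and W: "openin (manifold_topology A) W"
    and inj: "inj_on \<psi> W" and op: "open (\<psi> ` W)" and sm: "smooth_fun A W \<psi>"
    and opi: "\<And>i. open (\<psi> ` (W \<inter> cdom A i))"
    and smi: "\<And>i. smooth_on (\<psi> ` (W \<inter> cdom A i)) (cmap A i \<circ> inv_into W \<psi>)"
    and L: "subspace L" and slice: "\<psi> ` (W \<inter> P) = \<psi> ` W \<inter> L"
begin

text \<open>The constant field \<open>e\<close> transported by the inverse of \<open>\<psi>\<close>.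
  For \<open>e\<close> in \<open>L\<close> it is tangent to \<open>P\<close> at the points of
  \<open>P\<close> in \<open>W\<close>, which provides both the tangent spaces of \<open>P\<close>
  and smooth extensions of their vectors.\<close>

definition frame :: "'e \<Rightarrow> 'a \<Rightarrow> ('a, 'i, 'e) tvec" where
  "frame e q = (q, \<lambda>i. if q \<in> cdom A i then fd (cmap A i \<circ> inv_into W \<psi>) (\<psi> q) e else 0)"

lemma inv_psi: "q \<in> W \<Longrightarrow> inv_into W \<psi> (\<psi> q) = q"
  by (rule inv_into_f_f[OF inj])

lemma param_has_derivative:
  "q \<in> W \<Longrightarrow> q \<in> cdom A i \<Longrightarrow>
    ((cmap A i \<circ> inv_into W \<psi>) has_derivative fd (cmap A i \<circ> inv_into W \<psi>) (\<psi> q)) (at (\<psi> q))"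
  by (rule smooth_on_has_derivative[OF smi]) auto

lemma frame_tangent:
  assumes q: "q \<in> W"
  shows "frame e q \<in> tangent_space A q"
proof (rule tangentI)
  show "q \<in> points A" using openin_subset_points[OF A W] q by blast
  fix i j assume ij: "q \<in> cdom A i" "q \<in> cdom A j"
  let ?N = "\<psi> ` (W \<inter> cdom A i) \<inter> \<psi> ` (W \<inter> cdom A j)"
  have N: "open ?N" "\<psi> q \<in> ?N" using opi q ij by auto
  have "((\<lambda>y. transition A i j ((cmap A i \<circ> inv_into W \<psi>) y)) has_derivative
      (\<lambda>v. jac A i j q (fd (cmap A i \<circ> inv_into W \<psi>) (\<psi> q) v))) (at (\<psi> q))"
    using jac_has_derivative[OF A ij] inv_psi[OF q]
    by (intro has_derivative_compose[OF param_has_derivative[OF q ij(1)]]) simp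
  then have "((cmap A j \<circ> inv_into W \<psi>) has_derivative
      (\<lambda>v. jac A i j q (fd (cmap A i \<circ> inv_into W \<psi>) (\<psi> q) v))) (at (\<psi> q))"
  proof (rule has_derivative_transform_within_open[OF _ N])
    fix y assume "y \<in> ?N"
    then obtain a where a: "a \<in> W" "a \<in> cdom A i" "y = \<psi> a" by blast
    then show "transition A i j ((cmap A i \<circ> inv_into W \<psi>) y) = (cmap A j \<circ> inv_into W \<psi>) y"
      by (simp add: inv_psi transition_cmap[OF A])
  qed
  from fd_eqI[OF this] show "snd (frame e q) j = jac A i j q (snd (frame e q) i)"
    using ij by (simp add: frame_def)
qed (auto simp: frame_def)

lemma frame_linear:
  assumes q: "q \<in> W"
  shows "frame (e + e') q = tadd (frame e q) (frame e' q)" "frame (c *\<^sub>R e) q = tscale c (frame e q)"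
  using linear_add[OF has_derivative_linear[OF param_has_derivative[OF q]]]
    linear_scale[OF has_derivative_linear[OF param_has_derivative[OF q]]]
  by (auto simp: frame_def tadd_def tscale_def)

lemma frame_vector_field: "vector_field A W (frame e)"
  unfolding vector_field_def
proof (intro conjI ballI allI frame_tangent)
  fix i
  have N: "open (cimg A i W)" by (rule open_cimg[OF A W])
  have "smooth_on (cimg A i W) (\<lambda>y. fd (cmap A i \<circ> inv_into W \<psi>) ((\<psi> \<circ> cinv A i) y) e)"
  proof (rule smooth_on_compose[OF N opi _ _ smooth_on_fd[OF smi]])
    show "smooth_on (cimg A i W) (\<psi> \<circ> cinv A i)" using sm by (simp add: smooth_fun_def)
  qed (auto simp: cinv_cmap[OF A])
  then show "smooth_on (cimg A i W) (\<lambda>y. snd (frame e (cinv A i y)) i)"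
    by (rule smooth_on_transform[OF _ N]) (auto simp: frame_def cinv_cmap[OF A])
qed

text \<open>A curve in \<open>P\<close> is carried by \<open>\<psi>\<close> into \<open>L\<close>,
  so the velocity of its image lies in \<open>L\<close>; conversely \<open>\<psi>\<close> pulls a
  straight line in direction \<open>e \<in> L\<close> back to a curve in \<open>P\<close> with
  velocity \<open>frame e q\<close>.\<close>

lemma tangent_space_of_slice:
  assumes q: "q \<in> W" "q \<in> P"
  shows "tangent_space_of A P q = (\<lambda>e. frame e q) ` L"
proof (intro equalityI subsetI)
  fix v assume "v \<in> tangent_space_of A P q"
  then obtain c \<epsilon> where c: "v = velocity A c 0" "c 0 = q" "\<epsilon> > 0"
    "smooth_map real_line A {-\<epsilon><..<\<epsilon>} c" "c ` {-\<epsilon><..<\<epsilon>} \<subseteq> P"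
    unfolding tangent_space_of_def by blast
  have I: "0 \<in> {-\<epsilon><..<\<epsilon>}" using c(3) by simp
  have evW: "eventually (\<lambda>t. c t \<in> W) (nhds 0)"
    using curve_stays_near[OF A c(4) I W] q c(2) by simp
  have evP: "eventually (\<lambda>t. c t \<in> P) (nhds 0)"
    using eventually_nhds_in_open[OF open_greaterThanLessThan I] by eventually_elim (use c(5) in auto)
  have "q \<in> points A" using openin_subset_points[OF A W] q by blast
  then have i: "q \<in> cdom A (some_chart A q)" (is "_ \<in> cdom A ?i") by (rule some_chart)
  have evi: "eventually (\<lambda>t. c t \<in> cdom A ?i) (nhds 0)"
    using curve_stays_near[OF A c(4) I openin_cdom[OF A]] i c(2) by simp
  \<comment> \<open>Velocity of \<open>\<psi> \<circ> c\<close> at 0, the candidate for the constant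
    direction.\<close>
  let ?e = "fd (\<psi> \<circ> cinv A ?i) (cmap A ?i q) (snd v ?i)"
  have d: "((\<lambda>t. \<psi> (c t)) has_vector_derivative ?e) (at 0)"
  proof (rule has_vector_derivative_compose_eventually[where f = "cmap A ?i \<circ> c" and f' = "snd v ?i"
        and g = "\<psi> \<circ> cinv A ?i"])
    show "((cmap A ?i \<circ> c) has_vector_derivative snd v ?i) (at 0)"
      using velocity_works[OF c(4) I] i c(1,2) by simp
    have "smooth_on (cimg A ?i W) (\<psi> \<circ> cinv A ?i)" using sm by (simp add: smooth_fun_def)
    from smooth_on_has_derivative[OF this, of "cmap A ?i q"] q i c(2)
    show "((\<psi> \<circ> cinv A ?i) has_derivative fd (\<psi> \<circ> cinv A ?i) (cmap A ?i q)) (at ((cmap A ?i \<circ> c) 0))"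
      by simp
    show "eventually (\<lambda>t. \<psi> (c t) = (\<psi> \<circ> cinv A ?i) ((cmap A ?i \<circ> c) t)) (nhds 0)"
      using evi by eventually_elim (simp add: cinv_cmap[OF A])
  qed
  have "?e \<in> L"
  proof (rule vector_derivative_in_subspace[OF d L])
    show "eventually (\<lambda>t. \<psi> (c t) \<in> L) (nhds 0)"
      using evW evP by eventually_elim (use slice in blast)
  qed
  moreover have "v = frame ?e q"
  proof (rule prod_eqI)
    show "fst v = fst (frame ?e q)" by (simp add: c frame_def)
    show "snd v = snd (frame ?e q)"
    proof
      fix j
      show "snd v j = snd (frame ?e q) j"
      proof (cases "q \<in> cdom A j")
        case False
        then show ?thesis using c(1,2) by (simp add: frame_def velocity_def)
      next
        case True
        have "((cmap A j \<circ> c) has_vector_derivative fd (cmap A j \<circ> inv_into W \<psi>) (\<psi> q) ?e) (at 0)"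
        proof (rule has_vector_derivative_compose_eventually[OF d])
          show "((cmap A j \<circ> inv_into W \<psi>) has_derivative fd (cmap A j \<circ> inv_into W \<psi>) (\<psi> q)) (at (\<psi> (c 0)))"
            using param_has_derivative[OF q(1) True] c(2) by simp
          show "eventually (\<lambda>t. (cmap A j \<circ> c) t = (cmap A j \<circ> inv_into W \<psi>) (\<psi> (c t))) (nhds 0)"
            using evW by eventually_elim (simp add: inv_psi)
        qed
        moreover have "((cmap A j \<circ> c) has_vector_derivative snd v j) (at 0)"
          using velocity_works[OF c(4) I] True c(1,2) by simp
        ultimately show ?thesis
          using True vector_derivative_unique_at by (auto simp: frame_def)
      qed
    qed
  qed
  ultimately show "v \<in> (\<lambda>e. frame e q) ` L" by blast
next
  fix v assume "v \<in> (\<lambda>e. frame e q) ` L"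
  then obtain e where e: "e \<in> L" "v = frame e q" by blast
  \<comment> \<open>Straight line in \<open>\<psi>\<close>-coordinates; it stays in \<open>L\<close>
    for all \<open>t\<close>, and in the open image of \<open>W\<close> for small
    \<open>t\<close>.\<close>
  define l where "l t = \<psi> q + t *\<^sub>R e" for t :: real
  define c where "c t = inv_into W \<psi> (l t)" for t
  have cont: "continuous_on S l" for S unfolding l_def by (intro continuous_intros)
  have "open (l -` (\<psi> ` W))" by (rule open_vimage[OF op cont])
  moreover have "0 \<in> l -` (\<psi> ` W)" using q by (simp add: l_def)
  ultimately obtain \<epsilon> where \<epsilon>: "\<epsilon> > 0" "ball 0 \<epsilon> \<subseteq> l -` (\<psi> ` W)"
    unfolding open_contains_ball by blast
  let ?I = "{-\<epsilon><..<\<epsilon>}"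
  have I: "0 \<in> ?I" using \<epsilon> by simp
  have lW: "l t \<in> \<psi> ` W" if "t \<in> ?I" for t
    using \<epsilon>(2) that by (auto simp: subset_iff dist_real_def)
  have \<psi>c: "\<psi> (c t) = l t" "c t \<in> W" if "t \<in> ?I" for t
    using lW[OF that] by (auto simp: c_def f_inv_into_f inv_into_into)
  have lL: "l t \<in> L" for t
    using slice q e(1) L by (auto simp: l_def intro!: subspace_add subspace_scale)
  have cP: "c t \<in> P" if t: "t \<in> ?I" for t
  proof -
    have "l t \<in> \<psi> ` (W \<inter> P)" using lW[OF t] lL slice by blast
    then show ?thesis by (auto simp: c_def inv_psi)
  qed
  have c0: "c 0 = q" by (simp add: c_def l_def inv_psi q)
  \<comment> \<open>Expressing the parameter set through \<open>l\<close> makes its openness a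
    consequence of the continuity of \<open>l\<close>, before anything is known about the smoothness
    of \<open>c\<close>.\<close>
  have cdom: "{t \<in> ?I. c t \<in> cdom A i} = ?I \<inter> l -` (\<psi> ` (W \<inter> cdom A i))" for i
    using \<psi>c by (auto simp: c_def inv_psi) (metis Int_iff image_eqI)
  have opJ: "open {t \<in> ?I. c t \<in> cdom A i}" for i
    unfolding cdom by (intro open_Int open_greaterThanLessThan open_vimage opi cont)
  have "smooth_map real_line A ?I c"
  proof (rule smooth_map_real_lineI)
    show "c ` ?I \<subseteq> points A" using \<psi>c openin_subset_points[OF A W] by blast
    fix i
    let ?J = "{t \<in> ?I. c t \<in> cdom A i}"
    show "open ?J" by (rule opJ)
    have "smooth_on ?J (\<lambda>t. t *\<^sub>R e)"
      by (rule smooth_on_linear[OF opJ bounded_linear_scaleR_left])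
    then have "smooth_on ?J l"
      unfolding l_def by (intro smooth_on_add[OF opJ] smooth_on_const)
    then have "smooth_on ?J (\<lambda>t. (cmap A i \<circ> inv_into W \<psi>) (l t))"
      by (intro smooth_on_compose[OF opJ opi[of i] _ _ smi]) (use cdom in blast)+
    then show "smooth_on ?J (cmap A i \<circ> c)" by (simp add: o_def c_def)
  qed
  moreover have "velocity A c 0 = frame e q"
  proof (rule prod_eqI)
    show "snd (velocity A c 0) = snd (frame e q)"
    proof
      fix j
      have l: "(l has_vector_derivative e) (at 0)" unfolding l_def by (auto intro!: derivative_eq_intros)
      have "((cmap A j \<circ> c) has_vector_derivative fd (cmap A j \<circ> inv_into W \<psi>) (\<psi> q) e) (at 0)"
        if j: "q \<in> cdom A j"
      proof (rule has_vector_derivative_compose_eventually[OF l])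
        have "l 0 = \<psi> q" by (simp add: l_def)
        then show "((cmap A j \<circ> inv_into W \<psi>) has_derivative fd (cmap A j \<circ> inv_into W \<psi>) (\<psi> q)) (at (l 0))"
          using param_has_derivative[OF q(1) j] by simp
      qed (simp add: c_def)
      from vector_derivative_at[OF this] show "snd (velocity A c 0) j = snd (frame e q) j"
        by (simp add: velocity_def frame_def c0)
    qed
  qed (simp add: frame_def c0)
  ultimately show "v \<in> tangent_space_of A P q"
    using \<epsilon>(1) c0 cP unfolding tangent_space_of_def e(2)
    by (intro CollectI exI[of _ c] conjI exI[of _ \<epsilon>]) auto
qed

end

lemma embedded_submanifold_slice:
  assumes "smooth_atlas A" "embedded_submanifold A P" "x \<in> P"
  obtains W \<psi> L where "slice A P W \<psi> L" "x \<in> W"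
proof -
  obtain W \<psi> L where "open_nbhd A x W \<and> inj_on \<psi> W \<and> open (\<psi> ` W) \<and> smooth_fun A W \<psi> \<and>
        (\<forall>i. open (\<psi> ` (W \<inter> cdom A i)) \<and>
             smooth_on (\<psi> ` (W \<inter> cdom A i)) (cmap A i \<circ> inv_into W \<psi>)) \<and>
        subspace (L :: 'c set) \<and> \<psi> ` (W \<inter> P) = \<psi> ` W \<inter> L"
    using assms(2,3) unfolding embedded_submanifold_def by blast
  then show thesis using assms(1) by (intro that[of W \<psi> L]) (auto simp: slice_def open_nbhd_def)
qed

text \<open>A tangent space made of velocities of curves carries no evident linear structure. In an
  adapted chart it is the image of the subspace \<open>L\<close> under a map linear in
  \<open>e\<close>, and the field \<open>frame e\<close> extends each of its vectors to a field
  tangent to \<open>P\<close>.\<close>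

lemma tangent_space_of_subspace:
  assumes A: "smooth_atlas A" and P: "embedded_submanifold A P" "x \<in> P"
  shows "tangent_space_of A P x \<subseteq> tangent_space A x"
    "tzero x \<in> tangent_space_of A P x"
    "u \<in> tangent_space_of A P x \<Longrightarrow> u' \<in> tangent_space_of A P x \<Longrightarrow> tadd u u' \<in> tangent_space_of A P x"
    "u \<in> tangent_space_of A P x \<Longrightarrow> tscale c u \<in> tangent_space_of A P x"
    "u \<in> tangent_space_of A P x \<Longrightarrow> \<exists>U. submanifold_field_near A P x U \<and> U x = u"
proof -
  obtain W \<psi> L where sl: "slice A P W \<psi> L" and x: "x \<in> W"
    by (rule embedded_submanifold_slice[OF A P])
  interpret slice A P W \<psi> L by (rule sl)
  note T = tangent_space_of_slice[OF x P(2)]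
  show "tangent_space_of A P x \<subseteq> tangent_space A x"
    unfolding T using frame_tangent[OF x] by blast
  have "frame 0 x = tzero x"
    using frame_linear(2)[OF x, of 0 0] by (simp add: tscale_def tzero_def) (simp add: frame_def)
  then show "tzero x \<in> tangent_space_of A P x"
    unfolding T using subspace_0[OF L] by force
  show "tadd u u' \<in> tangent_space_of A P x" if uu: "u \<in> tangent_space_of A P x" "u' \<in> tangent_space_of A P x"
  proof -
    obtain e e' where "e \<in> L" "e' \<in> L" "u = frame e x" "u' = frame e' x" using uu unfolding T by blast
    then show ?thesis
      unfolding T using subspace_add[OF L, of e e'] frame_linear(1)[OF x, of e e'] by (metis image_eqI)
  qed
  show "tscale c u \<in> tangent_space_of A P x" if uu: "u \<in> tangent_space_of A P x"
  proof -
    obtain e where "e \<in> L" "u = frame e x" using uu unfolding T by blast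
    then show ?thesis
      unfolding T using subspace_scale[OF L, of e c] frame_linear(2)[OF x, of c e] by (metis image_eqI)
  qed
  show "\<exists>U. submanifold_field_near A P x U \<and> U x = u" if u: "u \<in> tangent_space_of A P x"
  proof -
    obtain e where e: "e \<in> L" "u = frame e x" using u unfolding T by blast
    have "\<forall>y\<in>W \<inter> P. frame e y \<in> tangent_space_of A P y" using tangent_space_of_slice e(1) by blast
    then have "submanifold_field_near A P x (frame e)"
      unfolding submanifold_field_near_def open_nbhd_def using W x frame_vector_field by blast
    with e(2) show ?thesis by blast
  qed
qed

section \<open>The second fundamental form\<close>

text \<open>Gram-Schmidt induction: the new vector is made orthogonal to \<open>B\<close> by
  applying the induction hypothesis to its own functional \<open>g a\<close>, and a multiple of the
  result then adjusts the value at \<open>a\<close>.\<close>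

lemma positive_definite_representation_span:
  fixes g :: "'e::euclidean_space \<Rightarrow> 'e \<Rightarrow> real"
  assumes l1: "\<And>a. linear (g a)" and l2: "\<And>c. linear (\<lambda>a. g a c)" and pos: "\<And>a. a \<noteq> 0 \<Longrightarrow> g a a > 0"
  shows "finite B \<Longrightarrow> independent B \<Longrightarrow> \<exists>v\<in>span B. \<forall>z\<in>B. g v z = \<phi> z"
proof (induction B arbitrary: \<phi> rule: finite_induct)
  case empty
  then show ?case by (auto intro: span_0)
next
  case (insert a B)
  have ind: "independent B" "a \<notin> span B" using insert.prems insert.hyps by (auto simp: independent_insert)
  obtain w where w: "w \<in> span B" "\<forall>z\<in>B. g w z = g a z" using insert.IH[OF ind(1), of "g a"] by blast
  obtain v where v: "v \<in> span B" "\<forall>z\<in>B. g v z = \<phi> z" using insert.IH[OF ind(1), of \<phi>] by blast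
  \<comment> \<open>The part of \<open>a\<close> that \<open>g\<close> pairs to 0 with
    \<open>B\<close>; it is nonzero by independence, and \<open>g n a = g n n > 0\<close>.\<close>
  define n where "n = a - w"
  have n0: "n \<noteq> 0" using w(1) ind(2) by (auto simp: n_def)
  have nB: "g n z = 0" if "z \<in> B" for z
    using w(2) that by (simp add: n_def linear_diff[OF l2])
  have "g n w = 0" by (rule linear_eq_0_on_span[OF l1 nB w(1)])
  moreover have "g n a = g n n + g n w" by (simp add: n_def linear_diff[OF l1])
  ultimately have na: "g n a > 0" using pos[OF n0] by simp
  \<comment> \<open>The coefficient repairs the value at \<open>a\<close>; on \<open>B\<close>
    nothing changes because \<open>g n\<close> vanishes there.\<close>
  define v' where "v' = v + ((\<phi> a - g v a) / g n a) *\<^sub>R n"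
  have gv': "g v' z = g v z + ((\<phi> a - g v a) / g n a) * g n z" for z
    by (simp add: v'_def linear_add[OF l2] linear_scale[OF l2])
  have sub: "span B \<subseteq> span (insert a B)" by (rule span_mono) blast
  have "v' \<in> span (insert a B)"
    unfolding v'_def n_def using v(1) w(1) sub
    by (intro span_add span_scale span_diff span_base[of a]) auto
  moreover have "\<forall>z\<in>insert a B. g v' z = \<phi> z"
    using v(2) nB na by (auto simp: gv')
  ultimately show ?case by blast
qed

text \<open>Riesz representation for a functional that is linear on \<open>L\<close> only. Agreement
  on a basis propagates to \<open>L\<close> because the vectors of \<open>L\<close> on which both
  sides agree form a subspace.\<close>

lemma positive_definite_representation:
  fixes g :: "'e::euclidean_space \<Rightarrow> 'e \<Rightarrow> real"
  assumes l1: "\<And>a. linear (g a)" and l2: "\<And>c. linear (\<lambda>a. g a c)" and pos: "\<And>a. a \<noteq> 0 \<Longrightarrow> g a a > 0"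
    and L: "subspace L" and add: "\<And>z z'. z \<in> L \<Longrightarrow> z' \<in> L \<Longrightarrow> \<phi> (z + z') = \<phi> z + \<phi> z'"
    and scale: "\<And>c z. z \<in> L \<Longrightarrow> \<phi> (c *\<^sub>R z) = c * \<phi> z"
  shows "\<exists>v. \<forall>z\<in>L. g v z = \<phi> z"
proof -
  obtain B where B: "B \<subseteq> L" "independent B" "L \<subseteq> span B" by (rule maximal_independent_subset)
  obtain v where v: "\<forall>z\<in>B. g v z = \<phi> z"
    using positive_definite_representation_span[OF l1 l2 pos independent_imp_finite[OF B(2)] B(2)] by blast
  let ?K = "{z \<in> L. g v z = \<phi> z}"
  have "\<phi> 0 = 0" using scale[of 0 0] subspace_0[OF L] by simp
  then have "subspace ?K"
    using L by (auto simp: subspace_def add scale linear_0[OF l1] linear_add[OF l1] linear_scale[OF l1])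
  then have "span B \<subseteq> ?K" using B(1) v by (intro span_minimal) auto
  with B(3) show ?thesis by blast
qed

section \<open>Connections evaluated on lifted fields\<close>

definition vfield :: "('i, 'a, 'e::euclidean_space) atlas \<Rightarrow> ('a \<Rightarrow> ('a, 'i, 'e) tvec) \<Rightarrow>
    ('a, 'i, 'e) tvec \<Rightarrow> ('a, 'i, 'e) ttvec" where
  "vfield A V = (\<lambda>z. vert_lift A z (V (fst z)))"

lemma vertical_field_near_vfield:
  assumes A: "smooth_atlas A" and W: "openin (manifold_topology A) W" and V: "vector_field A W V"
    and w: "w \<in> over A W"
  shows "vertical_field_near A w (vfield A V)"
  unfolding vertical_field_near_def open_nbhd_def vfield_def
  using openin_over[OF A W] vertical_field_vert_lift[OF A W V] w by blast

lemma vert_lift_tops: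
  "vert_lift A w (tadd u v) = tadd (vert_lift A w u) (vert_lift A w v)"
  "vert_lift A w (tzero p) = tzero w"
  by (auto intro!: prod_eqI simp: snd_vert_lift zero_prod_def)

lemma linear_connectionD:
  assumes D: "linear_connection A D" and X: "X \<in> tangent_space (slit A) w"
    and Z: "vertical_field_near A w Z"
  shows "D X Z \<in> vertical_space A w"
    "X' \<in> tangent_space (slit A) w \<Longrightarrow> D (tadd X X') Z = tadd (D X Z) (D X' Z)"
    "vertical_field_near A w Z' \<Longrightarrow> D X (\<lambda>z. tadd (Z z) (Z' z)) = tadd (D X Z) (D X Z')"
    "open_nbhd (slit A) w W \<Longrightarrow> (\<And>z. z \<in> W \<Longrightarrow> Z' z = Z z) \<Longrightarrow> D X Z' = D X Z"
proof -
  note c = mp[OF spec[OF bspec[OF bspec[OF conjunct1[OF D[unfolded linear_connection_def]]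
        tangent_point[OF X]] X]] Z]
  show "D X Z \<in> vertical_space A w" by (rule conjunct1[OF c])
  note c2 = conjunct2[OF c]
  show "D (tadd X X') Z = tadd (D X Z) (D X' Z)" if "X' \<in> tangent_space (slit A) w"
    by (rule bspec[OF conjunct1[OF c2] that])
  note c4 = conjunct2[OF conjunct2[OF c2]]
  show "D X (\<lambda>z. tadd (Z z) (Z' z)) = tadd (D X Z) (D X Z')" if "vertical_field_near A w Z'"
    by (rule mp[OF spec[OF conjunct1[OF c4]] that])
  show "D X Z' = D X Z" if "open_nbhd (slit A) w W" "\<And>z. z \<in> W \<Longrightarrow> Z' z = Z z"
    by (rule mp[OF spec[OF spec[OF conjunct2[OF conjunct2[OF c4]]]], OF conjI[OF that(1) ballI[OF that(2)]]])
qed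

text \<open>\<open>D X 0 = D X (0 + 0) = D X 0 + D X 0\<close>. The case is needed for the torsion
  term in which \<open>J\<close> is applied twice, since \<open>J(JX)\<close> is the zero
  field.\<close>

lemma connection_zero_field:
  fixes A :: "('i, 'a, 'e::euclidean_space) atlas"
  assumes A: "smooth_atlas A" and D: "linear_connection A D" and X: "X \<in> tangent_space (slit A) w"
  shows "vertical_field_near A w tzero" "D X tzero = tzero w"
proof -
  have w: "w \<in> points (slit A)" by (rule tangent_point[OF X])
  have "vector_field A (points A) tzero"
    by (simp add: vector_field_def tzero_tangent[OF A] smooth_on_const)
  moreover have "w \<in> over A (points A)"
    using w tangent_point[of w A "fst w"] by (simp add: over_def points_slit)
  ultimately have "vertical_field_near A w (vfield A tzero)"
    by (rule vertical_field_near_vfield[OF A openin_points[OF A]])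
  then show Z: "vertical_field_near A w tzero" by (simp add: vfield_def vert_lift_tops)
  have "(\<lambda>z. tadd (tzero z) (tzero z)) = (tzero :: ('a, 'i, 'e) tvec \<Rightarrow> ('a, 'i, 'e) ttvec)"
    by (rule ext) (simp add: tadd_def tzero_def)
  moreover have "D X (\<lambda>z. tadd (tzero z) (tzero z)) = tadd (D X tzero) (D X tzero)"
    by (rule linear_connectionD(3)[OF D X Z Z])
  ultimately have eq: "D X tzero = tadd (D X tzero) (D X tzero)" by simp
  have "D X tzero \<in> vertical_space A w" by (rule linear_connectionD(1)[OF D X Z])
  then have "fst (D X tzero) = w" by (auto simp: vertical_space_def tangent_fst)
  moreover have "snd (D X tzero) i = 0" for i
    using arg_cong[OF eq, of "\<lambda>Y. snd Y i"] by simp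
  ultimately show "D X tzero = tzero w" by (intro prod_eqI) (auto simp: fun_eq_iff)
qed

text \<open>(M2) is applied to \<open>\<C>(X, Y)\<close> with \<open>X = (v, 0)\<close>, \<open>v\<close> constant, and \<open>Y = (V(x), 0)\<close> in a
  chart, so that \<open>JX\<close> and \<open>Y\<close> commute and the torsion reduces to \<open>\<nabla>\<^sub>J\<^sub>X V\<close>.\<close>

lemma M2_vertical_derivative:
  fixes A :: "('i, 'a, 'e::euclidean_space) atlas"
  assumes A: "smooth_atlas A" and D: "linear_connection A D" and M2: "M2 A F D"
    and W: "openin (manifold_topology A) W" and V: "vector_field A W V"
    and w: "w \<in> over A W" and v: "v \<in> tangent_space A (fst w)"
  shows "vert_metric A F (D (vert_lift A w v) (vfield A V)) (canonical_field A w) = 0"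
proof -
  let ?B = "slit A" and ?i = "some_chart (slit A) w"
  note B = smooth_atlas_slit[OF A]
  have wp: "w \<in> points ?B" "fst w \<in> W" using w by (auto simp: over_def)
  have i: "w \<in> cdom ?B ?i" by (rule some_chart[OF wp(1)])
  note p = cdom_slitD(1)[OF i]
  let ?O = "over A W \<inter> cdom ?B ?i" and ?z = "cmap ?B ?i w"
  let ?N = "cimg ?B ?i ?O"
  have O: "openin (manifold_topology ?B) ?O" "w \<in> ?O" "?O \<subseteq> cdom ?B ?i"
    using openin_cdom_Int[OF B openin_over[OF A W]] w i by auto
  have N: "open ?N" "?z \<in> ?N" by (rule open_cimg[OF B O(1)]) (use O(2) i in blast)
  have M: "open (cimg A ?i W)" by (rule open_cimg[OF A W])
  have "?N \<subseteq> cimg A ?i W \<times> (- {0 :: 'e})" unfolding cimg_over[OF A, symmetric] by blast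
  then have sub: "fst ` ?N \<subseteq> cimg A ?i W" by auto
  define X where "X w = tvec_of ?B ?i w (snd v ?i, 0)" for w
  define Y where "Y w = tvec_of ?B ?i w (lcomp A ?i V (fst (cmap ?B ?i w)), 0)" for w
  have X: "vector_field ?B ?O X"
    unfolding X_def by (rule vector_field_tvec_of[OF B O(1,3) smooth_on_const])
  have "smooth_on ?N (\<lambda>z. (lcomp A ?i V (fst z), 0))"
    by (intro smooth_on_Pair[OF N(1)] smooth_on_const
        smooth_on_compose[OF N(1) M sub smooth_on_linear[OF N(1) bounded_linear_fst] vector_field_smooth[OF V]])
  from vector_field_tvec_of[OF B O(1,3) this] have Y: "vector_field ?B ?O Y" by (simp add: Y_def[abs_def])
  have sX: "snd (X q) ?i = (snd v ?i, 0)" and sY: "snd (Y q) ?i = (snd (V (fst q)) ?i, 0)"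
    if "q \<in> ?O" for q
    using that by (auto simp: X_def Y_def snd_tvec_of_self[OF B] cmap_slit cinv_cmap[OF A] cdom_slitD(1))
  have JX: "vector_field ?B ?O (\<lambda>z. J_map A (X z))" by (rule vector_field_J_map[OF A O(1) X])
  have JXq: "snd (J_map A (X q)) ?i = (0, snd v ?i)" if "q \<in> ?O" for q
    using snd_J_map[OF A vector_field_tangent[OF X that], of ?i] that by (auto simp: sX)
  have JXw: "J_map A (X w) = vert_lift A w v"
    using JXq[OF O(2)] i
    by (intro tangent_eqI[OF vector_field_tangent[OF JX O(2)] vert_lift_tangent[OF A wp(1) v] i])
      (simp add: snd_vert_lift)
  have JYq: "J_map A (Y q) = vfield A V q" if q: "q \<in> ?O" for q
  proof -
    have q': "q \<in> points ?B" "V (fst q) \<in> tangent_space A (fst q)" "q \<in> cdom ?B ?i"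
      using q vector_field_tangent[OF V] by (auto simp: over_def)
    show ?thesis
      unfolding vfield_def
      using snd_J_map[OF A vector_field_tangent[OF Y q] q'(3)] q'
      by (intro tangent_eqI[OF J_map_tangent[OF A vector_field_tangent[OF Y q]] vert_lift_tangent[OF A q'(1,2)] q'(3)])
        (simp add: snd_vert_lift sY[OF q])
  qed
  have JJX: "J_map A (J_map A (X q)) = tzero q" if q: "q \<in> ?O" for q
  proof -
    have q': "q \<in> points ?B" "q \<in> cdom ?B ?i" using q by (auto simp: over_def)
    show ?thesis
      using snd_J_map[OF A vector_field_tangent[OF JX q] q'(2)]
      by (intro tangent_eqI[OF J_map_tangent[OF A vector_field_tangent[OF JX q]] tzero_tangent[OF B q'(1)] q'(2)])
        (simp add: JXq[OF q] zero_prod_def)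
  qed
  have lc: "lcomp ?B ?i Z z = h z" if "\<And>q. q \<in> ?O \<Longrightarrow> snd (Z q) ?i = h (cmap ?B ?i q)" "z \<in> ?N" for Z h z
    using that by (auto simp: cinv_slit_cmap[OF A])
  have dX: "fd (lcomp ?B ?i (\<lambda>z. J_map A (X z))) ?z = (\<lambda>_. 0)"
    using fd_cong_open[OF N lc[of "\<lambda>z. J_map A (X z)" "\<lambda>_. (0, snd v ?i)"]] JXq by simp
  \<comment> \<open>The components of \<open>Y\<close> depend on \<open>x\<close> alone, so they do
    not change in the fibre direction of \<open>JX\<close>.\<close>
  have dY: "fd (lcomp ?B ?i Y) ?z (0, c) = 0" for c
  proof -
    have 1: "fd (lcomp ?B ?i Y) ?z = fd (\<lambda>z. (lcomp A ?i V (fst z), 0)) ?z"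
      using lc[of Y "\<lambda>z. (lcomp A ?i V (fst z), 0)"] sY
      by (intro fd_cong_open[OF N]) (auto simp: cmap_slit cinv_cmap[OF A] cdom_slitD(1))
    have "(lcomp A ?i V has_derivative fd (lcomp A ?i V) (cmap A ?i (fst w))) (at (fst ?z))"
      using vector_field_has_derivative[OF V wp(2) p] by (simp add: cmap_slit)
    then have "((\<lambda>z. (lcomp A ?i V (fst z), 0)) has_derivative
        (\<lambda>v. (fd (lcomp A ?i V) (cmap A ?i (fst w)) (fst v), 0))) (at ?z)"
      by (intro has_derivative_Pair has_derivative_const
          has_derivative_compose[OF bounded_linear_imp_has_derivative[OF bounded_linear_fst]])
    note 2 = fd_eqI[OF this]
    have 3: "linear (fd (lcomp A ?i V) (cmap A ?i (fst w)))"
      by (rule has_derivative_linear[OF vector_field_has_derivative[OF V wp(2) p]])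
    show ?thesis unfolding 1 2 by (simp add: linear_0[OF 3] zero_prod_def)
  qed
  have br: "bracket ?B (\<lambda>z. J_map A (X z)) Y w \<in> tangent_space ?B w"
    by (rule bracket_tangent[OF B O(1,2) JX Y])
  have "snd (bracket ?B (\<lambda>z. J_map A (X z)) Y w) ?i = 0"
    using i by (simp add: bracket_def dX dY JXq[OF O(2)])
  then have "J_map A (bracket ?B (\<lambda>z. J_map A (X z)) Y w) = tzero w"
    using snd_J_map[OF A br i]
    by (intro tangent_eqI[OF J_map_tangent[OF A br] tzero_tangent[OF B wp(1)] i]) (simp add: zero_prod_def)
  moreover have On: "open_nbhd ?B w ?O" using O by (simp add: open_nbhd_def)
  have "D (vert_lift A w v) (\<lambda>z. J_map A (Y z)) = D (vert_lift A w v) (vfield A V)"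
    by (rule linear_connectionD(4)[OF D vert_lift_tangent[OF A wp(1) v] vertical_field_near_vfield[OF A W V w] On JYq])
  moreover have "D (Y w) (\<lambda>z. J_map A (J_map A (X z))) = D (Y w) tzero"
    using vector_field_tangent[OF Y O(2)]
    by (intro linear_connectionD(4)[OF D _ _ On] JJX connection_zero_field(1)[OF A D])
  moreover note connection_zero_field(2)[OF A D vector_field_tangent[OF Y O(2)]]
  moreover have "tsub (tsub R (tzero w)) (tzero w) = R" for R :: "('a, 'i, 'e) ttvec"
    by (simp add: tsub_def tzero_def)
  ultimately have "C_tensor A D X Y w = D (vert_lift A w v) (vfield A V)"
    by (simp add: C_tensor_def torsion_def JXw)
  moreover have "field_near ?B w X" "field_near ?B w Y"
    using On X Y by (auto simp: field_near_def)
  ultimately show ?thesis using M2 wp(1) unfolding M2_def by metis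
qed

text \<open>Vanishing along the curve determines the directional derivative only if
  \<open>g(V^v, C)\<close> is differentiable on an open set of the slit bundle; its form
  \<open>dE(0, V)\<close>, a first derivative of the energy \<open>E\<close>, provides this.\<close>

lemma metric_derivative_along_normals:
  assumes A: "smooth_atlas A" and F: "finsler_metric A F"
    and W: "openin (manifold_topology A) W" and V: "vector_field A W V"
    and VP: "\<forall>y\<in>W \<inter> P. V y \<in> tangent_space_of A P y"
    and c: "smooth_map real_line (slit A) I c" "0 \<in> I" "open I" "c ` I \<subseteq> normal_vectors A F P"
    and c0: "fst (c 0) \<in> W"
  shows "dir_deriv (slit A) (\<lambda>z. vert_metric A F (vfield A V z) (canonical_field A z)) (velocity (slit A) c 0) = 0"
proof -
  let ?B = "slit A" and ?i = "some_chart (slit A) (c 0)"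
  let ?f = "\<lambda>z. vert_metric A F (vfield A V z) (canonical_field A z)"
  note B = smooth_atlas_slit[OF A]
  have wp: "c 0 \<in> points ?B" using smooth_map_real_line(1)[OF c(1)] c(2) by blast
  have i: "c 0 \<in> cdom ?B ?i" by (rule some_chart[OF wp])
  let ?N = "cimg ?B ?i (over A W)" and ?z = "cmap ?B ?i (c 0)"
  have O: "c 0 \<in> over A W" using wp c0 by (simp add: over_def)
  have N: "open ?N" "?z \<in> ?N" using open_cimg[OF B openin_over[OF A W]] O i by auto
  have M: "open (cimg A ?i W)" by (rule open_cimg[OF A W])
  have sub: "fst ` ?N \<subseteq> cimg A ?i W" unfolding cimg_over[OF A] by auto
  have val: "?f w = fundamental_tensor F w (V (fst w)) w" if "w \<in> over A W" for w
    using that vector_field_tangent[OF V, of "fst w"]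
    by (auto simp: over_def vfield_def canonical_field_def points_slit intro!: vert_metric_vert_lift[OF A])
  have "smooth_on ?N (\<lambda>z. fd (energy A F ?i) z (0, lcomp A ?i V (fst z)))"
  proof (rule smooth_on_fd_apply[where p = "\<lambda>z. z", OF N(1) _ open_slit_img[OF A] smooth_on_energy[OF A F]])
    show "smooth_on ?N (\<lambda>z. (0, lcomp A ?i V (fst z)))"
      by (intro smooth_on_Pair[OF N(1)] smooth_on_const
        smooth_on_compose[OF N(1) M sub smooth_on_linear[OF N(1) bounded_linear_fst] vector_field_smooth[OF V]])
    show "smooth_on ?N (\<lambda>z. z)" by (rule smooth_on_linear[OF N(1) bounded_linear_ident])
  qed auto
  then have "smooth_on ?N (?f \<circ> cinv ?B ?i)"
  proof (rule smooth_on_transform[OF _ N(1)])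
    fix z assume "z \<in> ?N"
    then obtain w where w: "w \<in> over A W" "w \<in> cdom ?B ?i" "z = cmap ?B ?i w" by blast
    have "V (fst w) \<in> tangent_space A (fst w)" using vector_field_tangent[OF V] w(1) by (simp add: over_def)
    from fundamental_tensor_self(2)[OF A F w(2) this]
    show "(?f \<circ> cinv ?B ?i) z = fd (energy A F ?i) z (0, lcomp A ?i V (fst z))"
      by (simp add: w(3) cinv_slit_cmap[OF A w(2)] val[OF w(1)])
        (simp add: cmap_slit cinv_cmap[OF A cdom_slitD(1)[OF w(2)]])
  qed
  note d = smooth_on_has_derivative[OF this N(2)]
  have X: "velocity ?B c 0 \<in> tangent_space ?B (c 0)" by (rule velocity_tangent[OF B c(1,2)])
  have ev: "eventually (\<lambda>t. 0 = (?f \<circ> cinv ?B ?i) ((cmap ?B ?i \<circ> c) t)) (nhds 0)"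
    using curve_stays_near[OF B c(1,2) openin_over[OF A W] O] curve_stays_near[OF B c(1,2) openin_cdom[OF B] i]
      eventually_nhds_in_open[OF c(3,2)]
  proof eventually_elim
    case (elim t)
    have n: "c t \<in> normal_vectors A F P" using c(4) elim(3) by blast
    then have "V (fst (c t)) \<in> tangent_space_of A P (fst (c t))"
      using VP elim(1) by (auto simp: normal_vectors_def over_def)
    with n have 0: "fundamental_tensor F (c t) (c t) (V (fst (c t))) = 0" by (auto simp: normal_vectors_def)
    have "V (fst (c t)) \<in> tangent_space A (fst (c t))"
      using vector_field_tangent[OF V] elim(1) by (simp add: over_def)
    from fundamental_tensor_self[OF A F elim(2) this] 0 have "fundamental_tensor F (c t) (V (fst (c t))) (c t) = 0"
      by simp
    then show ?case by (simp add: cinv_slit_cmap[OF A elim(2)] val[OF elim(1)])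
  qed
  have "((\<lambda>t. 0) has_vector_derivative fd (?f \<circ> cinv ?B ?i) ?z (snd (velocity ?B c 0) ?i)) (at 0)"
    by (rule has_vector_derivative_compose_eventually[OF velocity_works[OF c(1,2) i] _ ev])
      (unfold comp_apply[of "cmap ?B ?i"], rule d)
  then have "fd (?f \<circ> cinv ?B ?i) ?z (snd (velocity ?B c 0) ?i) = 0"
    using has_vector_derivative_const vector_derivative_unique_at by blast
  then show ?thesis using dir_deriv_chart[OF B X i d] by simp
qed

text \<open>The vertical lift of \<open>v'\<close> that separates \<open>X\<close> from the
  horizontal lift of \<open>u\<close> is the same vector that the lift condition yields as
  \<open>\<nabla>_X C\<close>; one choice of \<open>v'\<close> thus controls both terms of the
  metric derivative.\<close>

lemma fundamental_tensor_normal_derivative: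
  fixes A :: "('i, 'a, 'e::euclidean_space) atlas"
  assumes A: "smooth_atlas A" and F: "finsler_metric A F" and S: "geodesic_spray A F S"
    and P: "embedded_submanifold A P" "x \<in> P" and \<eta>: "fst \<eta> = x" "\<eta> \<in> normal_vectors A F P"
    and b: "symmetric_bilinear_on (tangent_space_of A P x) b"
    and split: "split_map A S ` tangent_space_of (slit A) (normal_vectors A F P) \<eta> =
           {(u, v). u \<in> tangent_space_of A P x \<and> v \<in> tangent_space A x \<and>
                    (\<forall>z\<in>tangent_space_of A P x. fundamental_tensor F \<eta> v z + b u z = 0)}"
    and D: "lift_of_Gamma A S D" and M1: "M1 A F D" and M2: "M2 A F D"
    and u: "u \<in> tangent_space_of A P x" and V: "submanifold_field_near A P x V"
  shows "affine_deriv A S D \<eta> u V \<in> tangent_space A x"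
    "fundamental_tensor F \<eta> \<eta> (affine_deriv A S D \<eta> u V) = b u (V x)"
proof -
  let ?B = "slit A" and ?T = "tangent_space_of A P x" and ?g = "fundamental_tensor F \<eta>"
  note B = smooth_atlas_slit[OF A]
  note sub = tangent_space_of_subspace[OF A P]
  have \<eta>p: "\<eta> \<in> points ?B" using \<eta>(2) by (simp add: normal_vectors_def)
  let ?i = "some_chart ?B \<eta>"
  have i: "\<eta> \<in> cdom ?B ?i" by (rule some_chart[OF \<eta>p])
  have \<eta>t: "\<eta> \<in> tangent_space A x" using cdom_slitD(2)[OF i] \<eta>(1) by simp
  have p: "x \<in> cdom A ?i" using cdom_slitD(1)[OF i] \<eta>(1) by simp
  have sym: "?g v w = ?g w v" if "v \<in> tangent_space A x" "w \<in> tangent_space A x" for v w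
    using fundamental_tensor_sym[OF A F \<eta>p] that \<eta>(1) by simp
  have vm: "vert_metric A F (vert_lift A \<eta> v) (vert_lift A \<eta> w) = ?g v w"
    if "v \<in> tangent_space A x" "w \<in> tangent_space A x" for v w
    using vert_metric_vert_lift[OF A \<eta>p] that \<eta>(1) by simp
  have vlt: "vert_lift A \<eta> v \<in> tangent_space ?B \<eta>" if "v \<in> tangent_space A x" for v
    using vert_lift_tangent[OF A \<eta>p] that \<eta>(1) by simp
  have vi: "vert_inv A (vert_lift A \<eta> v) = v" if "v \<in> tangent_space A x" for v
    using vert_inv_vert_lift[OF A \<eta>p] that \<eta>(1) by simp
  have Ex: "\<exists>a\<in>tangent_space A x. X = vert_lift A \<eta> a" if "X \<in> vertical_space A \<eta>" for X
    using vertical_spaceE[OF A that] \<eta>(1) by metis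

  \<comment> \<open>\<open>b u\<close> is controlled on \<open>?T\<close> only, so the functional
    \<open>- b u\<close> is represented on the subspace \<open>?L\<close> of
    \<open>i\<close>-components of \<open>?T\<close>, with the Hessian as inner product.\<close>
  obtain v' where v': "v' \<in> tangent_space A x" "\<forall>z\<in>?T. ?g v' z + b u z = 0"
  proof -
    let ?H = "hess A F ?i (cmap ?B ?i \<eta>)" and ?L = "(\<lambda>z. snd z ?i) ` ?T"
    have z: "cmap ?B ?i \<eta> \<in> cmap ?B ?i ` cdom ?B ?i" using i by blast
    have gH: "?g v w = ?H (snd v ?i) (snd w ?i)" if "v \<in> tangent_space A x" "w \<in> tangent_space A x" for v w
      using fundamental_tensor_chart[OF A F i] that \<eta>(1) by simp
    have tv: "tvec_of A ?i x a \<in> tangent_space A x" "snd (tvec_of A ?i x a) ?i = a" for a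
      using tvec_of_tangent[OF A p] snd_tvec_of_self[OF A p] by auto
    have "?H a a > 0" if a: "a \<noteq> 0" for a
    proof -
      have "tvec_of A ?i x a \<noteq> tzero x" using tv(2)[of a] a by auto
      then have "?g (tvec_of A ?i x a) (tvec_of A ?i x a) > 0"
        using F \<eta>p tv(1) \<eta>(1) by (simp add: finsler_metric_def)
      then show ?thesis using gH[OF tv(1) tv(1)] tv(2) by simp
    qed
    note pos = this
    have inT: "tvec_of A ?i x a \<in> ?T" if "a \<in> ?L" for a
      using that sub(1) tvec_of_snd[OF A _ p] by auto
    have Ladd: "tvec_of A ?i x (a + c) = tadd (tvec_of A ?i x a) (tvec_of A ?i x c)" for a c
      by (rule tangent_eqI[OF tv(1) tangent_closed(1)[OF A tv(1) tv(1)] p]) (simp add: tv(2))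
    have Lscale: "tvec_of A ?i x (r *\<^sub>R a) = tscale r (tvec_of A ?i x a)" for a r
      by (rule tangent_eqI[OF tv(1) tangent_closed(3)[OF A tv(1)] p]) (simp add: tv(2))
    have L: "subspace ?L"
      unfolding subspace_def
    proof (intro conjI ballI allI)
      show "0 \<in> ?L" using sub(2) by force
      fix a r assume "a \<in> ?L"
      then obtain w where w: "w \<in> ?T" "a = snd w ?i" by blast
      then have "r *\<^sub>R a = snd (tscale r w) ?i" by simp
      then show "r *\<^sub>R a \<in> ?L" using sub(4)[OF w(1)] by blast
      fix c assume "c \<in> ?L"
      then obtain w' where w': "w' \<in> ?T" "c = snd w' ?i" by blast
      with w have "a + c = snd (tadd w w') ?i" by simp
      then show "a + c \<in> ?L" using sub(3)[OF w(1) w'(1)] by blast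
    qed
    have bb: "b u (tadd w w') = b u w + b u w'" if "w \<in> ?T" "w' \<in> ?T" for w w'
      using b u that sub(3)[OF that] unfolding symmetric_bilinear_on_def by metis
    have bs: "b u (tscale r w) = r * b u w" if "w \<in> ?T" for w r
      using b u that sub(4)[OF that] unfolding symmetric_bilinear_on_def by metis
    have "\<exists>a. \<forall>z\<in>?L. ?H a z = - b u (tvec_of A ?i x z)"
      by (rule positive_definite_representation[OF hess_linear(2,3)[OF A F z] pos L])
        (simp_all only: Ladd Lscale bb bs inT mult_minus_right minus_add_distrib not_False_eq_True)
    then obtain a where a: "\<forall>z\<in>?L. ?H a z = - b u (tvec_of A ?i x z)" by blast
    show thesis
    proof (rule that[OF tv(1)[of a]], intro ballI)
      fix w assume w: "w \<in> ?T"
      then have "w \<in> tangent_space A x" using sub(1) by blast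
      then show "?g (tvec_of A ?i x a) w + b u w = 0"
        using a w gH[OF tv(1)] tvec_of_snd[OF A _ p] by (simp add: tv(2))
    qed
  qed
  then have "(u, v') \<in> split_map A S ` tangent_space_of ?B (normal_vectors A F P) \<eta>"
    unfolding split using u by blast
  then obtain X where X: "X \<in> tangent_space_of ?B (normal_vectors A F P) \<eta>"
    "d_proj A X = u" "vert_inv A (vert_proj A S X) = v'" by (auto simp: split_map_def)
  then obtain c \<epsilon> where c: "X = velocity ?B c 0" "c 0 = \<eta>" "\<epsilon> > 0"
    "smooth_map real_line ?B {-\<epsilon><..<\<epsilon>} c" "c ` {-\<epsilon><..<\<epsilon>} \<subseteq> normal_vectors A F P"
    unfolding tangent_space_of_def by blast
  have I: "0 \<in> {-\<epsilon><..<\<epsilon>}" using c(3) by simp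
  have Xt: "X \<in> tangent_space ?B \<eta>" using velocity_tangent[OF B c(4) I] c(1,2) by simp
  obtain W where W: "openin (manifold_topology A) W" "x \<in> W" "vector_field A W V"
    "\<forall>y\<in>W \<inter> P. V y \<in> tangent_space_of A P y"
    using V by (auto simp: submanifold_field_near_def open_nbhd_def)
  have \<eta>W: "\<eta> \<in> over A W" using \<eta>p \<eta>(1) W(2) by (simp add: over_def)
  have Vx: "V x \<in> ?T" "V x \<in> tangent_space A x"
    using W(2,4) P(2) vector_field_tangent[OF W(3,2)] by blast+

  have sp: "vector_field ?B (points ?B) S" "\<forall>w\<in>points ?B. d_proj A (S w) = w"
    using S d_proj_spray[OF A F S] by (auto simp: geodesic_spray_def)
  note dec = horizontal_vertical_decomposition[OF A sp Xt]
  have vp: "vert_proj A S X = vert_lift A \<eta> v'"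
    using Ex[OF dec(1)] vi X(3) by auto
  define H where "H = hor_lift A S \<eta> u"
  have H: "H \<in> tangent_space ?B \<eta>" "X = tadd H (vert_lift A \<eta> v')"
    using dec(2,3) by (auto simp: H_def X(2) vp tadd_def tsub_def prod_eq_iff fun_eq_iff)
  have Dl: "linear_connection A D" and DC: "D X (canonical_field A) = vert_lift A \<eta> v'"
    using D \<eta>p Xt vp by (auto simp: lift_of_Gamma_def)
  let ?Z = "vfield A V"
  have Z: "vertical_field_near A \<eta> ?Z" by (rule vertical_field_near_vfield[OF A W(1,3) \<eta>W])
  have DX: "D X ?Z = tadd (D H ?Z) (D (vert_lift A \<eta> v') ?Z)"
    unfolding H(2) by (rule linear_connectionD(2)[OF Dl H(1) Z vlt[OF v'(1)]])
  have "D H ?Z \<in> vertical_space A \<eta>" "D (vert_lift A \<eta> v') ?Z \<in> vertical_space A \<eta>"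
    using linear_connectionD(1)[OF Dl _ Z] H(1) vlt[OF v'(1)] by blast+
  then obtain a a' where a: "a \<in> tangent_space A x" "D H ?Z = vert_lift A \<eta> a"
    "a' \<in> tangent_space A x" "D (vert_lift A \<eta> v') ?Z = vert_lift A \<eta> a'"
    using Ex by meson
  have ad: "affine_deriv A S D \<eta> u V = a"
    using vi[OF a(1)] a(2) by (simp add: affine_deriv_def H_def vfield_def)
  then show "affine_deriv A S D \<eta> u V \<in> tangent_space A x" using a(1) by simp
  have C: "canonical_field A \<eta> = vert_lift A \<eta> \<eta>" by (simp add: canonical_field_def)
  have ga': "?g a' \<eta> = 0"
    using M2_vertical_derivative[OF A Dl M2 W(1,3) \<eta>W, of v'] v'(1) \<eta>(1) a(3,4) vm[OF a(3) \<eta>t] by (simp add: C)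
  have "nabla_g A F D X ?Z (canonical_field A) = 0"
    using M1 \<eta>p Xt Z by (simp add: M1_def)
  moreover have "dir_deriv ?B (\<lambda>z. vert_metric A F (?Z z) (canonical_field A z)) X = 0"
    unfolding c(1)
    by (rule metric_derivative_along_normals[OF A F W(1,3,4) c(4) I open_greaterThanLessThan c(5)])
      (simp add: c(2) \<eta>(1) W(2))
  moreover have "D X ?Z = vert_lift A \<eta> (tadd a a')" by (simp add: DX a(2,4) vert_lift_tops)
  moreover have "?Z \<eta> = vert_lift A \<eta> (V x)" by (simp add: vfield_def \<eta>(1))
  moreover have aa: "tadd a a' \<in> tangent_space A x" by (rule tangent_closed(1)[OF A a(1,3)])
  \<comment> \<open>(M1) with vanishing derivative of the metric function reads
    \<open>0 = - g(\<nabla>_X V, C) - g(V, \<nabla>_X C)\<close>; the two covariant derivatives are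
    the lifts of \<open>a + a'\<close> and \<open>v'\<close>.\<close>
  ultimately have "?g (tadd a a') \<eta> + ?g (V x) v' = 0"
    using vm[OF aa \<eta>t] vm[OF Vx(2) v'(1)] by (simp add: nabla_g_def tangent_fst[OF Xt] DC C)
  moreover have "?g (tadd a a') \<eta> = ?g \<eta> a + ?g \<eta> a'"
    using fundamental_tensor_linear(1)[OF A F \<eta>p, of a a' \<eta>] a(1,3) \<eta>t \<eta>(1) sym[OF aa \<eta>t] by simp
  moreover have "?g v' (V x) + b u (V x) = 0" using v'(2) Vx(1) by blast
  ultimately show "?g \<eta> (affine_deriv A S D \<eta> u V) = b u (V x)"
    using sym[OF Vx(2) v'(1)] sym[OF a(3) \<eta>t] ga' by (simp add: ad)
qed

theorem proposition5p3:
  fixes A :: "('i, 'a, 'e::euclidean_space) atlas"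
    and F :: "('a, 'i, 'e) tvec \<Rightarrow> real"
    and S :: "('a, 'i, 'e) tvec \<Rightarrow> ('a, 'i, 'e) ttvec"
    and P :: "'a set" and x :: 'a and \<eta> :: "('a, 'i, 'e) tvec"
    and b :: "('a, 'i, 'e) tvec \<Rightarrow> ('a, 'i, 'e) tvec \<Rightarrow> real"
    and D :: "('a, 'i, 'e) conn"
  assumes "smooth_manifold A"
    and "finsler_metric A F"
    and "geodesic_spray A F S"
    and "embedded_submanifold A P"
    and "x \<in> P"
    and "fst \<eta> = x" and "\<eta> \<in> normal_vectors A F P"
    and "symmetric_bilinear_on (tangent_space_of A P x) b"
    and "split_map A S ` tangent_space_of (slit A) (normal_vectors A F P) \<eta> =
           {(u, v). u \<in> tangent_space_of A P x \<and> v \<in> tangent_space A x \<and>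
                    (\<forall>z\<in>tangent_space_of A P x. fundamental_tensor F \<eta> v z + b u z = 0)}"
    and "lift_of_Gamma A S D"
    and "M1 A F D"
    and "M2 A F D"
  shows "\<forall>u\<in>tangent_space_of A P x. \<forall>v\<in>tangent_space_of A P x.
           b u v = second_fundamental_form A F S D P \<eta> u v"
proof (intro ballI)
  fix u v assume uv: "u \<in> tangent_space_of A P x" "v \<in> tangent_space_of A P x"
  have A: "smooth_atlas A" using assms(1) by (simp add: smooth_manifold_def)
  note key = fundamental_tensor_normal_derivative[OF A assms(2-12)]
  have \<eta>p: "\<eta> \<in> points (slit A)" and \<eta>t: "\<eta> \<in> tangent_space A (fst \<eta>)"
    using assms(7) by (auto simp: normal_vectors_def points_slit)
  have val: "b u v = 1/2 * fundamental_tensor F \<eta> \<eta>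
      (tadd (affine_deriv A S D \<eta> u V) (affine_deriv A S D \<eta> v U))"
    if UV: "submanifold_field_near A P x U" "U x = u" "submanifold_field_near A P x V" "V x = v" for U V
  proof -
    have "fundamental_tensor F \<eta> \<eta> (tadd (affine_deriv A S D \<eta> u V) (affine_deriv A S D \<eta> v U)) = b u v + b v u"
      using fundamental_tensor_linear(1)[OF A assms(2) \<eta>p _ _ \<eta>t] key[OF uv(1) UV(3)] key[OF uv(2) UV(1)]
      by (simp add: assms(6) UV)
    moreover have "b v u = b u v" using assms(8) uv by (simp add: symmetric_bilinear_on_def)
    ultimately show ?thesis by simp
  qed
  \<comment> \<open>Without extensions of \<open>u\<close> and \<open>v\<close> tangent to
    \<open>P\<close> every \<open>r\<close> would satisfy the description vacuously, so their
    existence is what fixes its value.\<close>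
  obtain U V where UV: "submanifold_field_near A P x U" "U x = u" "submanifold_field_near A P x V" "V x = v"
    using tangent_space_of_subspace(5)[OF A assms(4,5)] uv by metis
  show "b u v = second_fundamental_form A F S D P \<eta> u v"
    unfolding second_fundamental_form_def assms(6)
  proof (rule the_equality[symmetric])
    show "\<forall>U V. submanifold_field_near A P x U \<and> U x = u \<and> submanifold_field_near A P x V \<and> V x = v \<longrightarrow>
        b u v = 1/2 * fundamental_tensor F \<eta> \<eta> (tadd (affine_deriv A S D \<eta> u V) (affine_deriv A S D \<eta> v U))"
      using val by blast
    fix r
    assume "\<forall>U V. submanifold_field_near A P x U \<and> U x = u \<and> submanifold_field_near A P x V \<and> V x = v \<longrightarrow>
        r = 1/2 * fundamental_tensor F \<eta> \<eta> (tadd (affine_deriv A S D \<eta> u V) (affine_deriv A S D \<eta> v U))"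
    then show "r = b u v" using UV val[OF UV] by metis
  qed
qed

end
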